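(* Let $\Omega\subset\mathbb R^n$ be a bounded domain and let $\mathbf p=(p_1,\dots,p_n)$ satisfy $1<p_1\le\dots\le p_n<\infty$ and $\bar{\mathbf p}<n$. Let $u\in W^{1,\mathbf p}_0(\Omega)$, $u\neq0$. Then $u$ is a critical point of $\mathcal Q_{\mathbf p}$ if and only if, for some $\lambda\in\mathbb R$, $u$ is a weak solution of $$-\mathcal L_{\mathbf p}u=\lambda\,\mathcal F_{\mathbf p}(u)\ \text{ in }\Omega,\qquad u=0\ \text{ in }\mathbb R^n\setminus\Omega.$$
   Context: Harmonic mean: $\bar{\mathbf p}=\left(\frac1n\sum_{i=1}^n\frac1{p_i}\right)^{-1}$. Mixed Lebesgue norm: for measurable $u:\mathbb R^n\to\mathbb R$ put $I_1(u)=\left(\int_{\mathbb R}|u|^{p_1}dx_1\right)^{1/p_1}$, $I_j(u)=\left(\int_{\mathbb R}I_{j-1}(u)^{p_j}dx_j\right)^{1/p_j}$ for $j=2,\dots,n$ (a function of $(x_{j+1},\dots,x_n)$), and $\|u\|_{\mathbf p}=I_n(u)$. $L^{\mathbf p}(\mathbb R^n)$ is the space of measurable $u$ with $\|u\|_{\mathbf p}<\infty$. $W^{1,\mathbf p}(\mathbb R^n)=\{u\in L^{\mathbf p}(\mathbb R^n): u_{x_i}\in L^{p_i}(\mathbb R^n),\ i=1,\dots,n\}$ with norm $\|u\|_{\mathbf p}+\|\nabla u\|_{\mathbf p}$, where $\|\nabla u\|_{\mathbf p}=\sum_{i=1}^n\|u_{x_i}\|_{p_i}$ and $\|\cdot\|_{p_i}$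 is the usual $L^{p_i}(\mathbb R^n)$ norm. $W^{1,\mathbf p}_0(\Omega)$ is the closure of $C_c^\infty(\Omega)$ in $W^{1,\mathbf p}(\mathbb R^n)$. $\mathcal Q_{\mathbf p}(u)=\|\nabla u\|_{\mathbf p}/\|u\|_{\mathbf p}$ for $u\in W^{1,\mathbf p}_0(\Omega)\setminus\{0\}$; $u\ne0$ is a critical point if $\frac{d}{dt}\mathcal Q_{\mathbf p}(u+tv)|_{t=0}=0$ for all $v\in W^{1,\mathbf p}_0(\Omega)$. $-\mathcal L_{\mathbf p}u=-\operatorname{div}$ of the vector field with $i$-th component $\left|\frac{u_{x_i}}{\|u_{x_i}\|_{p_i}}\right|^{p_i-2}\frac{u_{x_i}}{\|u_{x_i}\|_{p_i}}$, and $\mathcal F_{\mathbf p}(u)=\prod_{i=1}^n I_i(u)^{p_{i+1}-p_i}|u|^{p_1-2}u$ with $p_{n+1}=1$ (understood as $0$ where $u=0$). Weak solution of the problem with parameter $\lambda$ means $$\int_\Omega\sum_{i=1}^n\left|\frac{u_{x_i}}{\|u_{x_i}\|_{p_i}}\right|^{p_i-2}\frac{u_{x_i}}{\|u_{x_i}\|_{p_i}}v_{x_i}\,dx=\lambda\int_\Omega\mathcal F_{\mathbf p}(u)v\,dx\quad\text{for all }v\in W^{1,\mathbf p}_0(\Omega).$$ *)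

theory Defs
  imports "HOL-Analysis.Analysis"
begin

text \<open>
  Euclidean space is \<open>real ^ 'n\<close> for a finite linearly ordered index type. The order matters because
  the mixed norm integrates out the coordinates one after the other. \<open>coord j\<close> is the \<open>j\<close>-th
  smallest index, \<open>j = 1, \<dots>, CARD('n)\<close>, so that \<open>x $ coord j\<close> is the \<open>j\<close>-th coordinate and
  \<open>p (coord j)\<close> is the \<open>j\<close>-th exponent.

  Functions are Lebesgue measurable representatives of their classes modulo almost everywhere
  equality.
\<close>

definition coord :: "nat \<Rightarrow> 'n::{finite,linorder}" where
  "coord j = sorted_list_of_set UNIV ! (j - 1)"

lemma coord_strict_mono_on:
  "strict_mono_on {1..CARD('n)} (coord :: nat \<Rightarrow> 'n::{finite,linorder})"
proof (rule strict_mono_onI)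
  fix i j :: nat
  assume "i \<in> {1..CARD('n)}" "j \<in> {1..CARD('n)}" "i < j"
  then have *: "i - 1 < j - 1" "j - 1 < length (sorted_list_of_set (UNIV :: 'n set))"
    by auto
  show "(coord i :: 'n) < coord j"
    unfolding coord_def using sorted_wrt_nth_less[OF strict_sorted_list_of_set *] .
qed

lemma coord_bij_betw:
  "bij_betw (coord :: nat \<Rightarrow> 'n::{finite,linorder}) {1..CARD('n)} UNIV"
proof -
  have inj: "inj_on (coord :: nat \<Rightarrow> 'n) {1..CARD('n)}"
    using coord_strict_mono_on by (rule strict_mono_on_imp_inj_on)
  then have "card ((coord :: nat \<Rightarrow> 'n) ` {1..CARD('n)}) = CARD('n)"
    by (simp add: card_image)
  then have "(coord :: nat \<Rightarrow> 'n) ` {1..CARD('n)} = UNIV"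
    by (intro card_subset_eq) auto
  with inj show ?thesis by (simp add: bij_betw_def)
qed

definition harmonic_mean :: "('n::finite \<Rightarrow> real) \<Rightarrow> real" where
  "harmonic_mean p = inverse ((1 / real CARD('n)) * (\<Sum>i\<in>UNIV. 1 / p i))"


subsection \<open>Norms\<close>

text \<open>Real power on \<open>[0, \<infinity>]\<close>; used for positive exponents only.\<close>

definition epowr :: "ennreal \<Rightarrow> real \<Rightarrow> ennreal" where
  "epowr a r = (if a = \<infinity> then \<infinity> else ennreal (enn2real a powr r))"

text \<open>
  \<open>mixed_int p u j\<close> is $I_j(u)$, with $I_0(u) = |u|$. It is kept as a function of the whole point \<open>x\<close>
  although it does not depend on the first \<open>j\<close> coordinates.
\<close>

primrec mixed_int ::
  "('n::{finite,linorder} \<Rightarrow> real) \<Rightarrow> (real^'n::_ \<Rightarrow> real) \<Rightarrow> nat \<Rightarrow> real^'n::_ \<Rightarrow> ennreal" where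
  "mixed_int p u 0 x = ennreal \<bar>u x\<bar>"
| "mixed_int p u (Suc j) x =
     epowr (\<integral>\<^sup>+ t. epowr (mixed_int p u j (\<chi> i. if i = coord (Suc j) then t else x $ i))
                     (p (coord (Suc j))) \<partial>lebesgue)
       (1 / p (coord (Suc j)))"

text \<open>$I_n(u)$ is constant, so the evaluation point \<open>0\<close> is immaterial.\<close>

definition mixed_norm :: "('n::{finite,linorder} \<Rightarrow> real) \<Rightarrow> (real^'n::_ \<Rightarrow> real) \<Rightarrow> ennreal" where
  "mixed_norm p u = mixed_int p u CARD('n) 0"

definition Lp_norm :: "real \<Rightarrow> (real^'n::finite \<Rightarrow> real) \<Rightarrow> ennreal" where
  "Lp_norm q g = epowr (\<integral>\<^sup>+ x. ennreal (\<bar>g x\<bar> powr q) \<partial>lebesgue) (1 / q)"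


subsection \<open>Test functions and weak derivatives\<close>

definition pderivative :: "'n::finite \<Rightarrow> (real^'n \<Rightarrow> real) \<Rightarrow> real^'n \<Rightarrow> real" where
  "pderivative i f x = frechet_derivative f (at x) (axis i 1)"

primrec Ck :: "nat \<Rightarrow> (real^'n::finite \<Rightarrow> real) \<Rightarrow> bool" where
  "Ck 0 f \<longleftrightarrow> continuous_on UNIV f"
| "Ck (Suc k) f \<longleftrightarrow> f differentiable_on UNIV \<and> (\<forall>i. Ck k (pderivative i f))"

definition test_functions :: "(real^'n::finite) set \<Rightarrow> (real^'n \<Rightarrow> real) set" where
  "test_functions \<Omega> = {\<phi>. (\<forall>k. Ck k \<phi>) \<and>
     compact (closure (support_on UNIV \<phi>)) \<and> closure (support_on UNIV \<phi>) \<subseteq> \<Omega>}"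

definition locally_integrable :: "(real^'n::finite \<Rightarrow> real) \<Rightarrow> bool" where
  "locally_integrable f \<longleftrightarrow> (\<forall>K. compact K \<longrightarrow> set_integrable lebesgue K f)"

definition has_weak_partial ::
  "'n::finite \<Rightarrow> (real^'n \<Rightarrow> real) \<Rightarrow> (real^'n \<Rightarrow> real) \<Rightarrow> bool" where
  "has_weak_partial i u g \<longleftrightarrow> locally_integrable u \<and> locally_integrable g \<and>
     (\<forall>\<phi>\<in>test_functions UNIV.
        (LINT x|lebesgue. u x * pderivative i \<phi> x) = - (LINT x|lebesgue. g x * \<phi> x))"

text \<open>A representative of the weak derivative $u_{x_i}$, which is unique almost everywhere.\<close>

definition weak_partial :: "'n::finite \<Rightarrow> (real^'n \<Rightarrow> real) \<Rightarrow> real^'n \<Rightarrow> real" where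
  "weak_partial i u = (SOME g. has_weak_partial i u g)"


subsection \<open>Anisotropic Sobolev spaces\<close>

definition grad_norm :: "('n::finite \<Rightarrow> real) \<Rightarrow> (real^'n \<Rightarrow> real) \<Rightarrow> ennreal" where
  "grad_norm p u = (\<Sum>i\<in>UNIV. Lp_norm (p i) (weak_partial i u))"

definition W1p :: "('n::{finite,linorder} \<Rightarrow> real) \<Rightarrow> (real^'n::_ \<Rightarrow> real) set" where
  "W1p p = {u \<in> borel_measurable lebesgue. mixed_norm p u < \<infinity> \<and>
     (\<forall>i. \<exists>g \<in> borel_measurable lebesgue. has_weak_partial i u g \<and> Lp_norm (p i) g < \<infinity>)}"

text \<open>The closure of the test functions on \<open>\<Omega>\<close> with respect to the norm of \<open>W1p p\<close>.\<close>

definition W01p ::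
  "('n::{finite,linorder} \<Rightarrow> real) \<Rightarrow> (real^'n::_) set \<Rightarrow> (real^'n::_ \<Rightarrow> real) set" where
  "W01p p \<Omega> = {u \<in> W1p p. \<forall>\<epsilon>>0. \<exists>\<phi>\<in>test_functions \<Omega>.
     mixed_norm p (\<lambda>x. u x - \<phi> x) + grad_norm p (\<lambda>x. u x - \<phi> x) < ennreal \<epsilon>}"


subsection \<open>Rayleigh quotient and the Euler--Lagrange equation\<close>

definition Rayleigh :: "('n::{finite,linorder} \<Rightarrow> real) \<Rightarrow> (real^'n::_ \<Rightarrow> real) \<Rightarrow> real" where
  "Rayleigh p u = enn2real (grad_norm p u) / enn2real (mixed_norm p u)"

definition critical_point ::
  "('n::{finite,linorder} \<Rightarrow> real) \<Rightarrow> (real^'n::_) set \<Rightarrow> (real^'n::_ \<Rightarrow> real) \<Rightarrow> bool" where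
  "critical_point p \<Omega> u \<longleftrightarrow> u \<in> W01p p \<Omega> \<and> \<not> (AE x in lebesgue. u x = 0) \<and>
     (\<forall>v\<in>W01p p \<Omega>.
        ((\<lambda>t. Rayleigh p (\<lambda>x. u x + t * v x)) has_real_derivative 0) (at 0))"

text \<open>The \<open>i\<close>-th component of the vector field in $\mathcal{L}_{\mathbf p} u$.\<close>

definition flux ::
  "('n::finite \<Rightarrow> real) \<Rightarrow> (real^'n \<Rightarrow> real) \<Rightarrow> 'n \<Rightarrow> real^'n \<Rightarrow> real" where
  "flux p u i x = (let w = weak_partial i u x / enn2real (Lp_norm (p i) (weak_partial i u))
                   in \<bar>w\<bar> powr (p i - 2) * w)"

text \<open>The exponents $p_1, \dots, p_n$ followed by $p_{n+1} = 1$.\<close>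

definition exponent :: "('n::{finite,linorder} \<Rightarrow> real) \<Rightarrow> nat \<Rightarrow> real" where
  "exponent p j = (if j \<le> CARD('n) then p (coord j) else 1)"

text \<open>The factor \<open>u x\<close> makes the value \<open>0\<close> where \<open>u\<close> vanishes.\<close>

definition Fp :: "('n::{finite,linorder} \<Rightarrow> real) \<Rightarrow> (real^'n::_ \<Rightarrow> real) \<Rightarrow> real^'n::_ \<Rightarrow> real" where
  "Fp p u x =
     (\<Prod>j=1..CARD('n). enn2real (mixed_int p u j x) powr (exponent p (j + 1) - exponent p j))
       * (\<bar>u x\<bar> powr (exponent p 1 - 2) * u x)"

text \<open>The condition \<open>u = 0\<close> outside \<open>\<Omega>\<close> is the membership in \<open>W01p p \<Omega>\<close>.\<close>

definition weak_solution ::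
  "('n::{finite,linorder} \<Rightarrow> real) \<Rightarrow> (real^'n::_) set \<Rightarrow> real \<Rightarrow> (real^'n::_ \<Rightarrow> real) \<Rightarrow> bool" where
  "weak_solution p \<Omega> \<mu> u \<longleftrightarrow> u \<in> W01p p \<Omega> \<and>
     (\<forall>v\<in>W01p p \<Omega>.
        (LINT x:\<Omega>|lebesgue. \<Sum>i\<in>UNIV. flux p u i x * weak_partial i v x)
          = \<mu> * (LINT x:\<Omega>|lebesgue. Fp p u x * v x))"

end

theory Submission
  imports Defs
begin

text \<open>
  Fix \<open>u\<close> and write \<open>G(v)\<close> and \<open>N(v)\<close> for the gradient norm and the mixed norm. If both are differentiable at
  \<open>u\<close> in every direction \<open>v\<close>, with derivatives \<open>dG(v)\<close> and \<open>dN(v)\<close>, the quotient rule says that \<open>u\<close> is critical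
  iff \<open>dG(v) = (G(u) / N(u)) * dN(v)\<close> for all \<open>v\<close>. The two sides of the weak equation are just \<open>dG(v)\<close> and
  \<open>\<mu> * dN(v)\<close>, so a critical point is a weak solution with \<open>\<mu> = G(u) / N(u)\<close>. Conversely, testing the weak
  equation with \<open>v = u\<close> forces this value of \<open>\<mu>\<close>, because both norms are homogeneous and hence
  \<open>dG(u) = G(u)\<close> and \<open>dN(u) = N(u)\<close> (\<open>has_derivative_at_0_of_homogeneous\<close>).

  The work lies in the two derivatives. Both rest on \<open>has_derivative_Lq_norm\<close>: along a family \<open>A t\<close> with
  \<open>\<bar>A t - A 0\<bar> \<le> \<bar>t\<bar> * B\<close> and \<open>B\<close> in \<open>L^q\<close>, \<open>q > 1\<close>, the \<open>L^q\<close> norm can be differentiated under the integral by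
  dominated convergence, provided that it is not 0 at \<open>t = 0\<close>.

  For the mixed norm (\<open>mixed_int_has_derivative\<close>) this is applied once for each coordinate. The Lipschitz
  bound for \<open>I_j\<close> is its triangle inequality, the pointwise derivative of \<open>I_j\<close> is the induction hypothesis,
  and the chain rule produces the weight \<open>mixed_grad\<close>, which for the last coordinate is \<open>Fp\<close>
  (\<open>Fp_eq_mixed_grad\<close>). Hoelder's inequality bounds the integrals, so that Tonelli's theorem turns the
  nested integrals into one integral over the whole space.

  For the gradient norm (\<open>grad_norm_has_derivative\<close>) each summand is an \<open>L^q\<close> norm, but one has to know that
  no weak partial derivative of \<open>u\<close> is 0 almost everywhere. A function with vanishing \<open>i\<close>-th derivative
  is invariant under translations in direction \<open>i\<close>; being 0 outside a bounded set, it is 0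
  (\<open>zero_weak_partial_imp_zero\<close>). Weak derivatives are linear in \<open>u\<close> only up to null sets, by the fundamental
  lemma of the calculus of variations (\<open>AE_zero_if_orthogonal_to_tensors\<close>). Finally, elements of the closure of the
  test functions on \<open>\<Omega>\<close> vanish almost everywhere outside \<open>\<Omega>\<close> together with their weak derivatives
  (\<open>W01p_mem\<close>), so that integrals over \<open>\<Omega>\<close> and over the whole space agree.
\<close>

section \<open>The inequalities of Minkowski and Hoelder and differentiation of norms\<close>

lemma epowr_top [simp]: "epowr \<infinity> r = \<infinity>" "epowr top r = top"
  by (auto simp: epowr_def)

lemma epowr_ennreal: "0 \<le> x \<Longrightarrow> epowr (ennreal x) r = ennreal (x powr r)"
  by (simp add: epowr_def)

lemma epowr_0 [simp]: "epowr 0 r = 0"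
  by (simp add: epowr_def)

lemma epowr_eq_0_iff [simp]: "epowr a r = 0 \<longleftrightarrow> a = 0"
  by (cases a) (auto simp: epowr_ennreal ennreal_eq_0_iff)

lemma epowr_eq_top_iff [simp]: "epowr a r = top \<longleftrightarrow> a = top"
  by (cases a) (auto simp: epowr_ennreal)

lemma epowr_mono: "a \<le> b \<Longrightarrow> 0 \<le> r \<Longrightarrow> epowr a r \<le> epowr b r"
  by (cases a; cases b) (auto simp: epowr_ennreal ennreal_leI powr_mono2 top_unique)

lemma epowr_mult: "epowr (a * b) r = epowr a r * epowr b r"
proof (cases "a = 0 \<or> b = 0")
  case False
  then show ?thesis
    by (cases a; cases b)
       (auto simp: epowr_ennreal ennreal_mult[symmetric] powr_mult ennreal_mult_top ennreal_top_mult)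
qed auto

lemma epowr_epowr_inverse: "r > 0 \<Longrightarrow> epowr (epowr a r) (1 / r) = a"
  by (cases a) (auto simp: epowr_ennreal powr_powr)

lemma epowr_inverse_epowr: "r > 0 \<Longrightarrow> epowr (epowr a (1 / r)) r = a"
  by (cases a) (auto simp: epowr_ennreal powr_powr)

lemma enn2real_epowr: "r > 0 \<Longrightarrow> enn2real (epowr a r) = enn2real a powr r"
  by (cases a) (auto simp: epowr_ennreal)

lemma measurable_epowr [measurable]:
  "f \<in> borel_measurable M \<Longrightarrow> (\<lambda>x. epowr (f x) r) \<in> borel_measurable M"
proof -
  assume [measurable]: "f \<in> borel_measurable M"
  have "(\<lambda>x. if f x = \<infinity> then \<infinity> else ennreal (enn2real (f x) powr r)) \<in> borel_measurable M"
    by (intro measurable_If measurable_const powr_real_measurable measurable_compose[OF _ measurable_ennreal]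
        borel_measurable_enn2real) auto
  then show ?thesis by (simp add: epowr_def[abs_def])
qed

text \<open>
  The common shape of \<open>Lp_norm\<close> and of one step of \<open>mixed_int\<close>. Taking the integrand with values in
  \<open>[0, \<infinity>]\<close> allows the result of one step, which may be infinite, to be the integrand of the next.
\<close>

definition Lq_enorm :: "'a measure \<Rightarrow> real \<Rightarrow> ('a \<Rightarrow> ennreal) \<Rightarrow> ennreal" where
  "Lq_enorm M q f = epowr (\<integral>\<^sup>+ y. epowr (f y) q \<partial>M) (1 / q)"

lemma Lq_enorm_powr: "q > 0 \<Longrightarrow> epowr (Lq_enorm M q f) q = (\<integral>\<^sup>+ y. epowr (f y) q \<partial>M)"
  by (simp add: Lq_enorm_def epowr_inverse_epowr)

lemma Lq_enorm_mono:
  assumes "AE y in M. f y \<le> g y" "q > 0"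
  shows "Lq_enorm M q f \<le> Lq_enorm M q g"
  unfolding Lq_enorm_def using assms
  by (intro epowr_mono nn_integral_mono_AE) (auto elim!: eventually_mono intro: epowr_mono)

lemma Lq_enorm_cong:
  assumes "AE y in M. f y = g y"
  shows "Lq_enorm M q f = Lq_enorm M q g"
  unfolding Lq_enorm_def using assms
  by (intro arg_cong2[where f=epowr] nn_integral_cong_AE) (auto elim!: eventually_mono)

lemma Lq_enorm_cmult:
  assumes [measurable]: "f \<in> borel_measurable M" and "q > 0"
  shows "Lq_enorm M q (\<lambda>y. c * f y) = c * Lq_enorm M q f"
  unfolding Lq_enorm_def using assms(2)
  by (simp add: epowr_mult nn_integral_cmult epowr_epowr_inverse)

lemma Lq_enorm_eq_0:
  assumes [measurable]: "f \<in> borel_measurable M"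
  shows "Lq_enorm M q f = 0 \<longleftrightarrow> (AE y in M. f y = 0)"
  unfolding Lq_enorm_def by (simp add: nn_integral_0_iff_AE)

lemma Lq_enorm_AE_finite:
  assumes [measurable]: "f \<in> borel_measurable M" and "Lq_enorm M q f < \<infinity>"
  shows "AE y in M. f y < \<infinity>"
proof -
  have "(\<integral>\<^sup>+ y. epowr (f y) q \<partial>M) \<noteq> \<infinity>"
    using assms(2) by (auto simp: Lq_enorm_def)
  from nn_integral_noteq_infinite[OF _ this] show ?thesis
    by (auto simp: less_top)
qed

text \<open>
  Young's inequality for \<open>x / a\<close> and \<open>y / b\<close>. If \<open>a\<close> and \<open>b\<close> are the \<open>L^q\<close> norms of two functions, the
  bracket integrates to 1, which turns this pointwise bound into the inequality of Hoelder.
\<close>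

lemma Young_powr:
  fixes x y a b q :: real
  assumes "0 \<le> x" "0 \<le> y" "0 < a" "0 < b" "1 < q"
  shows "x powr (q - 1) * y \<le> a powr (q - 1) * b * ((1 - 1/q) * (a powr (-q) * x powr q) + (1/q) * (b powr (-q) * y powr q))"
proof (cases "x = 0 \<or> y = 0")
  case True
  then have "x powr (q - 1) * y = 0" by auto
  moreover have "0 \<le> a powr (q - 1) * b * ((1 - 1/q) * (a powr (-q) * x powr q) + (1/q) * (b powr (-q) * y powr q))"
    using assms by (intro mult_nonneg_nonneg add_nonneg_nonneg) auto
  ultimately show ?thesis by linarith
next
  case False
  then have pos: "0 < x" "0 < y" using assms by auto
  have "((x/a) powr q) powr (1 - 1/q) * ((y/b) powr q) powr (1/q) \<le> (1 - 1/q) * (x/a) powr q + (1/q) * (y/b) powr q"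
    by (rule Youngs_inequality_0) (use assms pos in auto)
  also have "((x/a) powr q) powr (1 - 1/q) = (x/a) powr (q - 1)"
    using assms by (simp add: powr_powr algebra_simps)
  also have "((y/b) powr q) powr (1/q) = y / b"
    using assms by (simp add: powr_powr)
  finally have "a powr (q - 1) * b * ((x/a) powr (q - 1) * (y/b)) \<le> a powr (q - 1) * b * ((1 - 1/q) * (x/a) powr q + (1/q) * (y/b) powr q)"
    using assms by (intro mult_left_mono) auto
  also have "a powr (q - 1) * b * ((x/a) powr (q - 1) * (y/b)) = x powr (q - 1) * y"
    using assms by (simp add: powr_divide)
  finally show ?thesis
    using assms by (simp add: powr_divide powr_minus field_simps)
qed

text \<open>
  Convexity of the power, with \<open>(x + y) / (a + b)\<close> written as the convex combination of \<open>x / a\<close> and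
  \<open>y / b\<close> with weights \<open>a / (a + b)\<close> and \<open>b / (a + b)\<close>. If \<open>a\<close> and \<open>b\<close> are the \<open>L^q\<close> norms of two functions,
  the right-hand side integrates to \<open>(a + b)^q\<close>, which is the inequality of Minkowski.
\<close>

lemma powr_add_le_convex:
  fixes x y a b q :: real
  assumes "0 \<le> x" "0 \<le> y" "0 < a" "0 < b" "1 < q"
  shows "(x + y) powr q \<le> (a + b) powr (q - 1) * (a * (a powr (-q) * x powr q) + b * (b powr (-q) * y powr q))"
proof -
  have *: "(s * X + t * Y) powr q \<le> s * X powr q + t * Y powr q"
    if "0 \<le> X" "0 \<le> Y" "0 < s" "0 < t" "s + t = 1" for s t X Y :: real
  proof (cases "X = 0 \<or> Y = 0")
    case True
    have "s powr q \<le> s powr 1" "t powr q \<le> t powr 1"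
      using that assms by (intro powr_mono'; simp)+
    with True that show ?thesis by (auto simp: powr_mult intro!: mult_right_mono)
  next
    case False
    have t: "s = 1 - t" using that by simp
    show ?thesis
      using convex_onD[OF powr_convex[of q], of t X Y] that False assms unfolding t by auto
  qed
  have "(a / (a+b)) * (x / a) + (b / (a+b)) * (y / b) = (x + y) / (a + b)"
    using assms by (simp add: add_divide_distrib)
  then have "((x + y) / (a + b)) powr q \<le> a / (a+b) * (x/a) powr q + b / (a+b) * (y/b) powr q"
    using *[of "x/a" "y/b" "a/(a+b)" "b/(a+b)"] assms by (simp add: add_divide_distrib[symmetric])
  then have "(a+b) powr q * ((x + y) / (a + b)) powr q \<le> (a+b) powr q * (a / (a+b) * (x/a) powr q + b / (a+b) * (y/b) powr q)"
    by (intro mult_left_mono) auto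
  also have "(a+b) powr q * ((x + y) / (a + b)) powr q = (x + y) powr q"
    using assms by (simp add: powr_divide)
  also have "(a+b) powr q * (a / (a+b) * (x/a) powr q + b / (a+b) * (y/b) powr q)
    = ((a+b) powr q / (a+b)) * (a * (x/a) powr q + b * (y/b) powr q)"
    by (simp add: algebra_simps add_divide_distrib)
  also have "(a+b) powr q / (a+b) = (a + b) powr (q - 1)"
    using assms by (simp add: powr_diff)
  also have "(x/a) powr q = x powr q / a powr q"
    using assms by (simp add: powr_divide)
  also have "x powr q / a powr q = a powr (-q) * x powr q"
    by (simp add: powr_minus divide_inverse)
  also have "(y/b) powr q = y powr q / b powr q"
    using assms by (simp add: powr_divide)
  also have "y powr q / b powr q = b powr (-q) * y powr q"
    by (simp add: powr_minus divide_inverse)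
  finally show ?thesis .
qed

text \<open>
  Normalising by a norm is impossible if the norm is 0. Arguments that normalise therefore work with
  arbitrary reals above the norm and pass to the limit by this lemma.
\<close>

lemma ennreal_le_of_forall_real_gt:
  fixes a :: ennreal and c b :: real
  assumes "0 \<le> b" "0 \<le> c" and le: "\<And>b'. b' > b \<Longrightarrow> a \<le> ennreal (c * b')"
  shows "a \<le> ennreal (c * b)"
proof -
  have "((\<lambda>b'. ennreal (c * b')) \<longlongrightarrow> ennreal (c * b)) (at_right b)"
    by (intro tendsto_ennrealI tendsto_intros)
  then show ?thesis
    by (rule tendsto_lowerbound) (auto simp: eventually_at_right_less le intro!: eventually_mono[OF eventually_at_right_less])
qed

lemma Lq_enorm_triangle:
  assumes [measurable]: "f \<in> borel_measurable M" "g \<in> borel_measurable M" and q: "1 < q"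
  shows "Lq_enorm M q (\<lambda>y. f y + g y) \<le> Lq_enorm M q f + Lq_enorm M q g"
proof (cases "Lq_enorm M q f = \<infinity> \<or> Lq_enorm M q g = \<infinity>")
  case False
  then obtain \<alpha> \<beta> where \<alpha>: "Lq_enorm M q f = ennreal \<alpha>" "0 \<le> \<alpha>" and \<beta>: "Lq_enorm M q g = ennreal \<beta>" "0 \<le> \<beta>"
    by (metis ennreal_cases infinity_ennreal_def)
  have F: "(\<integral>\<^sup>+ y. epowr (f y) q \<partial>M) = ennreal (\<alpha> powr q)"
    using Lq_enorm_powr[of q M f] \<alpha> q by (simp add: epowr_ennreal)
  have G: "(\<integral>\<^sup>+ y. epowr (g y) q \<partial>M) = ennreal (\<beta> powr q)"
    using Lq_enorm_powr[of q M g] \<beta> q by (simp add: epowr_ennreal)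
  have "Lq_enorm M q (\<lambda>y. f y + g y) \<le> ennreal (1 * c)" if "c > \<alpha> + \<beta>" for c
  proof -
    \<comment> \<open>Split \<open>c\<close> into two positive reals above the two norms.\<close>
    define e where "e = (c - \<alpha> - \<beta>) / 2"
    define a b where "a = \<alpha> + e" and "b = \<beta> + e"
    have ab: "a > \<alpha>" "b > \<beta>" "a + b = c" "a > 0" "b > 0"
      using that \<alpha> \<beta> by (auto simp: e_def a_def b_def field_simps)
    have pw: "epowr (f y + g y) q \<le> ennreal ((a + b) powr (q - 1)) *
       (ennreal (a * a powr (-q)) * epowr (f y) q + ennreal (b * b powr (-q)) * epowr (g y) q)" for y
    proof (cases "f y = top \<or> g y = top")
      case True
      have "0 < (a + b) powr (q - 1)" "0 < a * a powr (-q)" "0 < b * b powr (-q)"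
        using ab by auto
      then have "ennreal ((a + b) powr (q - 1)) \<noteq> 0" "ennreal (a * a powr (-q)) \<noteq> 0" "ennreal (b * b powr (-q)) \<noteq> 0"
        by (auto simp only: ennreal_eq_0_iff not_le)
      then show ?thesis using True by (auto simp: ennreal_mult_top simp del: ennreal_eq_0_iff)
    next
      case False
      then obtain x z where x: "f y = ennreal x" "0 \<le> x" and z: "g y = ennreal z" "0 \<le> z"
        by (metis ennreal_cases)
      show ?thesis
        unfolding x z using powr_add_le_convex[of x z a b q] x(2) z(2) ab q
        by (simp add: epowr_ennreal ennreal_mult[symmetric] ennreal_plus[symmetric] mult.assoc
            del: ennreal_plus)
    qed
    have "(\<integral>\<^sup>+ y. epowr (f y + g y) q \<partial>M) \<le> (\<integral>\<^sup>+ y. ennreal ((a + b) powr (q - 1)) *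
       (ennreal (a * a powr (-q)) * epowr (f y) q + ennreal (b * b powr (-q)) * epowr (g y) q) \<partial>M)"
      by (intro nn_integral_mono pw)
    also have "\<dots> = ennreal ((a + b) powr (q - 1)) *
       (ennreal (a * a powr (-q)) * ennreal (\<alpha> powr q) + ennreal (b * b powr (-q)) * ennreal (\<beta> powr q))"
      by (simp add: nn_integral_cmult nn_integral_add F G)
    also have "\<dots> = ennreal ((a + b) powr (q - 1) * (a * (a powr (-q) * \<alpha> powr q) + b * (b powr (-q) * \<beta> powr q)))"
      using ab by (simp add: ennreal_mult[symmetric] ennreal_plus[symmetric] mult.assoc del: ennreal_plus)
    also have "\<dots> \<le> ennreal ((a + b) powr (q - 1) * (a * (a powr (-q) * a powr q) + b * (b powr (-q) * b powr q)))"
      using ab \<alpha> \<beta> q by (intro ennreal_leI mult_left_mono add_mono powr_mono2) auto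
    also have "(a + b) powr (q - 1) * (a * (a powr (-q) * a powr q) + b * (b powr (-q) * b powr q)) = c powr q"
      using ab by (simp add: powr_add[symmetric] powr_diff)
    finally have "Lq_enorm M q (\<lambda>y. f y + g y) \<le> epowr (ennreal (c powr q)) (1 / q)"
      unfolding Lq_enorm_def using q by (intro epowr_mono) auto
    also have "\<dots> = ennreal c"
      using ab q by (simp add: epowr_ennreal powr_powr)
    finally show ?thesis by simp
  qed
  from ennreal_le_of_forall_real_gt[OF _ _ this] show ?thesis
    using \<alpha> \<beta> by (simp add: ennreal_plus[symmetric] del: ennreal_plus)
qed auto

lemma Lq_enorm_Hoelder:
  assumes [measurable]: "f \<in> borel_measurable M" "g \<in> borel_measurable M" and q: "1 < q"
    and fin: "Lq_enorm M q f < \<infinity>" "Lq_enorm M q g < \<infinity>"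
  shows "(\<integral>\<^sup>+ y. epowr (f y) (q - 1) * g y \<partial>M) \<le> epowr (Lq_enorm M q f) (q - 1) * Lq_enorm M q g"
proof (cases "Lq_enorm M q f = 0")
  case True
  then have "AE y in M. f y = 0" by (simp add: Lq_enorm_eq_0)
  then have "AE y in M. epowr (f y) (q - 1) * g y = 0" by (auto elim: eventually_mono)
  then have "(\<integral>\<^sup>+ y. epowr (f y) (q - 1) * g y \<partial>M) = 0"
    by (simp add: nn_integral_0_iff_AE)
  then show ?thesis by simp
next
  case False
  with fin obtain a \<beta> where a: "Lq_enorm M q f = ennreal a" "0 < a" and \<beta>: "Lq_enorm M q g = ennreal \<beta>" "0 \<le> \<beta>"
    by (cases "Lq_enorm M q f"; cases "Lq_enorm M q g") (auto simp: ennreal_eq_0_iff not_le)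
  have F: "(\<integral>\<^sup>+ y. epowr (f y) q \<partial>M) = ennreal (a powr q)"
    using Lq_enorm_powr[of q M f] a q by (simp add: epowr_ennreal)
  have G: "(\<integral>\<^sup>+ y. epowr (g y) q \<partial>M) = ennreal (\<beta> powr q)"
    using Lq_enorm_powr[of q M g] \<beta> q by (simp add: epowr_ennreal)
  have "(\<integral>\<^sup>+ y. epowr (f y) (q - 1) * g y \<partial>M) \<le> ennreal (a powr (q - 1) * b)" if "b > \<beta>" for b
  proof -
    have b: "b > 0" using that \<beta> by simp
    have pos: "0 < a powr (q - 1) * b" "0 < (1 - 1/q) * a powr (-q)" "0 < 1/q * b powr (-q)"
      using a b q by auto
    have pw: "epowr (f y) (q - 1) * g y \<le> ennreal (a powr (q - 1) * b) *
       (ennreal ((1 - 1/q) * a powr (-q)) * epowr (f y) q + ennreal (1/q * b powr (-q)) * epowr (g y) q)" for y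
    proof (cases "f y = top \<or> g y = top")
      case True
      have "ennreal (a powr (q - 1) * b) \<noteq> 0" "ennreal ((1 - 1/q) * a powr (-q)) \<noteq> 0" "ennreal (1/q * b powr (-q)) \<noteq> 0"
        using pos by (auto simp only: ennreal_eq_0_iff not_le)
      then show ?thesis using True by (auto simp: ennreal_mult_top simp del: ennreal_eq_0_iff)
    next
      case False
      then obtain x z where x: "f y = ennreal x" "0 \<le> x" and z: "g y = ennreal z" "0 \<le> z"
        by (metis ennreal_cases)
      have "x powr (q - 1) * z \<le> a powr (q - 1) * b * ((1 - 1/q) * a powr (-q) * x powr q + (1/q * b powr (-q)) * z powr q)"
        using Young_powr[of x z a b q] x(2) z(2) a b q by (simp add: mult.assoc)
      then show ?thesis
        unfolding x z using x(2) z(2) pos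
        by (simp add: epowr_ennreal ennreal_mult'[symmetric] ennreal_mult''[symmetric] ennreal_plus[symmetric] ennreal_leI
            del: ennreal_plus times_divide_eq_left)
    qed
    have "(\<integral>\<^sup>+ y. epowr (f y) (q - 1) * g y \<partial>M) \<le> (\<integral>\<^sup>+ y. ennreal (a powr (q - 1) * b) *
       (ennreal ((1 - 1/q) * a powr (-q)) * epowr (f y) q + ennreal (1/q * b powr (-q)) * epowr (g y) q) \<partial>M)"
      by (intro nn_integral_mono pw)
    also have "\<dots> = ennreal (a powr (q - 1) * b) *
       (ennreal ((1 - 1/q) * a powr (-q)) * ennreal (a powr q) + ennreal (1/q * b powr (-q)) * ennreal (\<beta> powr q))"
      by (simp add: nn_integral_cmult nn_integral_add F G)
    also have "\<dots> = ennreal (a powr (q - 1) * b * ((1 - 1/q) * a powr (-q) * a powr q + 1/q * b powr (-q) * \<beta> powr q))"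
      using pos by (simp add: ennreal_mult'[symmetric] ennreal_mult''[symmetric] ennreal_plus[symmetric] del: ennreal_plus times_divide_eq_left)
    also have "\<dots> \<le> ennreal (a powr (q - 1) * b * ((1 - 1/q) * a powr (-q) * a powr q + 1/q * b powr (-q) * b powr q))"
      using pos that \<beta> q a(2) by (intro ennreal_leI mult_left_mono add_mono powr_mono2) auto
    also have "(1 - 1/q) * a powr (-q) * a powr q + 1/q * b powr (-q) * b powr q = 1"
      using a b q by (simp add: mult.assoc powr_add[symmetric])
    finally show ?thesis by simp
  qed
  from ennreal_le_of_forall_real_gt[OF _ _ this] show ?thesis
    using a \<beta> by (simp add: epowr_ennreal ennreal_mult)
qed


text \<open>
  The mean value estimate for the power function, which also holds at 0. It follows from Young's
  inequality with both scales equal to the larger of the two numbers.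
\<close>

lemma powr_diff_le:
  fixes x y m q :: real
  assumes "0 \<le> x" "0 \<le> y" "x \<le> m" "y \<le> m" "1 < q"
  shows "\<bar>x powr q - y powr q\<bar> \<le> q * m powr (q - 1) * \<bar>x - y\<bar>"
proof -
  have *: "x powr q - y powr q \<le> q * m powr (q - 1) * (x - y)" if "0 \<le> y" "y \<le> x" "x \<le> m" for x y
  proof (cases "x = 0")
    case False
    then have x: "x > 0" using that by simp
    then have "x powr (q - 1) * y \<le> x powr (q - 1) * x * ((1 - 1/q) * (x powr (-q) * x powr q) + (1/q) * (x powr (-q) * y powr q))"
      using that \<open>1 < q\<close> by (intro Young_powr) auto
    also have "\<dots> = x powr q * x powr (-q) * ((1 - 1/q) * x powr q + (1/q) * y powr q)"
      using x by (simp add: powr_diff algebra_simps)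
    also have "x powr q * x powr (-q) = 1" using x by (simp add: powr_add[symmetric])
    finally have "q * (x powr (q - 1) * y) \<le> q * ((1 - 1/q) * x powr q + (1/q) * y powr q)"
      using \<open>1 < q\<close> by (intro mult_left_mono) auto
    also have "\<dots> = (q - 1) * x powr q + y powr q" using \<open>1 < q\<close> by (simp add: field_simps)
    also have "x powr q = x powr (q - 1) * x" using x by (simp add: powr_diff)
    finally have "x powr (q - 1) * x - y powr q \<le> q * x powr (q - 1) * (x - y)"
      by (simp add: algebra_simps)
    also have "\<dots> \<le> q * m powr (q - 1) * (x - y)"
      using that \<open>1 < q\<close> by (intro mult_right_mono mult_left_mono powr_mono2) auto
    also have "x powr (q - 1) * x = x powr q" using x by (simp add: powr_diff)
    finally show ?thesis .
  qed (use that in auto)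
  show ?thesis
  proof (cases "y \<le> x")
    case True
    then have "y powr q \<le> x powr q" using assms by (intro powr_mono2) auto
    with *[of y x] True assms show ?thesis by simp
  next
    case False
    then have "x powr q \<le> y powr q" using assms by (intro powr_mono2) auto
    with *[of x y] False assms show ?thesis by simp
  qed
qed

lemma has_derivative_powr_at_zero:
  fixes a :: "real \<Rightarrow> real"
  assumes q: "1 < q" and a: "\<And>t. 0 \<le> a t" "\<And>t. a t \<le> \<bar>t\<bar> * b" and b: "0 \<le> b"
  shows "((\<lambda>t. a t powr q) has_real_derivative 0) (at 0)"
proof -
  have a0: "a 0 = 0" using a(1)[of 0] a(2)[of 0] by simp
  have le: "norm ((a h powr q - a 0 powr q) / h) \<le> b powr q * \<bar>h\<bar> powr (q - 1)" for h
  proof (cases "h = 0")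
    case False
    have "a h powr q \<le> (\<bar>h\<bar> * b) powr q" using a q by (intro powr_mono2) auto
    then have "a h powr q / \<bar>h\<bar> \<le> (\<bar>h\<bar> * b) powr q / \<bar>h\<bar>" by (intro divide_right_mono) auto
    also have "\<dots> = b powr q * \<bar>h\<bar> powr (q - 1)" using False b by (simp add: powr_mult powr_diff)
    finally show ?thesis by (simp add: a0)
  qed (use b in auto)
  have "((\<lambda>h. b powr q * \<bar>h\<bar> powr (q - 1)) \<longlongrightarrow> b powr q * \<bar>0\<bar> powr (q - 1)) (at 0)"
    using q by (intro tendsto_intros) auto
  then have "((\<lambda>h. b powr q * \<bar>h\<bar> powr (q - 1)) \<longlongrightarrow> 0) (at 0)" by simp
  then have "((\<lambda>h. (a h powr q - a 0 powr q) / h) \<longlongrightarrow> 0) (at 0)"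
    by (rule Lim_null_comparison[rotated]) (use le in auto)
  then show ?thesis by (simp add: DERIV_def)
qed

text \<open>
  Differentiation under the integral sign. By the mean value estimate the difference quotients of
  \<open>A t y powr q\<close> along a null sequence bounded by \<open>C \<ge> 1\<close> are at most \<open>q * (A 0 y + C * B y) powr q\<close>, which
  is integrable. The derivative of \<open>A\<close> is assumed only where \<open>A 0 y\<close> is positive, since norms have none at
  0; where \<open>A 0 y = 0\<close>, the power \<open>A t y powr q\<close> is bounded by a multiple of \<open>\<bar>t\<bar> powr q\<close> and has
  derivative 0, because \<open>q > 1\<close>.
\<close>

lemma has_derivative_integral_powr:
  fixes A :: "real \<Rightarrow> 'a \<Rightarrow> real"
  assumes q: "1 < q"
    and [measurable]: "\<And>t. A t \<in> borel_measurable M" "B \<in> borel_measurable M" "D \<in> borel_measurable M"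
    and nonneg: "\<And>t y. 0 \<le> A t y" "\<And>y. 0 \<le> B y"
    and int: "integrable M (\<lambda>y. A 0 y powr q)" "integrable M (\<lambda>y. B y powr q)"
    and lip: "AE y in M. \<forall>t. \<bar>A t y - A 0 y\<bar> \<le> \<bar>t\<bar> * B y"
    and der: "AE y in M. 0 < A 0 y \<longrightarrow> ((\<lambda>t. A t y) has_real_derivative D y) (at 0)"
  shows "integrable M (\<lambda>y. A 0 y powr (q - 1) * D y)" (is ?th1)
    and "((\<lambda>t. \<integral>y. A t y powr q \<partial>M) has_real_derivative
            q * (\<integral>y. A 0 y powr (q - 1) * D y \<partial>M)) (at 0)" (is ?th2)
proof -
  \<comment> \<open>The majorant for difference quotients with steps of size at most \<open>C\<close>.\<close>
  define W where "W C y = q * (A 0 y + C * B y) powr q" for C y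
  have [measurable]: "W C \<in> borel_measurable M" for C unfolding W_def by measurable
  have int_W: "integrable M (W C)" if "C \<ge> 0" for C
    unfolding W_def
  proof (intro integrable_mult_right)
    have "integrable M (\<lambda>y. 2 powr (q - 1) * (A 0 y powr q + C powr q * B y powr q))"
      using int by auto
    then show "integrable M (\<lambda>y. (A 0 y + C * B y) powr q)"
    proof (rule Bochner_Integration.integrable_bound)
      show "AE y in M. norm ((A 0 y + C * B y) powr q) \<le> norm (2 powr (q - 1) * (A 0 y powr q + C powr q * B y powr q))"
      proof (rule AE_I2)
        fix y
        have "(A 0 y + C * B y) powr q \<le> 2 powr (q - 1) * (A 0 y powr q + C powr q * B y powr q)"
          using powr_add_le_convex[of "A 0 y" "C * B y" 1 1 q] nonneg(1)[of 0 y] nonneg(2)[of y] that q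
          by (simp add: powr_mult)
        then show "norm ((A 0 y + C * B y) powr q) \<le> norm (2 powr (q - 1) * (A 0 y powr q + C powr q * B y powr q))"
          by simp
      qed
    qed measurable
  qed
  have int_A: "integrable M (\<lambda>y. A t y powr q)" for t
  proof (rule Bochner_Integration.integrable_bound[OF int_W[OF abs_ge_zero, of t]])
    show "AE y in M. norm (A t y powr q) \<le> norm (W \<bar>t\<bar> y)"
      using lip
    proof eventually_elim
      case (elim y)
      have "A t y powr q \<le> (A 0 y + \<bar>t\<bar> * B y) powr q"
        using elim[rule_format, of t] nonneg q by (intro powr_mono2) auto
      also have "\<dots> \<le> W \<bar>t\<bar> y" unfolding W_def using q by (simp add: mult_le_cancel_right1)
      finally have "A t y powr q \<le> W \<bar>t\<bar> y" .
      then show ?case by auto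
    qed
  qed measurable
  \<comment> \<open>Dominated convergence is applied along an arbitrary null sequence.\<close>
  have seq: "integrable M (\<lambda>y. q * (A 0 y powr (q - 1) * D y)) \<and>
     (\<lambda>i. ((\<integral>y. A (X i) y powr q \<partial>M) - (\<integral>y. A 0 y powr q \<partial>M)) / X i) \<longlonglongrightarrow> (\<integral>y. q * (A 0 y powr (q - 1) * D y) \<partial>M)"
    if X: "X \<longlonglongrightarrow> 0" "\<And>i. X i \<noteq> 0" for X
  proof -
    obtain K where K: "\<And>i. norm (X i) \<le> K"
      using convergent_imp_Bseq[OF convergentI[OF X(1)]] by (elim BseqE) blast
    define C where "C = max 1 K"
    have C: "1 \<le> C" "\<And>i. \<bar>X i\<bar> \<le> C" using K by (auto simp: C_def intro: max.coboundedI2)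
    have lim: "AE y in M. (\<lambda>i. (A (X i) y powr q - A 0 y powr q) / X i) \<longlonglongrightarrow> q * (A 0 y powr (q - 1) * D y)"
      using lip der
    proof eventually_elim
      case (elim y)
      have "((\<lambda>t. A t y powr q) has_real_derivative q * (A 0 y powr (q - 1) * D y)) (at 0)"
      proof (cases "A 0 y = 0")
        case True
        have "((\<lambda>t. A t y powr q) has_real_derivative 0) (at 0)"
        proof (rule has_derivative_powr_at_zero[OF q])
          show "A t y \<le> \<bar>t\<bar> * B y" for t using elim(1) True by (metis abs_le_D1 diff_zero)
        qed (use nonneg in auto)
        then show ?thesis using True by simp
      next
        case False
        then have pos: "0 < A 0 y" using nonneg(1)[of 0 y] by simp
        with elim(2) have "((\<lambda>t. A t y) has_real_derivative D y) (at 0)" by simp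
        from DERIV_chain2[where g = "\<lambda>t. A t y", OF has_real_derivative_powr[OF pos, of q] this] show ?thesis
          by (simp add: mult_ac)
      qed
      then have "((\<lambda>h. (A h y powr q - A 0 y powr q) / h) \<longlongrightarrow> q * (A 0 y powr (q - 1) * D y)) (at 0)"
        by (simp add: DERIV_def)
      then show ?case
        unfolding tendsto_at_iff_sequentially using X by (simp add: comp_def)
    qed
    have bound: "AE y in M. norm ((A (X i) y powr q - A 0 y powr q) / X i) \<le> W C y" for i
      using lip
    proof eventually_elim
      case (elim y)
      let ?m = "A 0 y + C * B y"
      have l: "\<bar>A (X i) y - A 0 y\<bar> \<le> \<bar>X i\<bar> * B y" using elim by simp
      have cb: "\<bar>X i\<bar> * B y \<le> C * B y" "0 \<le> C * B y" "B y \<le> C * B y"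
        using C nonneg(2)[of y] by (auto intro: mult_right_mono simp: mult_le_cancel_right1)
      have "\<bar>A (X i) y powr q - A 0 y powr q\<bar> \<le> q * ?m powr (q - 1) * \<bar>A (X i) y - A 0 y\<bar>"
        using nonneg(1)[of _ y] l cb q by (intro powr_diff_le) auto
      also have "\<dots> \<le> q * ?m powr (q - 1) * (\<bar>X i\<bar> * B y)"
        using l q by (intro mult_left_mono) auto
      finally have "\<bar>A (X i) y powr q - A 0 y powr q\<bar> / \<bar>X i\<bar> \<le> q * ?m powr (q - 1) * (\<bar>X i\<bar> * B y) / \<bar>X i\<bar>"
        by (intro divide_right_mono) auto
      also have "\<dots> = q * (?m powr (q - 1) * B y)" using X(2)[of i] by simp
      also have "\<dots> \<le> q * (?m powr (q - 1) * ?m)"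
        using cb nonneg(1)[of 0 y] q by (intro mult_left_mono) auto
      also have "?m powr (q - 1) * ?m = ?m powr q"
        using cb nonneg(1)[of 0 y] by (cases "?m = 0") (auto simp: powr_diff)
      finally show ?case by (simp add: W_def abs_divide)
    qed
    have W: "integrable M (W C)" using C by (intro int_W) auto
    note dc = integrable_dominated_convergence[OF _ _ W lim bound] integral_dominated_convergence[OF _ _ W lim bound]
    show ?thesis
    proof
      show "integrable M (\<lambda>y. q * (A 0 y powr (q - 1) * D y))" by (rule dc(1)) measurable
      have "(\<lambda>i. \<integral>y. (A (X i) y powr q - A 0 y powr q) / X i \<partial>M) \<longlonglongrightarrow> (\<integral>y. q * (A 0 y powr (q - 1) * D y) \<partial>M)"
        by (rule dc(2)) measurable
      then show "(\<lambda>i. ((\<integral>y. A (X i) y powr q \<partial>M) - (\<integral>y. A 0 y powr q \<partial>M)) / X i) \<longlonglongrightarrow> (\<integral>y. q * (A 0 y powr (q - 1) * D y) \<partial>M)"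
        using int_A by simp
    qed
  qed
  have "integrable M (\<lambda>y. q * (A 0 y powr (q - 1) * D y))"
    using seq[of "\<lambda>n. inverse (real (Suc n))"] LIMSEQ_inverse_real_of_nat by simp
  then show ?th1 using q by simp
  show ?th2
    unfolding DERIV_def tendsto_at_iff_sequentially
    using seq by (auto simp: comp_def)
qed

text \<open>
  The gradient norm uses this with \<open>A t = \<bar>w + t z\<bar>\<close>, and each step of the mixed norm with
  \<open>A t = I_j(u + t v)\<close>, restricted to the line along which the next coordinate varies.
\<close>

lemma has_derivative_Lq_norm:
  fixes A :: "real \<Rightarrow> 'a \<Rightarrow> real"
  assumes "1 < q"
    and "\<And>t. A t \<in> borel_measurable M" "B \<in> borel_measurable M" "D \<in> borel_measurable M"
    and "\<And>t y. 0 \<le> A t y" "\<And>y. 0 \<le> B y"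
    and "integrable M (\<lambda>y. A 0 y powr q)" "integrable M (\<lambda>y. B y powr q)"
    and "AE y in M. \<forall>t. \<bar>A t y - A 0 y\<bar> \<le> \<bar>t\<bar> * B y"
    and "AE y in M. 0 < A 0 y \<longrightarrow> ((\<lambda>t. A t y) has_real_derivative D y) (at 0)"
    and pos: "0 < (\<integral>y. A 0 y powr q \<partial>M)"
  shows "((\<lambda>t. (\<integral>y. A t y powr q \<partial>M) powr (1 / q)) has_real_derivative
            ((\<integral>y. A 0 y powr q \<partial>M) powr (1 / q)) powr (1 - q) * (\<integral>y. A 0 y powr (q - 1) * D y \<partial>M)) (at 0)"
proof -
  let ?S = "\<integral>y. A 0 y powr q \<partial>M"
  have "((\<lambda>t. \<integral>y. A t y powr q \<partial>M) has_real_derivative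
            q * (\<integral>y. A 0 y powr (q - 1) * D y \<partial>M)) (at 0)"
    using assms by (intro has_derivative_integral_powr(2)[where B=B]) auto
  from DERIV_chain2[where g = "\<lambda>t. \<integral>y. A t y powr q \<partial>M", OF has_real_derivative_powr[OF pos, of "1/q"] this]
  have "((\<lambda>t. (\<integral>y. A t y powr q \<partial>M) powr (1 / q)) has_real_derivative
     1 / q * ?S powr (1 / q - 1) * (q * (\<integral>y. A 0 y powr (q - 1) * D y \<partial>M))) (at 0)" .
  moreover have "?S powr (1 / q - 1) = (?S powr (1 / q)) powr (1 - q)"
    using \<open>1 < q\<close> by (simp add: powr_powr diff_divide_distrib)
  ultimately show ?thesis using \<open>1 < q\<close> by simp
qed

section \<open>Iterated integrals and exceptional sets\<close>

definition upd :: "nat \<Rightarrow> real \<Rightarrow> real^'n::{finite,linorder} \<Rightarrow> real^'n::_" where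
  "upd k t x = (\<chi> i. if i = coord k then t else x $ i)"

lemma upd_upd_same [simp]: "upd k t (upd k s x) = upd k t x"
  by (simp add: upd_def vec_eq_iff)

lemma upd_commute: "coord k \<noteq> (coord l :: 'n::{finite,linorder}) \<Longrightarrow>
    upd k t (upd l s x) = upd l s (upd k t (x :: real^'n::_))"
  by (auto simp: upd_def vec_eq_iff)

lemma measurable_vec_nth [measurable]: "(\<lambda>x :: real^'n::finite. x $ i) \<in> borel_measurable borel"
  by (intro borel_measurable_continuous_onI continuous_intros)

lemma measurable_upd [measurable (raw)]:
  assumes [measurable]: "f \<in> borel_measurable M" "g \<in> borel_measurable M"
  shows "(\<lambda>z. upd k (f z) (g z) :: real^'n::{finite,linorder}) \<in> borel_measurable M"
proof -
  have "upd k t x = x + (t - x $ coord k) *\<^sub>R axis (coord k) 1" for t and x :: "real^'n::_"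
    by (auto simp: upd_def vec_eq_iff axis_def)
  then show ?thesis by simp
qed

text \<open>
  The partial norms \<open>I_j\<close> are functions of the whole point; this is how one says that they depend
  only on the coordinates after the \<open>j\<close>-th.
\<close>

definition indep_upto :: "nat \<Rightarrow> (real^'n::{finite,linorder} \<Rightarrow> 'a) \<Rightarrow> bool" where
  "indep_upto j F \<longleftrightarrow> (\<forall>k t x. 1 \<le> k \<and> k \<le> j \<longrightarrow> F (upd k t x) = F x)"

text \<open>
  The functional \<open>G\<close> stands for an integral over the next coordinate, or for an almost everywhere
  quantifier over it.
\<close>

lemma indep_upto_Suc:
  fixes F :: "real^'n::{finite,linorder} \<Rightarrow> 'a"
  assumes "indep_upto j F"
  shows "indep_upto (Suc j) (\<lambda>x. G (\<lambda>t. F (upd (Suc j) t x)))"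
  unfolding indep_upto_def
proof (intro allI impI arg_cong[where f=G] ext)
  fix k t x s
  assume k: "1 \<le> k \<and> k \<le> Suc j"
  show "F (upd (Suc j) s (upd k t x)) = F (upd (Suc j) s x)"
  proof (cases "(coord k :: 'n) = coord (Suc j)")
    case True
    then have "upd (Suc j) s (upd k t x) = upd (Suc j) s x" by (simp add: upd_def vec_eq_iff)
    then show ?thesis by simp
  next
    case False
    with k have "k \<le> j" by (cases "k = Suc j") auto
    then show ?thesis using k assms False by (simp add: upd_commute indep_upto_def)
  qed
qed

lemma indep_upto_mono: "indep_upto j F \<Longrightarrow> i \<le> j \<Longrightarrow> indep_upto i F"
  by (auto simp: indep_upto_def)

primrec iter_int :: "nat \<Rightarrow> (real^'n::{finite,linorder} \<Rightarrow> ennreal) \<Rightarrow> real^'n::_ \<Rightarrow> ennreal" where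
  "iter_int 0 f x = f x"
| "iter_int (Suc j) f x = (\<integral>\<^sup>+ t. iter_int j f (upd (Suc j) t x) \<partial>lborel)"

text \<open>
  Exceptional null sets are handled coordinate by coordinate: at each stage the remaining condition
  may fail for a null set of values of the current coordinate only. This is the form in which an
  almost everywhere statement on the whole space enters an induction over the partial norms.
\<close>

primrec iter_AE :: "nat \<Rightarrow> (real^'n::{finite,linorder} \<Rightarrow> bool) \<Rightarrow> real^'n::_ \<Rightarrow> bool" where
  "iter_AE 0 P x = P x"
| "iter_AE (Suc j) P x = (AE t in lborel. iter_AE j P (upd (Suc j) t x))"

lemma indep_upto_iter_AE: "indep_upto j (iter_AE j P)"
proof (induction j)
  case (Suc j)
  then show ?case
    using indep_upto_Suc[of j "iter_AE j P" "\<lambda>h. AE t in lborel. h t"] by (simp add: indep_upto_def)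
qed (simp add: indep_upto_def)

lemma indep_upto_mixed_int: "indep_upto j (mixed_int p u j)"
proof (induction j)
  case (Suc j)
  then show ?case
    using indep_upto_Suc[of j "mixed_int p u j" "\<lambda>h. epowr (\<integral>\<^sup>+ t. epowr (h t) (p (coord (Suc j))) \<partial>lebesgue)
       (1 / p (coord (Suc j)))"]
    by (simp add: indep_upto_def upd_def)
qed (simp add: indep_upto_def)

lemma measurable_iter_int [measurable]:
  assumes [measurable]: "f \<in> borel_measurable borel"
  shows "iter_int j f \<in> borel_measurable borel"
proof (induction j)
  case 0
  have "iter_int 0 f = f" by (simp add: fun_eq_iff)
  then show ?case by simp
next
  case (Suc j)
  note [measurable] = Suc
  have "(\<lambda>x. \<integral>\<^sup>+ t. iter_int j f (upd (Suc j) t x) \<partial>lborel) \<in> borel_measurable borel"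
    by measurable
  then show ?case by (simp add: fun_eq_iff[symmetric] cong: measurable_cong)
qed

lemma iter_int_cmult:
  assumes [measurable]: "f \<in> borel_measurable borel" and c: "indep_upto j c"
  shows "iter_int j (\<lambda>x. c x * f x) x = c x * iter_int j f x"
  using c
proof (induction j arbitrary: x)
  case (Suc j)
  have "iter_int (Suc j) (\<lambda>x. c x * f x) x = (\<integral>\<^sup>+ t. c x * iter_int j f (upd (Suc j) t x) \<partial>lborel)"
    using Suc.IH[OF indep_upto_mono[OF Suc.prems]] Suc.prems by (simp add: indep_upto_def)
  also have "\<dots> = c x * iter_int (Suc j) f x"
    by (simp add: nn_integral_cmult)
  finally show ?case .
qed simp

lemma iter_int_mono: "(\<And>x. f x \<le> g x) \<Longrightarrow> iter_int j f x \<le> iter_int j g x"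
  by (induction j arbitrary: x) (auto intro!: nn_integral_mono)

lemma iter_int_eq_0_iff:
  assumes [measurable]: "f \<in> borel_measurable borel"
  shows "iter_int j f x = 0 \<longleftrightarrow> iter_AE j (\<lambda>x. f x = 0) x"
proof (induction j arbitrary: x)
  case (Suc j)
  then show ?case by (simp add: nn_integral_0_iff_AE)
qed simp

lemma iter_AE_mono:
  "iter_AE j P x \<Longrightarrow> (\<And>x. P x \<Longrightarrow> Q x) \<Longrightarrow> iter_AE j Q x"
  by (induction j arbitrary: x) (auto elim!: eventually_mono)

text \<open>
  The coordinates are indexed here by the standard basis vectors, because Lebesgue measure is by
  definition the product measure over the basis.
\<close>

lemma iter_int_eq_PiM:
  fixes f :: "real^'n::{finite,linorder} \<Rightarrow> ennreal"
  defines "e \<equiv> (\<lambda>k. axis (coord k) 1 :: real^'n::_)"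
  assumes [measurable]: "f \<in> borel_measurable borel" and "j \<le> CARD('n)"
  shows "iter_int j f x =
    (\<integral>\<^sup>+ y. f (\<chi> i. if axis i 1 \<in> e ` {1..j} then y (axis i 1) else x $ i) \<partial>PiM (e ` {1..j}) (\<lambda>_. lborel))"
  using assms(3)
proof (induction j arbitrary: x)
  case 0
  interpret product_sigma_finite "\<lambda>_::real^'n::_. lborel :: real measure"
    by standard
  show ?case by (simp add: nn_integral_empty del: nn_integral_const)
next
  case (Suc j)
  interpret product_sigma_finite "\<lambda>_::real^'n::_. lborel :: real measure"
    by standard
  have inj: "inj_on (coord :: nat \<Rightarrow> 'n) {1..CARD('n)}"
    using coord_bij_betw by (auto simp: bij_betw_def)
  have notin: "e (Suc j) \<notin> e ` {1..j}"
    using inj_on_eq_iff[OF inj, of "Suc j"] Suc.prems by (fastforce simp: e_def axis_eq_axis)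
  have ins: "e ` {1..Suc j} = insert (e (Suc j)) (e ` {1..j})"
    by (simp add: atLeastAtMostSuc_conv)
  let ?h = "\<lambda>y. \<chi> i. if axis i 1 \<in> e ` {1..Suc j} then y (axis i 1) else x $ i"
  have m: "?h \<in> borel_measurable (PiM (e ` {1..Suc j}) (\<lambda>_. lborel :: real measure))"
  proof (subst borel_measurable_euclidean_space, intro ballI)
    fix b :: "real^'n::_" assume "b \<in> Basis"
    then obtain i where b: "b = axis i 1" by (auto simp: Basis_vec_def)
    show "(\<lambda>y. ?h y \<bullet> b) \<in> borel_measurable (PiM (e ` {1..Suc j}) (\<lambda>_. lborel :: real measure))"
    proof (cases "b \<in> e ` {1..Suc j}")
      case True
      then have "(\<lambda>y. y b :: real) \<in> measurable (PiM (e ` {1..Suc j}) (\<lambda>_. lborel :: real measure)) lborel"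
        by (rule measurable_component_singleton)
      then show ?thesis using True by (simp add: b inner_axis)
    qed (simp add: b inner_axis)
  qed
  have mm: "(\<lambda>y. f (\<chi> i. if axis i 1 \<in> insert (e (Suc j)) (e ` {1..j}) then y (axis i 1) else x $ i))
      \<in> borel_measurable (PiM (insert (e (Suc j)) (e ` {1..j})) (\<lambda>_. lborel :: real measure))"
    using measurable_compose[OF m assms(2)] unfolding ins .
  have "(\<integral>\<^sup>+ y. f (?h y) \<partial>PiM (e ` {1..Suc j}) (\<lambda>_. lborel))
    = (\<integral>\<^sup>+ t. \<integral>\<^sup>+ y. f (?h (y(e (Suc j) := t))) \<partial>PiM (e ` {1..j}) (\<lambda>_. lborel) \<partial>lborel)"
    unfolding ins
    by (rule product_nn_integral_insert_rev) (simp, rule notin, rule mm)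
  also have "\<dots> = (\<integral>\<^sup>+ t. iter_int j f (upd (Suc j) t x) \<partial>lborel)"
  proof (intro nn_integral_cong)
    fix t
    have "?h (y(e (Suc j) := t)) =
       (\<chi> i. if axis i 1 \<in> e ` {1..j} then y (axis i 1) else upd (Suc j) t x $ i)" for y
    proof (subst vec_eq_iff, intro allI)
      fix i
      have eq: "axis i 1 = e (Suc j) \<longleftrightarrow> i = coord (Suc j)"
        by (simp add: e_def axis_eq_axis)
      show "?h (y(e (Suc j) := t)) $ i =
         (\<chi> i. if axis i 1 \<in> e ` {1..j} then y (axis i 1) else upd (Suc j) t x $ i) $ i"
      proof (cases "i = coord (Suc j)")
        case True
        then have "axis i 1 = e (Suc j)" using eq by simp
        then show ?thesis using notin True unfolding ins by (simp add: upd_def)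
      next
        case False
        then show ?thesis using eq unfolding ins by (simp add: upd_def)
      qed
    qed
    then show "(\<integral>\<^sup>+ y. f (?h (y(e (Suc j) := t))) \<partial>PiM (e ` {1..j}) (\<lambda>_. lborel)) = iter_int j f (upd (Suc j) t x)"
      using Suc by simp
  qed
  finally show ?case by simp
qed

lemma iter_int_eq_nn_integral:
  fixes f :: "real^'n::{finite,linorder} \<Rightarrow> ennreal"
  assumes [measurable]: "f \<in> borel_measurable borel"
  shows "iter_int CARD('n) f x = (\<integral>\<^sup>+ y. f y \<partial>lborel)"
proof -
  have UNIV: "(coord :: nat \<Rightarrow> 'n) ` {1..CARD('n)} = UNIV"
    using coord_bij_betw by (auto simp: bij_betw_def)
  have Basis: "(Basis :: (real^'n::_) set) = (\<lambda>k. axis (coord k) 1) ` {1..CARD('n)}"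
    using UNIV by (auto simp: Basis_vec_def image_image[symmetric, of "\<lambda>i. axis i 1" coord])
  have "(\<chi> i. if (axis i 1 :: real^'n::_) \<in> Basis then y (axis i 1) else x $ i) = (\<Sum>b\<in>Basis. y b *\<^sub>R b)" for y :: "real^'n::_ \<Rightarrow> real" and x
  proof (rule euclidean_eqI)
    fix b :: "real^'n::_" assume B: "b \<in> Basis"
    then obtain i where b: "b = axis i 1" by (auto simp: Basis_vec_def)
    have "(\<chi> i. if (axis i 1 :: real^'n::_) \<in> Basis then y (axis i 1) else x $ i) \<bullet> b = (if b \<in> Basis then y b else x $ i)"
      unfolding b by (simp only: inner_axis vec_lambda_beta inner_real_def mult_1_right)
    then show "(\<chi> i. if (axis i 1 :: real^'n::_) \<in> Basis then y (axis i 1) else x $ i) \<bullet> b = (\<Sum>b\<in>Basis. y b *\<^sub>R b) \<bullet> b"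
      using B by (simp add: inner_sum_left_Basis)
  qed
  then have "iter_int CARD('n) f x = (\<integral>\<^sup>+ y. f (\<Sum>b\<in>Basis. y b *\<^sub>R b) \<partial>PiM (Basis :: (real^'n::_) set) (\<lambda>_. lborel))"
    using iter_int_eq_PiM[OF assms order_refl, of x, folded Basis] by (simp only:)
  also have "\<dots> = (\<integral>\<^sup>+ y. f y \<partial>lborel)"
    by (subst lborel_eq, subst nn_integral_distr) auto
  finally show ?thesis .
qed

lemma iter_AE_iff_AE:
  fixes P :: "real^'n::{finite,linorder} \<Rightarrow> bool"
  assumes [measurable]: "Measurable.pred borel P"
  shows "iter_AE CARD('n) P x \<longleftrightarrow> (AE y in lborel. P y)"
proof -
  let ?f = "\<lambda>y. indicator {y. \<not> P y} y :: ennreal"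
  have [measurable]: "?f \<in> borel_measurable borel" by measurable
  have "iter_AE CARD('n) (\<lambda>y. ?f y = 0) x \<longleftrightarrow> (\<integral>\<^sup>+ y. ?f y \<partial>lborel) = 0"
    using iter_int_eq_0_iff[of ?f "CARD('n)" x] by (simp add: iter_int_eq_nn_integral)
  also have "\<dots> \<longleftrightarrow> (AE y in lborel. ?f y = 0)"
    by (subst nn_integral_0_iff_AE) auto
  finally show ?thesis by (simp add: indicator_eq_0_iff)
qed

text \<open>
  Fubini's theorem for exceptional sets needs measurability, hence the passage to a measurable
  condition that is stronger and still holds almost everywhere.
\<close>

lemma AE_borel_core:
  assumes "AE y in lborel. P y"
  obtains Q where "Measurable.pred borel Q" "AE y in lborel. Q y" "\<And>y. Q y \<Longrightarrow> P (y :: 'a::euclidean_space)"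
proof -
  from assms obtain N where N: "{y. \<not> P y} \<subseteq> N" "N \<in> null_sets lborel"
    by (auto simp: eventually_ae_filter)
  show thesis
  proof (rule that[of "\<lambda>y. y \<notin> N"])
    have "N \<in> sets borel" using N(2) by auto
    then show "Measurable.pred borel (\<lambda>y. y \<notin> N)" by measurable
    show "AE y in lborel. y \<notin> N" using N(2) by (rule AE_not_in)
  qed (use N in auto)
qed

lemma AE_imp_iter_AE:
  fixes P :: "real^'n::{finite,linorder} \<Rightarrow> bool"
  assumes "AE y in lborel. P y"
  shows "iter_AE CARD('n) P x"
  using AE_borel_core[OF assms] iter_AE_iff_AE iter_AE_mono by metis

lemma measurable_iter_AE:
  assumes [measurable]: "Measurable.pred borel P"
  shows "Measurable.pred borel (iter_AE j P)"
proof -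
  let ?f = "\<lambda>y. indicator {y. \<not> P y} y :: ennreal"
  have [measurable]: "?f \<in> borel_measurable borel" by measurable
  have "iter_AE j P = (\<lambda>x. iter_int j ?f x = 0)"
    by (simp add: iter_int_eq_0_iff fun_eq_iff indicator_eq_0_iff)
  then show ?thesis by simp
qed

lemma iter_AE_indep:
  assumes "indep_upto j R" "R x"
  shows "iter_AE j R x"
  using assms
  by (induction j arbitrary: x) (auto simp: indep_upto_def)

lemma iter_AE_iter_AE:
  assumes "iter_AE m P x" "j \<le> m"
  shows "iter_AE m (iter_AE j P) x"
  using assms
proof (induction m arbitrary: x)
  case (Suc m)
  show ?case
  proof (cases "j = Suc m")
    case True
    then show ?thesis using Suc.prems iter_AE_indep[OF indep_upto_iter_AE] by metis
  next
    case False
    then show ?thesis using Suc by (auto elim!: eventually_mono)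
  qed
qed simp

text \<open>
  The inner quantifiers do not see the first \<open>j\<close> coordinates of the point, so quantifying over them
  again changes nothing, and the outer ones complete them to a quantifier over the whole space.
\<close>

lemma AE_iter_AE:
  fixes P :: "real^'n::{finite,linorder} \<Rightarrow> bool"
  assumes "AE y in lborel. P y" "j \<le> CARD('n)"
  shows "AE y in lborel. iter_AE j P y"
proof -
  obtain Q where Q: "Measurable.pred borel Q" "AE y in lborel. Q y" "\<And>y. Q y \<Longrightarrow> P y"
    using AE_borel_core[OF assms(1)] by blast
  have "iter_AE CARD('n) (iter_AE j Q) 0"
    using Q assms(2) by (intro iter_AE_iter_AE AE_imp_iter_AE)
  then have "AE y in lborel. iter_AE j Q y"
    using measurable_iter_AE[OF Q(1)] iter_AE_iff_AE by metis
  then show ?thesis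
    by (rule eventually_mono) (use Q(3) iter_AE_mono in metis)
qed

section \<open>The partial mixed norms and their derivatives\<close>

lemma mixed_int_Suc:
  "mixed_int p u (Suc j) x = Lq_enorm lborel (p (coord (Suc j))) (\<lambda>t. mixed_int p u j (upd (Suc j) t x))"
  by (simp add: Lq_enorm_def upd_def nn_integral_completion)

declare mixed_int.simps(2) [simp del]

lemma measurable_mixed_int [measurable]:
  assumes [measurable]: "u \<in> borel_measurable borel"
  shows "mixed_int p u j \<in> borel_measurable borel"
proof (induction j)
  case 0
  have "mixed_int p u 0 = (\<lambda>x. ennreal \<bar>u x\<bar>)" by (simp add: fun_eq_iff)
  then show ?case by simp
next
  case (Suc j)
  note [measurable] = Suc
  have "mixed_int p u (Suc j) = (\<lambda>x. Lq_enorm lborel (p (coord (Suc j))) (\<lambda>t. mixed_int p u j (upd (Suc j) t x)))"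
    by (intro ext mixed_int_Suc)
  also have "\<dots> \<in> borel_measurable borel"
    unfolding Lq_enorm_def by measurable
  finally show ?case .
qed

lemma mixed_int_mono:
  assumes "\<And>i. 0 < p i" "iter_AE j (\<lambda>x. \<bar>u x\<bar> \<le> \<bar>v x\<bar>) x"
  shows "mixed_int p u j x \<le> mixed_int p v j x"
  using assms(2)
proof (induction j arbitrary: x)
  case (Suc j)
  show ?case
    unfolding mixed_int_Suc using Suc assms(1)
    by (intro Lq_enorm_mono) (auto elim!: eventually_mono)
qed (simp add: ennreal_leI)

lemma mixed_int_cong:
  assumes "iter_AE j (\<lambda>x. u x = v x) x"
  shows "mixed_int p u j x = mixed_int p v j x"
  using assms
proof (induction j arbitrary: x)
  case (Suc j)
  show ?case
    unfolding mixed_int_Suc using Suc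
    by (intro Lq_enorm_cong) (auto elim!: eventually_mono)
qed simp

text \<open>
  Minkowski's inequality in one variable at a time. The pointwise hypothesis, instead of \<open>f = g + h\<close>,
  is what monotonicity preserves from one step to the next.
\<close>

lemma mixed_int_triangle:
  assumes p: "\<And>i. 1 < p i"
    and [measurable]: "f \<in> borel_measurable borel" "g \<in> borel_measurable borel" "h \<in> borel_measurable borel"
    and le: "\<And>x. \<bar>f x\<bar> \<le> \<bar>g x\<bar> + \<bar>h x\<bar>"
  shows "mixed_int p f j x \<le> mixed_int p g j x + mixed_int p h j x"
proof (induction j arbitrary: x)
  case 0
  show ?case using le by (simp add: ennreal_plus[symmetric] ennreal_leI del: ennreal_plus)
next
  case (Suc j)
  have p0: "0 < p i" for i using p[of i] by simp
  have "mixed_int p f (Suc j) x \<le> Lq_enorm lborel (p (coord (Suc j)))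
     (\<lambda>t. mixed_int p g j (upd (Suc j) t x) + mixed_int p h j (upd (Suc j) t x))"
    unfolding mixed_int_Suc using Suc p0 by (intro Lq_enorm_mono) auto
  also have "\<dots> \<le> mixed_int p g (Suc j) x + mixed_int p h (Suc j) x"
    unfolding mixed_int_Suc using p by (intro Lq_enorm_triangle) measurable
  finally show ?case .
qed

lemma mixed_int_cmult:
  assumes p: "\<And>i. 0 < p i" and [measurable]: "u \<in> borel_measurable borel"
  shows "mixed_int p (\<lambda>x. c * u x) j x = ennreal \<bar>c\<bar> * mixed_int p u j x"
proof (induction j arbitrary: x)
  case 0
  show ?case by (simp add: abs_mult ennreal_mult)
next
  case (Suc j)
  have "mixed_int p (\<lambda>x. c * u x) (Suc j) x = Lq_enorm lborel (p (coord (Suc j)))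
     (\<lambda>t. ennreal \<bar>c\<bar> * mixed_int p u j (upd (Suc j) t x))"
    unfolding mixed_int_Suc Suc ..
  also have "\<dots> = ennreal \<bar>c\<bar> * mixed_int p u (Suc j) x"
    unfolding mixed_int_Suc using p by (intro Lq_enorm_cmult) measurable
  finally show ?case .
qed

lemma mixed_int_eq_0_iff:
  assumes [measurable]: "u \<in> borel_measurable borel"
  shows "mixed_int p u j x = 0 \<longleftrightarrow> iter_AE j (\<lambda>x. u x = 0) x"
proof (induction j arbitrary: x)
  case (Suc j)
  have "(\<lambda>t. mixed_int p u j (upd (Suc j) t x)) \<in> borel_measurable lborel"
    by measurable
  then show ?case
    by (simp add: mixed_int_Suc Suc Lq_enorm_eq_0)
qed (simp add: ennreal_eq_0_iff)

text \<open>
  The weight \<open>w\<close> for which \<open>w * v\<close>, integrated over the first \<open>j\<close> coordinates, is the directional derivative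
  of \<open>I_j\<close> at \<open>u\<close> in direction \<open>v\<close> wherever \<open>I_j\<close> is positive. The recursion is the chain rule
  \<open>dI_(j+1) = I_(j+1) powr (1 - q) * \<integral> I_j powr (q - 1) * dI_j\<close> with \<open>q\<close> the next exponent, starting from the
  derivative \<open>sgn (u x)\<close> of \<open>\<bar>u x\<bar>\<close>. The convention that powers of 0 are 0 makes the weight vanish where
  some \<open>I_j\<close> vanishes.
\<close>

primrec mixed_grad ::
  "('n::{finite,linorder} \<Rightarrow> real) \<Rightarrow> (real^'n::_ \<Rightarrow> real) \<Rightarrow> nat \<Rightarrow> real^'n::_ \<Rightarrow> real" where
  "mixed_grad p u 0 x = sgn (u x)"
| "mixed_grad p u (Suc j) x =
     enn2real (mixed_int p u j x) powr (p (coord (Suc j)) - 1)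
     * enn2real (mixed_int p u (Suc j) x) powr (1 - p (coord (Suc j))) * mixed_grad p u j x"

lemma measurable_mixed_grad [measurable]:
  assumes [measurable]: "u \<in> borel_measurable borel"
  shows "mixed_grad p u j \<in> borel_measurable borel"
proof (induction j)
  case 0
  have "mixed_grad p u 0 = (\<lambda>x. sgn (u x))" by (simp add: fun_eq_iff)
  then show ?case by simp
next
  case (Suc j)
  note [measurable] = Suc
  have "mixed_grad p u (Suc j) = (\<lambda>x. enn2real (mixed_int p u j x) powr (p (coord (Suc j)) - 1)
     * enn2real (mixed_int p u (Suc j) x) powr (1 - p (coord (Suc j))) * mixed_grad p u j x)"
    by (simp add: fun_eq_iff)
  then show ?case by simp
qed

text \<open>
  The recursion multiplies \<open>I_j\<close> first with exponent \<open>1 - p_j\<close> and one step later with exponent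
  \<open>p_(j+1) - 1\<close>, which combine to \<open>p_(j+1) - p_j\<close>. For \<open>j = n\<close> only \<open>1 - p_n\<close> remains, which is the reason
  for the convention \<open>p_(n+1) = 1\<close>.
\<close>

lemma Fp_eq_mixed_grad:
  "Fp p u (x :: real^'n::{finite,linorder}) = mixed_grad p u CARD('n) x"
proof -
  let ?I = "\<lambda>j. enn2real (mixed_int p u j x)"
  let ?e = "exponent p"
  have e: "?e k = p (coord k)" if "k \<le> CARD('n)" for k using that by (simp add: exponent_def)
  have *: "mixed_grad p u (Suc j) x = (\<Prod>k=1..j. ?I k powr (?e (k + 1) - ?e k)) * ?I (Suc j) powr (1 - ?e (Suc j))
     * (\<bar>u x\<bar> powr (?e 1 - 2) * u x)" if "Suc j \<le> CARD('n)" for j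
    using that
  proof (induction j)
    case 0
    have "\<bar>u x\<bar> powr (?e 1 - 1) * sgn (u x) = \<bar>u x\<bar> powr (?e 1 - 2) * u x"
    proof (cases "u x = 0")
      case False
      have "\<bar>u x\<bar> powr (?e 1 - 1) = \<bar>u x\<bar> powr (?e 1 - 2) * \<bar>u x\<bar>"
        using powr_add[of "\<bar>u x\<bar>" "?e 1 - 2" 1] by simp
      then show ?thesis by (simp only: mult.assoc abs_mult_sgn)
    qed simp
    then show ?case using 0 e[of 1] by (simp add: mult_ac)
  next
    case (Suc j)
    have "?I (Suc j) powr (?e (Suc (Suc j)) - 1) * ?I (Suc j) powr (1 - ?e (Suc j)) = ?I (Suc j) powr (?e (Suc (Suc j)) - ?e (Suc j))"
      by (simp add: powr_add[symmetric])
    moreover have "mixed_grad p u (Suc (Suc j)) x = ?I (Suc j) powr (?e (Suc (Suc j)) - 1)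
       * ?I (Suc (Suc j)) powr (1 - ?e (Suc (Suc j))) * mixed_grad p u (Suc j) x"
      using e[of "Suc (Suc j)"] Suc.prems by simp
    ultimately show ?case using Suc by (simp add: mult_ac del: mixed_grad.simps(2))
  qed
  obtain m where m: "CARD('n) = Suc m" using not0_implies_Suc[of "CARD('n)"] by auto
  have "?e (CARD('n) + 1) = 1" by (simp add: exponent_def)
  then show ?thesis
    using *[of m] unfolding Fp_def m by (simp add: mult_ac del: mixed_grad.simps(2))
qed


lemma ennreal_enn2real_powr: "a < \<infinity> \<Longrightarrow> ennreal (enn2real a powr r) = epowr a r"
  by (cases a) (auto simp: epowr_ennreal)

text \<open>
  The weights of the last step do not depend on the first \<open>j\<close> coordinates and come out of the inner
  integral. The function \<open>F\<close> is the positive part, the negative part or the absolute value, so that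
  signed iterated integrals reduce to integrals with values in \<open>[0, \<infinity>]\<close>.
\<close>

lemma iter_int_mixed_grad_Suc:
  fixes p :: "'n::{finite,linorder} \<Rightarrow> real"
  assumes [measurable]: "u \<in> borel_measurable borel" "g \<in> borel_measurable borel"
    and F: "\<And>c r. 0 \<le> c \<Longrightarrow> F (c * r) = ennreal c * F r" and [measurable]: "F \<in> borel_measurable borel"
  shows "iter_int (Suc j) (\<lambda>x. F (mixed_grad p u (Suc j) x * g x)) x
    = ennreal (enn2real (mixed_int p u (Suc j) x) powr (1 - p (coord (Suc j))))
      * (\<integral>\<^sup>+ t. ennreal (enn2real (mixed_int p u j (upd (Suc j) t x)) powr (p (coord (Suc j)) - 1))
             * iter_int j (\<lambda>x. F (mixed_grad p u j x * g x)) (upd (Suc j) t x) \<partial>lborel)"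
proof -
  let ?q = "p (coord (Suc j))"
  let ?c = "\<lambda>x. enn2real (mixed_int p u j x) powr (?q - 1) * enn2real (mixed_int p u (Suc j) x) powr (1 - ?q)"
  have ind: "indep_upto j (\<lambda>x. ennreal (?c x))"
    using indep_upto_mixed_int[of j p u] indep_upto_mixed_int[of "Suc j" p u] by (simp add: indep_upto_def)
  have I: "mixed_int p u (Suc j) (upd (Suc j) t x) = mixed_int p u (Suc j) x" for t
    using indep_upto_mixed_int[of "Suc j" p u] by (simp add: indep_upto_def)
  have "iter_int (Suc j) (\<lambda>x. F (mixed_grad p u (Suc j) x * g x)) x =
     (\<integral>\<^sup>+ t. iter_int j (\<lambda>x. ennreal (?c x) * F (mixed_grad p u j x * g x)) (upd (Suc j) t x) \<partial>lborel)"
  proof -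
    have "mixed_grad p u (Suc j) y * g y = ?c y * (mixed_grad p u j y * g y)" for y
      by (simp add: mult.assoc)
    then have "F (mixed_grad p u (Suc j) y * g y) = ennreal (?c y) * F (mixed_grad p u j y * g y)" for y
      by (simp only: F[of "?c y"] mult_nonneg_nonneg powr_ge_zero)
    then show ?thesis by (simp only: iter_int.simps)
  qed
  also have "\<dots> = (\<integral>\<^sup>+ t. ennreal (?c (upd (Suc j) t x)) * iter_int j (\<lambda>x. F (mixed_grad p u j x * g x)) (upd (Suc j) t x) \<partial>lborel)"
    by (subst iter_int_cmult[OF _ ind]) measurable
  also have "\<dots> = (\<integral>\<^sup>+ t. ennreal (enn2real (mixed_int p u (Suc j) x) powr (1 - ?q)) *
      (ennreal (enn2real (mixed_int p u j (upd (Suc j) t x)) powr (?q - 1)) * iter_int j (\<lambda>x. F (mixed_grad p u j x * g x)) (upd (Suc j) t x)) \<partial>lborel)"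
    by (simp add: I ennreal_mult mult_ac)
  also have "\<dots> = ennreal (enn2real (mixed_int p u (Suc j) x) powr (1 - ?q)) * (\<integral>\<^sup>+ t. 
      (ennreal (enn2real (mixed_int p u j (upd (Suc j) t x)) powr (?q - 1)) * iter_int j (\<lambda>x. F (mixed_grad p u j x * g x)) (upd (Suc j) t x)) \<partial>lborel)"
    by (rule nn_integral_cmult) measurable
  finally show ?thesis .
qed

lemma mixed_int_AE_finite:
  assumes [measurable]: "u \<in> borel_measurable borel" and "mixed_int p u (Suc j) x < \<infinity>"
  shows "AE t in lborel. mixed_int p u j (upd (Suc j) t x) < \<infinity>"
  using assms(2) unfolding mixed_int_Suc by (intro Lq_enorm_AE_finite[rotated]) measurable

lemma mixed_grad_Hoelder:
  fixes p :: "'n::{finite,linorder} \<Rightarrow> real"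
  assumes p: "\<And>i. 1 < p i"
    and [measurable]: "u \<in> borel_measurable borel" "v \<in> borel_measurable borel"
    and fin: "mixed_int p u (Suc j) x < \<infinity>" "mixed_int p v (Suc j) x < \<infinity>"
    and le: "AE t in lborel. E t \<le> mixed_int p v j (upd (Suc j) t x)"
  shows "(\<integral>\<^sup>+ t. ennreal (enn2real (mixed_int p u j (upd (Suc j) t x)) powr (p (coord (Suc j)) - 1)) * E t \<partial>lborel)
     \<le> epowr (mixed_int p u (Suc j) x) (p (coord (Suc j)) - 1) * mixed_int p v (Suc j) x"
proof -
  let ?q = "p (coord (Suc j))"
  have "(\<integral>\<^sup>+ t. ennreal (enn2real (mixed_int p u j (upd (Suc j) t x)) powr (?q - 1)) * E t \<partial>lborel)
    \<le> (\<integral>\<^sup>+ t. epowr (mixed_int p u j (upd (Suc j) t x)) (?q - 1) * mixed_int p v j (upd (Suc j) t x) \<partial>lborel)"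
    by (intro nn_integral_mono_AE, use le mixed_int_AE_finite[OF assms(2) fin(1)] in eventually_elim)
       (auto simp: ennreal_enn2real_powr intro!: mult_left_mono)
  also have "\<dots> \<le> epowr (mixed_int p u (Suc j) x) (?q - 1) * mixed_int p v (Suc j) x"
    using fin p unfolding mixed_int_Suc by (intro Lq_enorm_Hoelder) measurable
  finally show ?thesis .
qed

text \<open>
  The derivative of a norm is a functional of norm at most 1; here this is Hoelder's inequality, one
  variable at a time. It gives the absolute convergence of all integrals that represent derivatives.
\<close>

lemma iter_int_mixed_grad_le:
  fixes p :: "'n::{finite,linorder} \<Rightarrow> real"
  assumes p: "\<And>i. 1 < p i"
    and [measurable]: "u \<in> borel_measurable borel" "v \<in> borel_measurable borel"
    and fin: "mixed_int p u j x < \<infinity>" "mixed_int p v j x < \<infinity>"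
  shows "iter_int j (\<lambda>x. ennreal \<bar>mixed_grad p u j x * v x\<bar>) x \<le> mixed_int p v j x"
  using fin
proof (induction j arbitrary: x)
  case 0
  show ?case by (auto simp: abs_mult sgn_if)
next
  case (Suc j)
  let ?q = "p (coord (Suc j))"
  let ?I = "mixed_int p u (Suc j) x"
  have AE: "AE t in lborel. iter_int j (\<lambda>x. ennreal \<bar>mixed_grad p u j x * v x\<bar>) (upd (Suc j) t x) \<le> mixed_int p v j (upd (Suc j) t x)"
    using mixed_int_AE_finite[OF assms(2) Suc.prems(1)] mixed_int_AE_finite[OF assms(3) Suc.prems(2)]
    by eventually_elim (rule Suc.IH)
  have "iter_int (Suc j) (\<lambda>x. ennreal \<bar>mixed_grad p u (Suc j) x * v x\<bar>) x = ennreal (enn2real ?I powr (1 - ?q))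
      * (\<integral>\<^sup>+ t. ennreal (enn2real (mixed_int p u j (upd (Suc j) t x)) powr (?q - 1))
             * iter_int j (\<lambda>x. ennreal \<bar>mixed_grad p u j x * v x\<bar>) (upd (Suc j) t x) \<partial>lborel)"
    by (rule iter_int_mixed_grad_Suc) (auto simp: abs_mult ennreal_mult)
  also have "\<dots> \<le> ennreal (enn2real ?I powr (1 - ?q)) * (epowr ?I (?q - 1) * mixed_int p v (Suc j) x)"
    by (intro mult_left_mono mixed_grad_Hoelder p assms Suc.prems AE) auto
  also have "\<dots> \<le> mixed_int p v (Suc j) x"
  proof -
    have "ennreal (enn2real ?I powr (1 - ?q)) * epowr ?I (?q - 1) \<le> 1"
      using Suc.prems(1)
      by (cases ?I) (auto simp: epowr_ennreal ennreal_mult[symmetric] powr_add[symmetric])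
    then have "ennreal (enn2real ?I powr (1 - ?q)) * epowr ?I (?q - 1) * mixed_int p v (Suc j) x \<le> 1 * mixed_int p v (Suc j) x"
      by (rule mult_right_mono) auto
    then show ?thesis by (simp add: mult.assoc)
  qed
  finally show ?case .
qed

text \<open>
  The Lipschitz estimate is the reverse triangle inequality for \<open>I_j\<close>. It provides the majorant for
  the next integration.
\<close>

lemma mixed_int_perturb_finite:
  assumes p: "\<And>i. 1 < p i"
    and [measurable]: "u \<in> borel_measurable borel" "v \<in> borel_measurable borel"
    and fin: "mixed_int p u j x < \<infinity>" "mixed_int p v j x < \<infinity>"
  shows "mixed_int p (\<lambda>x. u x + s * v x) j x < \<infinity>"
    and "\<bar>enn2real (mixed_int p (\<lambda>x. u x + s * v x) j x) - enn2real (mixed_int p u j x)\<bar> \<le> \<bar>s\<bar> * enn2real (mixed_int p v j x)"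
proof -
  have p0: "0 < p i" for i using p[of i] by simp
  have hom: "mixed_int p (\<lambda>x. s * v x) j x = ennreal \<bar>s\<bar> * mixed_int p v j x"
    by (rule mixed_int_cmult[OF p0]) measurable
  have le1: "mixed_int p (\<lambda>x. u x + s * v x) j x \<le> mixed_int p u j x + ennreal \<bar>s\<bar> * mixed_int p v j x"
    unfolding hom[symmetric] by (rule mixed_int_triangle[OF p]) (auto simp: abs_triangle_ineq)
  have le2: "mixed_int p u j x \<le> mixed_int p (\<lambda>x. u x + s * v x) j x + ennreal \<bar>s\<bar> * mixed_int p v j x"
    unfolding hom[symmetric] by (rule mixed_int_triangle[OF p]) auto
  show fin1: "mixed_int p (\<lambda>x. u x + s * v x) j x < \<infinity>"
    using le1 fin by (auto simp: ennreal_mult_less_top intro: le_less_trans)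
  obtain a where a: "mixed_int p u j x = ennreal a" "0 \<le> a"
    using fin(1) by (cases "mixed_int p u j x") auto
  obtain b where b: "mixed_int p v j x = ennreal b" "0 \<le> b"
    using fin(2) by (cases "mixed_int p v j x") auto
  obtain c where c: "mixed_int p (\<lambda>x. u x + s * v x) j x = ennreal c" "0 \<le> c"
    using fin1 by (cases "mixed_int p (\<lambda>x. u x + s * v x) j x") auto
  note abc = a b c
  have "c \<le> a + \<bar>s\<bar> * b" "a \<le> c + \<bar>s\<bar> * b"
    using le1 le2 abc by (simp_all add: ennreal_mult[symmetric] ennreal_plus[symmetric] del: ennreal_plus)
  then show "\<bar>enn2real (mixed_int p (\<lambda>x. u x + s * v x) j x) - enn2real (mixed_int p u j x)\<bar> \<le> \<bar>s\<bar> * enn2real (mixed_int p v j x)"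
    using abc by simp
qed

lemma enn2real_mixed_int_Suc:
  assumes p: "0 < p (coord (Suc j))" and [measurable]: "u \<in> borel_measurable borel" and fin: "mixed_int p u (Suc j) x < \<infinity>"
  shows "integrable lborel (\<lambda>t. enn2real (mixed_int p u j (upd (Suc j) t x)) powr p (coord (Suc j)))"
    and "enn2real (mixed_int p u (Suc j) x) =
      (\<integral>t. enn2real (mixed_int p u j (upd (Suc j) t x)) powr p (coord (Suc j)) \<partial>lborel) powr (1 / p (coord (Suc j)))"
proof -
  let ?q = "p (coord (Suc j))"
  have eq: "(\<integral>\<^sup>+ t. ennreal (enn2real (mixed_int p u j (upd (Suc j) t x)) powr ?q) \<partial>lborel)
     = (\<integral>\<^sup>+ t. epowr (mixed_int p u j (upd (Suc j) t x)) ?q \<partial>lborel)" (is "?L = ?R")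
    by (intro nn_integral_cong_AE, use mixed_int_AE_finite[OF assms(2) fin] in eventually_elim)
       (simp add: ennreal_enn2real_powr)
  have I: "mixed_int p u (Suc j) x = epowr ?R (1 / ?q)"
    by (simp add: mixed_int_Suc Lq_enorm_def)
  then have R: "?R < \<infinity>" using fin by (simp add: less_top[symmetric])
  show "integrable lborel (\<lambda>t. enn2real (mixed_int p u j (upd (Suc j) t x)) powr ?q)"
    using R eq by (intro integrableI_nonneg) auto
  have "(\<integral>t. enn2real (mixed_int p u j (upd (Suc j) t x)) powr ?q \<partial>lborel) = enn2real ?L"
    by (intro integral_eq_nn_integral) auto
  then show "enn2real (mixed_int p u (Suc j) x) =
      (\<integral>t. enn2real (mixed_int p u j (upd (Suc j) t x)) powr ?q \<partial>lborel) powr (1 / ?q)"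
    using eq p by (simp add: I enn2real_epowr)
qed

lemma has_real_derivative_abs_affine:
  fixes a b :: real
  assumes "a \<noteq> 0"
  shows "((\<lambda>s. \<bar>a + s * b\<bar>) has_real_derivative sgn a * b) (at 0)"
proof -
  have "((\<lambda>s. a + s * b) has_real_derivative b) (at 0)"
    by (auto intro!: derivative_eq_intros)
  moreover have "(abs has_real_derivative sgn a) (at (a + 0 * b))"
    using has_derivative_norm[of "a + 0 * b"] assms
    by (simp add: has_field_derivative_def inner_real_def real_norm_def[abs_def] mult_commute_abs)
  ultimately show ?thesis by (rule DERIV_chain2[rotated])
qed

text \<open>
  Induction on the number of integrated coordinates. For almost every value of the next coordinate the
  finiteness assumptions hold and the induction hypothesis gives the derivative of \<open>I_j\<close> wherever \<open>I_j\<close>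
  is positive; the differentiation lemma for \<open>L^q\<close> norms does the rest. The derivative is expressed by
  positive and negative parts because Tonelli's theorem holds for these without integrability.
\<close>

lemma mixed_int_has_derivative:
  fixes p :: "'n::{finite,linorder} \<Rightarrow> real"
  assumes p: "\<And>i. 1 < p i"
    and [measurable]: "u \<in> borel_measurable borel" "v \<in> borel_measurable borel"
    and fin: "mixed_int p u j x < \<infinity>" "mixed_int p v j x < \<infinity>"
    and nz: "mixed_int p u j x \<noteq> 0"
  shows "((\<lambda>s. enn2real (mixed_int p (\<lambda>x. u x + s * v x) j x)) has_real_derivative
     enn2real (iter_int j (\<lambda>x. ennreal (mixed_grad p u j x * v x)) x) -
     enn2real (iter_int j (\<lambda>x. ennreal (- (mixed_grad p u j x * v x))) x)) (at 0)"
  using fin nz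
proof (induction j arbitrary: x)
  case 0
  then have u: "u x \<noteq> 0" by simp
  then have "((\<lambda>s. \<bar>u x + s * v x\<bar>) has_real_derivative sgn (u x) * v x) (at 0)"
    by (rule has_real_derivative_abs_affine)
  moreover have "enn2real (ennreal r) - enn2real (ennreal (- r)) = r" for r
    by (cases "0 \<le> r") (auto simp: ennreal_neg)
  ultimately show ?case by simp
next
  case (Suc j)
  let ?q = "p (coord (Suc j))"
  let ?I = "mixed_int p u (Suc j) x"
  have p0: "0 < p i" for i using p[of i] by simp
  define A where "A s t = enn2real (mixed_int p (\<lambda>x. u x + s * v x) j (upd (Suc j) t x))" for s t
  define B where "B t = enn2real (mixed_int p v j (upd (Suc j) t x))" for t
  define Ep where "Ep t = iter_int j (\<lambda>x. ennreal (mixed_grad p u j x * v x)) (upd (Suc j) t x)" for t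
  define En where "En t = iter_int j (\<lambda>x. ennreal (- (mixed_grad p u j x * v x))) (upd (Suc j) t x)" for t
  define D where "D t = enn2real (Ep t) - enn2real (En t)" for t
  have [measurable]: "A s \<in> borel_measurable lborel" "B \<in> borel_measurable lborel"
     "Ep \<in> borel_measurable lborel" "En \<in> borel_measurable lborel" for s
    unfolding A_def B_def Ep_def En_def by measurable
  have [measurable]: "D \<in> borel_measurable lborel" unfolding D_def by measurable
  have A0: "A 0 t = enn2real (mixed_int p u j (upd (Suc j) t x))" for t by (simp add: A_def)
  have finS: "mixed_int p (\<lambda>x. u x + s * v x) (Suc j) x < \<infinity>" for s
    by (rule mixed_int_perturb_finite) (use p Suc.prems in auto)
  have IA: "enn2real (mixed_int p (\<lambda>x. u x + s * v x) (Suc j) x) = (\<integral>t. A s t powr ?q \<partial>lborel) powr (1 / ?q)" for s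
    unfolding A_def by (rule enn2real_mixed_int_Suc) (use p0 finS in auto)
  have I0: "enn2real ?I = (\<integral>t. A 0 t powr ?q \<partial>lborel) powr (1 / ?q)"
    using IA[of 0] by simp
  have finAE: "AE t in lborel. mixed_int p u j (upd (Suc j) t x) < \<infinity> \<and> mixed_int p v j (upd (Suc j) t x) < \<infinity>"
    using mixed_int_AE_finite[OF assms(2) Suc.prems(1)] mixed_int_AE_finite[OF assms(3) Suc.prems(2)] by eventually_elim auto
  have pos: "0 < (\<integral>t. A 0 t powr ?q \<partial>lborel)"
  proof -
    have "enn2real ?I > 0" using Suc.prems by (simp add: enn2real_positive_iff zero_less_iff_neq_zero)
    then have "(\<integral>t. A 0 t powr ?q \<partial>lborel) \<noteq> 0" unfolding I0 by auto
    moreover have "0 \<le> (\<integral>t. A 0 t powr ?q \<partial>lborel)" by simp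
    ultimately show ?thesis by linarith
  qed
  have Ele: "AE t in lborel. Ep t \<le> mixed_int p v j (upd (Suc j) t x)" "AE t in lborel. En t \<le> mixed_int p v j (upd (Suc j) t x)"
  proof -
    have le: "Ep t \<le> iter_int j (\<lambda>x. ennreal \<bar>mixed_grad p u j x * v x\<bar>) (upd (Suc j) t x)"
       "En t \<le> iter_int j (\<lambda>x. ennreal \<bar>mixed_grad p u j x * v x\<bar>) (upd (Suc j) t x)" for t
      unfolding Ep_def En_def by (intro iter_int_mono ennreal_leI; simp)+
    have "AE t in lborel. Ep t \<le> mixed_int p v j (upd (Suc j) t x) \<and> En t \<le> mixed_int p v j (upd (Suc j) t x)"
      using finAE
    proof eventually_elim
      case (elim t)
      then have "iter_int j (\<lambda>x. ennreal \<bar>mixed_grad p u j x * v x\<bar>) (upd (Suc j) t x) \<le> mixed_int p v j (upd (Suc j) t x)"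
        by (intro iter_int_mixed_grad_le p assms(2,3)) auto
      then show ?case using le[of t] order_trans by blast
    qed
    then show "AE t in lborel. Ep t \<le> mixed_int p v j (upd (Suc j) t x)" "AE t in lborel. En t \<le> mixed_int p v j (upd (Suc j) t x)"
      by simp_all
  qed
  have Efin: "AE t in lborel. Ep t < \<infinity>" "AE t in lborel. En t < \<infinity>"
  proof -
    show "AE t in lborel. Ep t < \<infinity>"
      using finAE Ele(1) by eventually_elim (use le_less_trans in blast)
    show "AE t in lborel. En t < \<infinity>"
      using finAE Ele(2) by eventually_elim (use le_less_trans in blast)
  qed
  have deriv: "((\<lambda>s. (\<integral>t. A s t powr ?q \<partial>lborel) powr (1 / ?q)) has_real_derivative
            ((\<integral>t. A 0 t powr ?q \<partial>lborel) powr (1 / ?q)) powr (1 - ?q) * (\<integral>t. A 0 t powr (?q - 1) * D t \<partial>lborel)) (at 0)"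
  proof (rule has_derivative_Lq_norm[where B=B])
    show "integrable lborel (\<lambda>y. A 0 y powr ?q)"
      unfolding A0 by (rule enn2real_mixed_int_Suc) (use p0 Suc.prems in auto)
    show "integrable lborel (\<lambda>y. B y powr ?q)"
      unfolding B_def by (rule enn2real_mixed_int_Suc) (use p0 Suc.prems in auto)
    show "AE y in lborel. \<forall>t. \<bar>A t y - A 0 y\<bar> \<le> \<bar>t\<bar> * B y"
      using finAE unfolding A0 unfolding A_def B_def
      by eventually_elim (intro allI mixed_int_perturb_finite(2) p assms(2,3); simp)
    show "AE y in lborel. 0 < A 0 y \<longrightarrow> ((\<lambda>t. A t y) has_real_derivative D y) (at 0)"
      using finAE
    proof eventually_elim
      case (elim t)
      show ?case
      proof
        assume "0 < A 0 t"
        then have "mixed_int p u j (upd (Suc j) t x) \<noteq> 0" by (auto simp: A0)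
        from Suc.IH[OF _ _ this] elim show "((\<lambda>s. A s t) has_real_derivative D t) (at 0)"
          unfolding A_def D_def Ep_def En_def by simp
      qed
    qed
  qed (use p pos in \<open>auto simp: A_def B_def\<close>)
  have part: "integrable lborel (\<lambda>t. A 0 t powr (?q - 1) * enn2real (E t)) \<and>
      enn2real (ennreal (enn2real ?I powr (1 - ?q)) * (\<integral>\<^sup>+ t. ennreal (A 0 t powr (?q - 1)) * E t \<partial>lborel))
      = enn2real ?I powr (1 - ?q) * (\<integral>t. A 0 t powr (?q - 1) * enn2real (E t) \<partial>lborel)"
    if le: "AE t in lborel. E t \<le> mixed_int p v j (upd (Suc j) t x)" and finE: "AE t in lborel. E t < \<infinity>"
      and [measurable]: "E \<in> borel_measurable lborel" for E
  proof -
    have "(\<integral>\<^sup>+ t. ennreal (A 0 t powr (?q - 1)) * E t \<partial>lborel) \<le> epowr ?I (?q - 1) * mixed_int p v (Suc j) x"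
      unfolding A0 by (rule mixed_grad_Hoelder[OF p assms(2,3) Suc.prems(1,2) le])
    also have "\<dots> < \<infinity>" using Suc.prems
      by (cases ?I; cases "mixed_int p v (Suc j) x") (auto simp: epowr_ennreal ennreal_mult[symmetric])
    finally have fin: "(\<integral>\<^sup>+ t. ennreal (A 0 t powr (?q - 1)) * E t \<partial>lborel) < \<infinity>" .
    have eq: "(\<integral>\<^sup>+ t. ennreal (A 0 t powr (?q - 1)) * E t \<partial>lborel) = (\<integral>\<^sup>+ t. ennreal (A 0 t powr (?q - 1) * enn2real (E t)) \<partial>lborel)"
      by (intro nn_integral_cong_AE, use finE in eventually_elim) (simp only: ennreal_mult powr_ge_zero enn2real_nonneg ennreal_enn2real infinity_ennreal_def)
    have "integrable lborel (\<lambda>t. A 0 t powr (?q - 1) * enn2real (E t))"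
      using fin eq by (intro integrableI_nonneg) auto
    moreover have "(\<integral>t. A 0 t powr (?q - 1) * enn2real (E t) \<partial>lborel) = enn2real (\<integral>\<^sup>+ t. ennreal (A 0 t powr (?q - 1)) * E t \<partial>lborel)"
      unfolding eq by (intro integral_eq_nn_integral) auto
    ultimately show ?thesis by (simp add: enn2real_mult)
  qed
  have E1: "iter_int (Suc j) (\<lambda>x. ennreal (mixed_grad p u (Suc j) x * v x)) x =
     ennreal (enn2real ?I powr (1 - ?q)) * (\<integral>\<^sup>+ t. ennreal (A 0 t powr (?q - 1)) * Ep t \<partial>lborel)"
    unfolding A0 Ep_def by (rule iter_int_mixed_grad_Suc) (auto simp: ennreal_mult')
  have E2: "iter_int (Suc j) (\<lambda>x. ennreal (- (mixed_grad p u (Suc j) x * v x))) x =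
     ennreal (enn2real ?I powr (1 - ?q)) * (\<integral>\<^sup>+ t. ennreal (A 0 t powr (?q - 1)) * En t \<partial>lborel)"
    unfolding A0 En_def
    by (rule iter_int_mixed_grad_Suc[where F = "\<lambda>r. ennreal (- r)"]) (auto simp: ennreal_mult'[symmetric])
  have "(\<integral>t. A 0 t powr (?q - 1) * D t \<partial>lborel) = (\<integral>t. A 0 t powr (?q - 1) * enn2real (Ep t) \<partial>lborel) - (\<integral>t. A 0 t powr (?q - 1) * enn2real (En t) \<partial>lborel)"
    using part[OF Ele(1) Efin(1)] part[OF Ele(2) Efin(2)] by (simp add: D_def right_diff_distrib)
  then have K: "enn2real ?I powr (1 - ?q) * (\<integral>t. A 0 t powr (?q - 1) * D t \<partial>lborel)
     = enn2real (iter_int (Suc j) (\<lambda>x. ennreal (mixed_grad p u (Suc j) x * v x)) x) - enn2real (iter_int (Suc j) (\<lambda>x. ennreal (- (mixed_grad p u (Suc j) x * v x))) x)"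
    unfolding E1 E2 using part[OF Ele(1) Efin(1)] part[OF Ele(2) Efin(2)] by (simp add: right_diff_distrib)
  from deriv show ?case
    unfolding IA I0[symmetric] K .
qed

section \<open>Passage to Lebesgue measurable functions\<close>

lemma borel_measurable_lebesgue_cong_AE:
  fixes f g :: "'a::euclidean_space \<Rightarrow> 'b::topological_space"
  assumes g: "g \<in> borel_measurable lebesgue" and ae: "AE x in lborel. f x = g x"
  shows "f \<in> borel_measurable lebesgue"
proof (rule measurableI)
  fix S :: "'b set" assume S: "S \<in> sets borel"
  have "AE x in lebesgue. x \<in> g -` S \<inter> space lebesgue \<longleftrightarrow> x \<in> f -` S \<inter> space lebesgue"
    using AE_completion[OF ae] by eventually_elim auto
  then show "f -` S \<inter> space lebesgue \<in> sets lebesgue"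
    by (rule completion.in_sets_AE) (rule measurable_sets[OF g S], simp)
qed simp

lemma borel_representative:
  fixes u :: "'a::euclidean_space \<Rightarrow> real"
  assumes "u \<in> borel_measurable lebesgue"
  obtains u' where "u' \<in> borel_measurable borel" "AE x in lborel. u x = u' x"
  using completion_ex_borel_measurable_real[OF assms] by auto

lemma mixed_norm_cong:
  assumes "AE x in lborel. u x = v x"
  shows "mixed_norm p u = mixed_norm p v"
  unfolding mixed_norm_def using assms by (intro mixed_int_cong AE_imp_iter_AE)

lemma mixed_norm_mono:
  assumes "\<And>i. 0 < p i" "AE x in lborel. \<bar>u x\<bar> \<le> \<bar>v x\<bar>"
  shows "mixed_norm p u \<le> mixed_norm p v"
  unfolding mixed_norm_def using assms by (intro mixed_int_mono AE_imp_iter_AE)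

lemma mixed_norm_eq_0_iff:
  fixes u :: "real^'n::{finite,linorder} \<Rightarrow> real"
  assumes "u \<in> borel_measurable lebesgue"
  shows "mixed_norm p u = 0 \<longleftrightarrow> (AE x in lborel. u x = 0)"
proof -
  obtain u' where [measurable]: "u' \<in> borel_measurable borel" and eq: "AE x in lborel. u x = u' x"
    using borel_representative[OF assms] .
  have "mixed_norm p u = 0 \<longleftrightarrow> mixed_int p u' CARD('n) 0 = 0"
    using mixed_norm_cong[OF eq] by (simp add: mixed_norm_def)
  also have "\<dots> \<longleftrightarrow> iter_AE CARD('n) (\<lambda>x. u' x = 0) 0"
    by (rule mixed_int_eq_0_iff) measurable
  also have "\<dots> \<longleftrightarrow> (AE x in lborel. u' x = 0)"
    by (rule iter_AE_iff_AE) measurable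
  also have "\<dots> \<longleftrightarrow> (AE x in lborel. u x = 0)"
  proof
    assume "AE x in lborel. u' x = 0" then show "AE x in lborel. u x = 0" using eq by eventually_elim auto
  next
    assume "AE x in lborel. u x = 0" then show "AE x in lborel. u' x = 0" using eq by eventually_elim auto
  qed
  finally show ?thesis .
qed

lemma mixed_norm_cmult:
  assumes "\<And>i. 0 < p i" "u \<in> borel_measurable lebesgue"
  shows "mixed_norm p (\<lambda>x. c * u x) = ennreal \<bar>c\<bar> * mixed_norm p u"
proof -
  obtain u' where u': "u' \<in> borel_measurable borel" and eq: "AE x in lborel. u x = u' x"
    using borel_representative[OF assms(2)] .
  have "mixed_norm p (\<lambda>x. c * u x) = mixed_norm p (\<lambda>x. c * u' x)"
    by (intro mixed_norm_cong, use eq in eventually_elim) simp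
  also have "\<dots> = ennreal \<bar>c\<bar> * mixed_norm p u'"
    unfolding mixed_norm_def by (rule mixed_int_cmult[OF assms(1) u'])
  finally show ?thesis using mixed_norm_cong[OF eq] by simp
qed

text \<open>
  The factors \<open>I_j\<close> are given by integrals over slices, so equality of the functions almost everywhere
  must be known on almost all slices.
\<close>

lemma Fp_cong_AE:
  fixes u v :: "real^'n::{finite,linorder} \<Rightarrow> real"
  assumes "AE x in lborel. u x = v x"
  shows "AE x in lborel. Fp p u x = Fp p v x"
proof -
  have "AE x in lborel. \<forall>j\<in>{1..CARD('n)}. iter_AE j (\<lambda>x. u x = v x) x"
    using AE_iter_AE[OF assms] by (intro AE_finite_allI) auto
  then show ?thesis
    using assms
    by eventually_elim (auto simp: Fp_def intro!: prod.cong arg_cong2[where f="(*)"] arg_cong2[where f="(powr)"] arg_cong[where f=enn2real] mixed_int_cong)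
qed

text \<open>
  The statement for Borel functions and all coordinates, transferred to Borel representatives of
  \<open>u\<close> and \<open>v\<close>. Since \<open>u + t v\<close> and its representative agree outside one null set for all \<open>t\<close> at once, the
  function of \<open>t\<close> to be differentiated is the same.
\<close>

lemma mixed_norm_has_derivative:
  fixes u v :: "real^'n::{finite,linorder} \<Rightarrow> real"
  assumes p: "\<And>i. 1 < p i"
    and u: "u \<in> borel_measurable lebesgue" and v: "v \<in> borel_measurable lebesgue"
    and fin: "mixed_norm p u < \<infinity>" "mixed_norm p v < \<infinity>"
    and nz: "\<not> (AE x in lborel. u x = 0)"
  shows "integrable lebesgue (\<lambda>x. Fp p u x * v x)"
    and "((\<lambda>t. enn2real (mixed_norm p (\<lambda>x. u x + t * v x))) has_real_derivative
           (LINT x|lebesgue. Fp p u x * v x)) (at 0)"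
proof -
  obtain u' where u' [measurable]: "u' \<in> borel_measurable borel" and equ: "AE x in lborel. u x = u' x"
    using borel_representative[OF u] .
  obtain v' where v' [measurable]: "v' \<in> borel_measurable borel" and eqv: "AE x in lborel. v x = v' x"
    using borel_representative[OF v] .
  define F where "F x = mixed_grad p u' CARD('n) x * v' x" for x
  have [measurable]: "F \<in> borel_measurable borel" unfolding F_def by measurable
  have fin': "mixed_int p u' CARD('n) 0 < \<infinity>" "mixed_int p v' CARD('n) 0 < \<infinity>"
    using fin mixed_norm_cong[OF equ] mixed_norm_cong[OF eqv] by (simp_all add: mixed_norm_def)
  have nz': "mixed_int p u' CARD('n) 0 \<noteq> 0"
    using nz mixed_norm_eq_0_iff[OF u, of p] mixed_norm_cong[OF equ, of p] by (simp add: mixed_norm_def)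
  have "(\<integral>\<^sup>+ x. ennreal \<bar>F x\<bar> \<partial>lborel) = iter_int CARD('n) (\<lambda>x. ennreal \<bar>F x\<bar>) 0"
    by (rule iter_int_eq_nn_integral[symmetric]) measurable
  also have "\<dots> \<le> mixed_int p v' CARD('n) 0"
    unfolding F_def by (rule iter_int_mixed_grad_le[OF p u' v' fin'])
  finally have intF: "integrable lborel F"
    using fin' by (intro integrableI_bounded) (auto intro: le_less_trans)
  have Fint: "(LINT x|lborel. F x) = enn2real (iter_int CARD('n) (\<lambda>x. ennreal (F x)) 0) - enn2real (iter_int CARD('n) (\<lambda>x. ennreal (- F x)) 0)"
    by (simp add: real_lebesgue_integral_def[OF intF] iter_int_eq_nn_integral)
  have eq: "mixed_int p (\<lambda>x. u' x + s * v' x) CARD('n) 0 = mixed_norm p (\<lambda>x. u x + s * v x)" for s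
    unfolding mixed_norm_def[symmetric]
    by (intro mixed_norm_cong, use equ eqv in eventually_elim) simp
  have deriv: "((\<lambda>s. enn2real (mixed_norm p (\<lambda>x. u x + s * v x))) has_real_derivative (LINT x|lborel. F x)) (at 0)"
    unfolding Fint unfolding eq[symmetric] F_def
    by (rule mixed_int_has_derivative[OF p u' v' fin' nz'])
  have ae: "AE x in lborel. Fp p u x * v x = F x"
    using Fp_cong_AE[OF equ, of p] eqv by eventually_elim (simp add: F_def Fp_eq_mixed_grad)
  have F': "F \<in> borel_measurable lebesgue" by (rule measurable_completion) simp
  have m: "(\<lambda>x. Fp p u x * v x) \<in> borel_measurable lebesgue"
    by (rule borel_measurable_lebesgue_cong_AE[OF F' ae])
  have "integrable lebesgue F" using intF by (simp add: integrable_completion)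
  then show "integrable lebesgue (\<lambda>x. Fp p u x * v x)"
    by (rule integrable_cong_AE_imp) (use m AE_completion[OF ae] in \<open>auto elim: eventually_mono\<close>)
  have "(LINT x|lebesgue. Fp p u x * v x) = (LINT x|lebesgue. F x)"
    by (intro integral_cong_AE m F' AE_completion[OF ae])
  also have "\<dots> = (LINT x|lborel. F x)" by (rule integral_completion) simp
  finally show "((\<lambda>t. enn2real (mixed_norm p (\<lambda>x. u x + t * v x))) has_real_derivative
           (LINT x|lebesgue. Fp p u x * v x)) (at 0)"
    using deriv by simp
qed

section \<open>Derivative of the gradient terms\<close>

lemma Lp_norm_eq_Lq_enorm: "Lp_norm q g = Lq_enorm lebesgue q (\<lambda>x. ennreal \<bar>g x\<bar>)"
  by (simp add: Lp_norm_def Lq_enorm_def epowr_ennreal)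

lemma Lp_norm_cong: "AE x in lebesgue. f x = g x \<Longrightarrow> Lp_norm q f = Lp_norm q g"
  unfolding Lp_norm_eq_Lq_enorm by (intro Lq_enorm_cong) (auto elim!: eventually_mono)

lemma Lp_norm_mono: "AE x in lebesgue. \<bar>f x\<bar> \<le> \<bar>g x\<bar> \<Longrightarrow> 0 < q \<Longrightarrow> Lp_norm q f \<le> Lp_norm q g"
  unfolding Lp_norm_eq_Lq_enorm by (intro Lq_enorm_mono) (auto elim!: eventually_mono intro: ennreal_leI)

lemma Lp_norm_eq_0_iff:
  "g \<in> borel_measurable lebesgue \<Longrightarrow> Lp_norm q g = 0 \<longleftrightarrow> (AE x in lebesgue. g x = 0)"
  unfolding Lp_norm_eq_Lq_enorm by (subst Lq_enorm_eq_0) (auto simp: ennreal_eq_0_iff)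

lemma Lp_norm_cmult:
  assumes "g \<in> borel_measurable lebesgue" "0 < q"
  shows "Lp_norm q (\<lambda>x. c * g x) = ennreal \<bar>c\<bar> * Lp_norm q g"
proof -
  have "Lp_norm q (\<lambda>x. c * g x) = Lq_enorm lebesgue q (\<lambda>x. ennreal \<bar>c\<bar> * ennreal \<bar>g x\<bar>)"
    by (simp add: Lp_norm_eq_Lq_enorm abs_mult ennreal_mult)
  also have "\<dots> = ennreal \<bar>c\<bar> * Lp_norm q g"
    unfolding Lp_norm_eq_Lq_enorm using assms by (intro Lq_enorm_cmult) auto
  finally show ?thesis .
qed

lemma Lp_norm_integrable:
  assumes [measurable]: "g \<in> borel_measurable lebesgue" and q: "0 < q" and fin: "Lp_norm q g < \<infinity>"
  shows "integrable lebesgue (\<lambda>x. \<bar>g x\<bar> powr q)"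
    and "enn2real (Lp_norm q g) = (LINT x|lebesgue. \<bar>g x\<bar> powr q) powr (1 / q)"
proof -
  have "(\<integral>\<^sup>+ x. ennreal (\<bar>g x\<bar> powr q) \<partial>lebesgue) < \<infinity>"
    using fin by (simp add: Lp_norm_def less_top[symmetric])
  then show "integrable lebesgue (\<lambda>x. \<bar>g x\<bar> powr q)"
    by (intro integrableI_nonneg) auto
  have "(LINT x|lebesgue. \<bar>g x\<bar> powr q) = enn2real (\<integral>\<^sup>+ x. ennreal (\<bar>g x\<bar> powr q) \<partial>lebesgue)"
    by (intro integral_eq_nn_integral) auto
  then show "enn2real (Lp_norm q g) = (LINT x|lebesgue. \<bar>g x\<bar> powr q) powr (1 / q)"
    using q by (simp add: Lp_norm_def enn2real_epowr)
qed

lemma Lp_norm_triangle: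
  assumes [measurable]: "f \<in> borel_measurable lebesgue" "g \<in> borel_measurable lebesgue" and q: "1 < q"
  shows "Lp_norm q (\<lambda>x. f x + g x) \<le> Lp_norm q f + Lp_norm q g"
proof -
  have "Lp_norm q (\<lambda>x. f x + g x) \<le> Lq_enorm lebesgue q (\<lambda>x. ennreal \<bar>f x\<bar> + ennreal \<bar>g x\<bar>)"
    unfolding Lp_norm_eq_Lq_enorm using q
    by (intro Lq_enorm_mono AE_I2) (auto simp: ennreal_plus[symmetric] abs_triangle_ineq intro!: ennreal_leI simp del: ennreal_plus)
  also have "\<dots> \<le> Lp_norm q f + Lp_norm q g"
    unfolding Lp_norm_eq_Lq_enorm using q by (intro Lq_enorm_triangle) auto
  finally show ?thesis .
qed

lemma Lp_norm_has_derivative: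
  fixes w z :: "real^'n::finite \<Rightarrow> real"
  assumes q: "1 < q"
    and [measurable]: "w \<in> borel_measurable lebesgue" "z \<in> borel_measurable lebesgue"
    and fin: "Lp_norm q w < \<infinity>" "Lp_norm q z < \<infinity>"
    and nz: "\<not> (AE x in lebesgue. w x = 0)"
  defines "f \<equiv> \<lambda>x. \<bar>w x / enn2real (Lp_norm q w)\<bar> powr (q - 2) * (w x / enn2real (Lp_norm q w))"
  shows "integrable lebesgue (\<lambda>x. f x * z x)"
    and "((\<lambda>t. enn2real (Lp_norm q (\<lambda>x. w x + t * z x))) has_real_derivative (LINT x|lebesgue. f x * z x)) (at 0)"
proof -
  define S where "S = enn2real (Lp_norm q w)"
  have S: "S > 0"
    using fin(1) nz Lp_norm_eq_0_iff[of w q] by (simp add: S_def enn2real_positive_iff zero_less_iff_neq_zero)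
  have f: "f x = S powr (1 - q) * (\<bar>w x\<bar> powr (q - 1) * sgn (w x))" for x
  proof (cases "w x = 0")
    case False
    have "f x = (\<bar>w x\<bar> powr (q - 2) / S powr (q - 2)) * (w x / S)"
      using S by (simp add: f_def S_def[symmetric] abs_divide powr_divide)
    also have "\<dots> = (\<bar>w x\<bar> powr (q - 2) * (\<bar>w x\<bar> * sgn (w x))) / (S powr (q - 2) * S)"
      by (simp add: abs_mult_sgn)
    also have "\<dots> = (\<bar>w x\<bar> powr (q - 2) * \<bar>w x\<bar> powr 1) * sgn (w x) / (S powr (q - 2) * S powr 1)"
      using S by (simp add: mult.assoc)
    also have "\<dots> = \<bar>w x\<bar> powr (q - 1) * sgn (w x) / S powr (q - 1)"
      by (simp only: powr_add[symmetric]) simp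
    also have "\<dots> = S powr (1 - q) * (\<bar>w x\<bar> powr (q - 1) * sgn (w x))"
      using powr_minus_divide[of S "q - 1"] by simp
    finally show ?thesis .
  qed (simp add: f_def)
  let ?A = "\<lambda>t x. \<bar>w x + t * z x\<bar>"
  have fin_t: "Lp_norm q (\<lambda>x. w x + t * z x) < \<infinity>" for t
  proof -
    have "Lp_norm q (\<lambda>x. w x + t * z x) \<le> Lp_norm q w + Lp_norm q (\<lambda>x. t * z x)"
      by (rule Lp_norm_triangle) (use q in auto)
    also have "Lp_norm q (\<lambda>x. t * z x) = ennreal \<bar>t\<bar> * Lp_norm q z"
      by (rule Lp_norm_cmult) (use q in auto)
    also have "Lp_norm q w + ennreal \<bar>t\<bar> * Lp_norm q z < \<infinity>"
      using fin by (simp add: ennreal_mult_less_top)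
    finally show ?thesis .
  qed
  have N: "enn2real (Lp_norm q (\<lambda>x. w x + t * z x)) = (LINT x|lebesgue. ?A t x powr q) powr (1 / q)" for t
    by (rule Lp_norm_integrable) (use q fin_t in auto)
  have iw: "integrable lebesgue (\<lambda>x. ?A 0 x powr q)" and iz: "integrable lebesgue (\<lambda>x. \<bar>z x\<bar> powr q)"
    using Lp_norm_integrable(1)[of w q] Lp_norm_integrable(1)[of z q] q fin by auto
  have lip: "AE x in lebesgue. \<forall>t. \<bar>?A t x - ?A 0 x\<bar> \<le> \<bar>t\<bar> * \<bar>z x\<bar>"
    by (intro AE_I2) (auto simp: abs_mult[symmetric])
  have der: "AE x in lebesgue. 0 < ?A 0 x \<longrightarrow> ((\<lambda>t. ?A t x) has_real_derivative sgn (w x) * z x) (at 0)"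
    by (intro AE_I2) (auto intro: has_real_derivative_abs_affine)
  have S0: "(LINT x|lebesgue. ?A 0 x powr q) powr (1 / q) = S"
    using N[of 0] by (simp add: S_def)
  have pos: "0 < (LINT x|lebesgue. ?A 0 x powr q)"
  proof -
    have "(LINT x|lebesgue. ?A 0 x powr q) \<noteq> 0" using S0 S by auto
    moreover have "0 \<le> (LINT x|lebesgue. ?A 0 x powr q)" by simp
    ultimately show ?thesis by linarith
  qed
  have fz: "f x * z x = S powr (1 - q) * (?A 0 x powr (q - 1) * (sgn (w x) * z x))" for x
    by (simp add: f)
  have i1: "integrable lebesgue (\<lambda>x. ?A 0 x powr (q - 1) * (sgn (w x) * z x))"
    by (rule has_derivative_integral_powr(1)[OF q _ _ _ _ _ iw iz lip der]) auto
  then show "integrable lebesgue (\<lambda>x. f x * z x)"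
    unfolding fz by (rule integrable_mult_right)
  have "((\<lambda>t. (LINT x|lebesgue. ?A t x powr q) powr (1 / q)) has_real_derivative
     ((LINT x|lebesgue. ?A 0 x powr q) powr (1 / q)) powr (1 - q) * (LINT x|lebesgue. ?A 0 x powr (q - 1) * (sgn (w x) * z x))) (at 0)"
    by (rule has_derivative_Lq_norm[OF q _ _ _ _ _ iw iz lip der pos]) auto
  then show "((\<lambda>t. enn2real (Lp_norm q (\<lambda>x. w x + t * z x))) has_real_derivative (LINT x|lebesgue. f x * z x)) (at 0)"
    unfolding N S0 fz using i1 by simp
qed

section \<open>Smooth functions of one variable and their products\<close>

primrec times_differentiable :: "nat \<Rightarrow> (real \<Rightarrow> real) \<Rightarrow> bool" where
  "times_differentiable 0 f \<longleftrightarrow> True"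
| "times_differentiable (Suc k) f \<longleftrightarrow>
     (\<exists>f'. (\<forall>x. (f has_real_derivative f' x) (at x)) \<and> times_differentiable k f')"

definition smooth :: "(real \<Rightarrow> real) \<Rightarrow> bool" where
  "smooth f \<longleftrightarrow> (\<forall>k. times_differentiable k f)"

lemma times_differentiable_SucD: "times_differentiable (Suc k) f \<Longrightarrow> times_differentiable k f"
  by (induction k arbitrary: f) auto

lemma times_differentiable_add:
  "times_differentiable k f \<Longrightarrow> times_differentiable k g \<Longrightarrow> times_differentiable k (\<lambda>x. f x + g x)"
proof (induction k arbitrary: f g)
  case (Suc k)
  then obtain f' g' where f': "\<forall>x. (f has_real_derivative f' x) (at x)" "times_differentiable k f'"
    and g': "\<forall>x. (g has_real_derivative g' x) (at x)" "times_differentiable k g'"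
    by auto
  show ?case
    unfolding times_differentiable.simps
    by (rule exI[of _ "\<lambda>x. f' x + g' x"]) (use Suc.IH f' g' in \<open>auto intro!: DERIV_add\<close>)
qed simp

lemma times_differentiable_const: "times_differentiable k (\<lambda>x. c)"
proof (induction k arbitrary: c)
  case (Suc k)
  show ?case unfolding times_differentiable.simps
    by (rule exI[of _ "\<lambda>x. 0"]) (use Suc in auto)
qed simp

lemma times_differentiable_mult:
  "times_differentiable k f \<Longrightarrow> times_differentiable k g \<Longrightarrow> times_differentiable k (\<lambda>x. f x * g x)"
proof (induction k arbitrary: f g)
  case (Suc k)
  then obtain f' g' where f': "\<forall>x. (f has_real_derivative f' x) (at x)" "times_differentiable k f'"
    and g': "\<forall>x. (g has_real_derivative g' x) (at x)" "times_differentiable k g'"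
    by auto
  have "times_differentiable k f" "times_differentiable k g"
    using Suc.prems times_differentiable_SucD by auto
  then have "times_differentiable k (\<lambda>x. f' x * g x + g' x * f x)"
    using Suc.IH f' g' by (auto intro!: times_differentiable_add)
  moreover have "((\<lambda>x. f x * g x) has_real_derivative f' x * g x + g' x * f x) (at x)" for x
    using f' g' DERIV_mult by blast
  ultimately show ?case
    unfolding times_differentiable.simps by (intro exI[of _ "\<lambda>x. f' x * g x + g' x * f x"]) simp
qed simp

lemma times_differentiable_affine:
  "times_differentiable k f \<Longrightarrow> times_differentiable k (\<lambda>x. f (a * x + b))"
proof (induction k arbitrary: f)
  case (Suc k)
  then obtain f' where f': "\<forall>x. (f has_real_derivative f' x) (at x)" "times_differentiable k f'"
    by auto
  have "((\<lambda>x. f (a * x + b)) has_real_derivative f' (a * x + b) * a) (at x)" for x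
    by (rule DERIV_chain2[where g = "\<lambda>x. a * x + b"]) (use f' in \<open>auto intro!: derivative_eq_intros\<close>)
  moreover have "times_differentiable k (\<lambda>x. f' (a * x + b) * a)"
    using Suc.IH f' by (auto intro!: times_differentiable_mult times_differentiable_const)
  ultimately show ?case
    unfolding times_differentiable.simps by (intro exI[of _ "\<lambda>x. f' (a * x + b) * a"]) simp
qed simp

lemma smooth_mult: "smooth f \<Longrightarrow> smooth g \<Longrightarrow> smooth (\<lambda>x. f x * g x)"
  by (simp add: smooth_def times_differentiable_mult)

lemma smooth_affine: "smooth f \<Longrightarrow> smooth (\<lambda>x. f (a * x + b))"
  by (simp add: smooth_def times_differentiable_affine)

lemma smooth_shift: "smooth f \<Longrightarrow> smooth (\<lambda>x. f (x - b))"
  using smooth_affine[of f 1 "-b"] by simp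

lemma smooth_add: "smooth f \<Longrightarrow> smooth g \<Longrightarrow> smooth (\<lambda>x. f x + g x)"
  by (simp add: smooth_def times_differentiable_add)

lemma smooth_const: "smooth (\<lambda>x. c)"
  by (simp add: smooth_def times_differentiable_const)

lemma smooth_diff: "smooth f \<Longrightarrow> smooth g \<Longrightarrow> smooth (\<lambda>x. f x - g x)"
  using smooth_add[of f "\<lambda>x. (-1) * g x"] smooth_mult[OF smooth_const[of "-1"], of g] by simp

text \<open>
  Each order of differentiability comes with its own derivative function; uniqueness of derivatives
  makes them the same function.
\<close>

lemma smooth_derivative:
  assumes "smooth f"
  obtains f' where "\<And>x. (f has_real_derivative f' x) (at x)" "smooth f'"
proof -
  have "times_differentiable 1 f" using assms unfolding smooth_def by blast
  then obtain f' where f': "\<And>x. (f has_real_derivative f' x) (at x)" by auto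
  have "times_differentiable k f'" for k
  proof -
    have "times_differentiable (Suc k) f" using assms unfolding smooth_def by blast
    then obtain g where g: "\<And>x. (f has_real_derivative g x) (at x)" "times_differentiable k g" by auto
    have "g = f'" using g(1) f' DERIV_unique by blast
    then show ?thesis using g by simp
  qed
  then show thesis using that[of f'] f' by (simp add: smooth_def)
qed

lemma smooth_antiderivative:
  assumes "\<And>x. (f has_real_derivative f' x) (at x)" "smooth f'"
  shows "smooth f"
  unfolding smooth_def
proof
  fix k
  show "times_differentiable k f"
    by (cases k) (use assms in \<open>auto simp: smooth_def\<close>)
qed

lemma smooth_isCont: "smooth f \<Longrightarrow> isCont f x"
  by (metis smooth_derivative DERIV_isCont)

text \<open>
  The classical flat function \<open>exp (-1/x)\<close>. The powers of \<open>1/x\<close> make the family closed under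
  differentiation up to linear combinations, which proves smoothness by induction.
\<close>

definition flat_exp :: "nat \<Rightarrow> real \<Rightarrow> real" where
  "flat_exp n x = (if 0 < x then (1 / x) ^ n * exp (- (1 / x)) else 0)"

lemma flat_exp_has_derivative:
  "(flat_exp n has_real_derivative flat_exp (n + 2) x - real n * flat_exp (n + 1) x) (at x)"
proof -
  consider "x < 0" | "x = 0" | "x > 0" by linarith
  then show ?thesis
  proof cases
    case 1
    have "((\<lambda>x. 0) has_real_derivative 0) (at x)" by simp
    then have "(flat_exp n has_real_derivative 0) (at x)"
      by (rule has_field_derivative_transform_within_open[where S="{..<0}"]) (use 1 in \<open>auto simp: flat_exp_def\<close>)
    then show ?thesis using 1 by (simp add: flat_exp_def)
  next
    case 2
    have eq: "(flat_exp n h - flat_exp n 0) / h = (if h > 0 then (inverse h) ^ (n+1) / exp (inverse h) else 0)" for h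
      by (simp add: flat_exp_def exp_minus field_simps)
    have "((\<lambda>h. (inverse h) ^ (n+1) / exp (inverse h)) \<longlongrightarrow> (0::real)) (at_right 0)"
      using filterlim_compose[OF tendsto_power_div_exp_0 filterlim_inverse_at_top_right] .
    then have "((\<lambda>h. (flat_exp n (0 + h) - flat_exp n 0) / h) \<longlongrightarrow> 0) (at_right 0)"
      by (rule Lim_transform_eventually) (auto simp: eq eventually_at_right_less intro!: eventually_mono[OF eventually_at_right_less])
    moreover have "((\<lambda>h. (flat_exp n (0 + h) - flat_exp n 0) / h) \<longlongrightarrow> 0) (at_left 0)"
      by (rule Lim_transform_eventually[OF tendsto_const[of 0]])
         (auto simp: eq eventually_at_left_field intro!: exI[of _ "-1"])
    ultimately have "((\<lambda>h. (flat_exp n (0 + h) - flat_exp n 0) / h) \<longlongrightarrow> 0) (at 0)"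
      by (simp add: filterlim_at_split)
    then show ?thesis using 2 by (simp add: DERIV_def flat_exp_def)
  next
    case 3
    have "((\<lambda>x. (1 / x) ^ n * exp (- (1 / x))) has_real_derivative
       (1/x)^(n+2) * exp (- (1/x)) - real n * ((1/x)^(n+1) * exp (- (1 / x)))) (at x)"
    proof -
      have inv: "((\<lambda>x. 1 / x) has_real_derivative - ((1 / x)\<^sup>2)) (at x)"
        using 3 by (auto intro!: derivative_eq_intros simp: power2_eq_square)
      have "((\<lambda>x. (1 / x) ^ n) has_real_derivative - real n * (1 / x) ^ (n + 1)) (at x)"
      proof -
        have "real n * (- ((1 / x)\<^sup>2) * (1 / x) ^ (n - Suc 0)) = - real n * (1 / x) ^ (n + 1)"
          by (cases n) (auto simp: power2_eq_square algebra_simps add_divide_distrib diff_divide_distrib)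
        then show ?thesis using DERIV_power[OF inv, of n] by metis
      qed
      moreover have "((\<lambda>x. exp (- (1 / x))) has_real_derivative exp (- (1 / x)) * (- (- ((1 / x)\<^sup>2)))) (at x)"
        by (rule DERIV_chain2[OF DERIV_exp DERIV_minus[OF inv]])
      ultimately have "((\<lambda>x. (1 / x) ^ n * exp (- (1 / x))) has_real_derivative
         - real n * (1 / x) ^ (n + 1) * exp (- (1 / x)) + exp (- (1 / x)) * (- (- ((1 / x)\<^sup>2))) * (1 / x) ^ n) (at x)"
        by (rule DERIV_mult)
      then show ?thesis by (simp add: power_add power2_eq_square mult_ac)
    qed
    then have "(flat_exp n has_real_derivative
       (1/x)^(n+2) * exp (- (1/x)) - real n * ((1/x)^(n+1) * exp (- (1 / x)))) (at x)"
      by (rule has_field_derivative_transform_within_open[where S="{0<..}"]) (use 3 in \<open>auto simp: flat_exp_def\<close>)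
    then show ?thesis using 3 by (simp add: flat_exp_def)
  qed
qed

lemma smooth_flat_exp: "smooth (flat_exp n)"
proof -
  have "times_differentiable k (flat_exp n)" for k
  proof (induction k arbitrary: n)
    case (Suc k)
    have "times_differentiable k (\<lambda>x. flat_exp (n + 2) x + (- real n) * flat_exp (n + 1) x)"
      by (intro times_differentiable_add times_differentiable_mult times_differentiable_const Suc)
    then show ?case
      using flat_exp_has_derivative[of n] unfolding times_differentiable.simps by (intro exI[of _ "\<lambda>x. flat_exp (n + 2) x - real n * flat_exp (n + 1) x"]) simp
  qed simp
  then show ?thesis by (simp add: smooth_def)
qed

text \<open>
  Scaling the argument of \<open>exp (-1/x)\<close> by a large factor \<open>m\<close> amounts to taking an \<open>m\<close>-th root. The functions
  thus have the same support for all \<open>m\<close> and increase to the indicator of the interval; the scale is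
  \<open>Suc m\<close> because the scale 0 would give the zero function.
\<close>

definition bump :: "nat \<Rightarrow> real \<Rightarrow> real \<Rightarrow> real \<Rightarrow> real" where
  "bump m a b x = flat_exp 0 (real (Suc m) * (x - a)) * flat_exp 0 (real (Suc m) * (b - x))"

lemma smooth_bump: "smooth (bump m a b)"
proof -
  have "bump m a b = (\<lambda>x. flat_exp 0 (real (Suc m) * x + (- real (Suc m) * a)) * flat_exp 0 (- real (Suc m) * x + real (Suc m) * b))"
    by (simp add: bump_def fun_eq_iff algebra_simps)
  then show ?thesis by (simp only: smooth_mult smooth_affine smooth_flat_exp)
qed

lemma bump_bounds: "0 \<le> bump m a b x" "bump m a b x \<le> 1"
  by (auto simp: bump_def flat_exp_def intro!: mult_le_one)

lemma bump_outside: "x \<notin> {a<..<b} \<Longrightarrow> bump m a b x = 0"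
  by (auto simp: bump_def flat_exp_def zero_less_mult_iff)

lemma bump_tendsto: "(\<lambda>m. bump m a b x) \<longlonglongrightarrow> indicator {a<..<b} x"
proof (cases "x \<in> {a<..<b}")
  case True
  have *: "(\<lambda>m. flat_exp 0 (real (Suc m) * c)) \<longlonglongrightarrow> 1" if "c > 0" for c
  proof -
    have "(\<lambda>m. exp (- (inverse (real (Suc m)) * inverse c))) \<longlonglongrightarrow> exp (- (0 * inverse c))"
      by (intro tendsto_intros LIMSEQ_inverse_real_of_nat)
    moreover have "flat_exp 0 (real (Suc m) * c) = exp (- (inverse (real (Suc m)) * inverse c))" for m
      using that by (auto simp: flat_exp_def divide_inverse)
    ultimately show ?thesis by simp
  qed
  have "(\<lambda>m. bump m a b x) \<longlonglongrightarrow> 1 * 1"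
    unfolding bump_def using True by (intro tendsto_mult *) auto
  then show ?thesis using True by simp
qed (simp add: bump_outside)

text \<open>
  Products of functions of one coordinate each are a sufficient supply of test functions: partial
  derivatives act on one factor only, so all differentiability questions are one-dimensional.
\<close>

definition tensor :: "('n::finite \<Rightarrow> real \<Rightarrow> real) \<Rightarrow> real^'n \<Rightarrow> real" where
  "tensor F x = (\<Prod>i\<in>UNIV. F i (x $ i))"

lemma tensor_upd: "tensor (F(i := G)) x = G (x $ i) * (\<Prod>j\<in>UNIV - {i}. F j (x $ j))"
  unfolding tensor_def by (subst prod.remove[of _ i]) auto

lemma tensor_has_derivative:
  fixes F :: "'n::finite \<Rightarrow> real \<Rightarrow> real"
  assumes "\<And>i y. (F i has_real_derivative F' i y) (at y)"
  shows "(tensor F has_derivative (\<lambda>h. \<Sum>i\<in>UNIV. (h $ i * F' i (x $ i)) * (\<Prod>j\<in>UNIV - {i}. F j (x $ j)))) (at x)"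
proof -
  have "((\<lambda>x. F i (x $ i)) has_derivative (\<lambda>h. h $ i * F' i (x $ i))) (at x)" for i
  proof -
    have "((\<lambda>x. x $ i) has_derivative (\<lambda>h. h $ i)) (at x)"
      by (intro bounded_linear_imp_has_derivative bounded_linear_vec_nth)
    moreover have "(F i has_derivative (\<lambda>h. h * F' i (x $ i))) (at (x $ i))"
      using assms[of i "x $ i"] by (simp add: has_field_derivative_def mult_commute_abs)
    ultimately show ?thesis
      using has_derivative_compose[of "\<lambda>x. x $ i" "\<lambda>h. h $ i" x UNIV "F i"] by simp
  qed
  from has_derivative_prod[of UNIV "\<lambda>i x. F i (x $ i)", OF this] show ?thesis
    unfolding tensor_def[abs_def] .
qed

lemma pderivative_tensor:
  fixes F :: "'n::finite \<Rightarrow> real \<Rightarrow> real"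
  assumes "\<And>i. smooth (F i)" and k: "\<And>y. (F k has_real_derivative G y) (at y)"
  shows "pderivative k (tensor F) = tensor (F(k := G))"
proof -
  have "\<exists>f'. \<forall>y. (F i has_real_derivative f' y) (at y)" for i
    using smooth_derivative[OF assms(1)[of i]] by metis
  then obtain F' where F': "\<And>i y. (F i has_real_derivative F' i y) (at y)" by metis
  have Fk: "F' k = G" using F'[of k] k DERIV_unique by blast
  show ?thesis
  proof
    fix x
    have "pderivative k (tensor F) x = (\<Sum>i\<in>UNIV. (axis k 1 $ i * F' i (x $ i)) * (\<Prod>j\<in>UNIV - {i}. F j (x $ j)))"
      unfolding pderivative_def frechet_derivative_at[OF tensor_has_derivative[OF F'], symmetric] ..
    also have "\<dots> = (\<Sum>i\<in>UNIV. if i = k then F' i (x $ i) * (\<Prod>j\<in>UNIV - {i}. F j (x $ j)) else 0)"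
      by (intro sum.cong) (auto simp: axis_def)
    also have "\<dots> = tensor (F(k := G)) x"
      by (simp add: tensor_upd Fk)
    finally show "pderivative k (tensor F) x = tensor (F(k := G)) x" .
  qed
qed

lemma differentiable_tensor:
  assumes "\<And>i. smooth (F i)"
  shows "tensor F differentiable_on UNIV"
proof -
  have "\<exists>f'. \<forall>y. (F i has_real_derivative f' y) (at y)" for i
    using smooth_derivative[OF assms(1)[of i]] by metis
  then obtain F' where F': "\<And>i y. (F i has_real_derivative F' i y) (at y)" by metis
  show ?thesis
    using tensor_has_derivative[of F F', OF F'] by (auto simp: differentiable_on_def differentiable_def)
qed

lemma Ck_tensor:
  assumes "\<And>i. smooth (F i)"
  shows "Ck k (tensor F)"
  using assms
proof (induction k arbitrary: F)
  case 0
  then show ?case by (auto intro: differentiable_imp_continuous_on[OF differentiable_tensor])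
next
  case (Suc k)
  have "Ck k (pderivative i (tensor F))" for i
  proof -
    obtain G where G: "\<And>x. (F i has_real_derivative G x) (at x)" "smooth G"
      using smooth_derivative[OF Suc.prems[of i]] by blast
    have "smooth ((F(i := G)) j)" for j using Suc.prems G(2) by simp
    then have "Ck k (tensor (F(i := G)))" by (rule Suc.IH)
    then show ?thesis
      using pderivative_tensor[of F i G, OF Suc.prems G(1)] by simp
  qed
  then show ?case using differentiable_tensor[OF Suc.prems] by simp
qed

lemma tensor_outside:
  assumes "\<And>i y. y \<notin> {a i..b i} \<Longrightarrow> F i y = 0" "x \<notin> cbox (\<chi> i. a i) (\<chi> i. b i)"
  shows "tensor F x = 0"
proof -
  obtain i where "x $ i \<notin> {a i..b i}" using assms(2) by (auto simp: mem_box_cart)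
  then have "F i (x $ i) = 0" by (rule assms(1))
  then show ?thesis unfolding tensor_def by (intro prod_zero) auto
qed

lemma tensor_test_function:
  assumes "\<And>i. smooth (F i)" "\<And>i y. y \<notin> {a i..b i} \<Longrightarrow> F i y = 0"
  shows "tensor F \<in> test_functions UNIV"
proof -
  have "support_on UNIV (tensor F) \<subseteq> cbox (\<chi> i. a i) (\<chi> i. b i)"
    using tensor_outside[of a b F] assms(2) by (auto simp: support_on_def)
  then have "bounded (support_on UNIV (tensor F))"
    using bounded_cbox bounded_subset by blast
  then show ?thesis
    using Ck_tensor[of F, OF assms(1)] by (simp add: test_functions_def)
qed

section \<open>Fundamental lemma of the calculus of variations\<close>

text \<open>
  Boxes generate the Borel sets and are stable under intersection, so the positive and the negative part
  of the function are densities of the same measure.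
\<close>

lemma AE_zero_if_integral_box_zero:
  fixes f :: "'a::euclidean_space \<Rightarrow> real"
  assumes f: "integrable lborel f"
    and zero: "\<And>a b. (LINT x|lborel. indicator (box a b) x * f x) = 0"
  shows "AE x in lborel. f x = 0"
proof -
  have [measurable]: "f \<in> borel_measurable borel" using f by auto
  define M where "M = density lborel (\<lambda>x. ennreal (f x))"
  define N where "N = density lborel (\<lambda>x. ennreal (- f x))"
  have eq: "emeasure M (box a b) = emeasure N (box a b) \<and> emeasure M (box a b) \<noteq> \<infinity>" for a b :: 'a
  proof -
    let ?g = "\<lambda>x. indicator (box a b) x * f x"
    have g: "integrable lborel ?g"
      using integrable_mult_indicator[of "box a b" lborel f] f by simp
    have M: "emeasure M (box a b) = (\<integral>\<^sup>+ x. ennreal (?g x) \<partial>lborel)"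
      unfolding M_def by (subst emeasure_density) (auto intro!: nn_integral_cong simp: indicator_def)
    have N: "emeasure N (box a b) = (\<integral>\<^sup>+ x. ennreal (- ?g x) \<partial>lborel)"
      unfolding N_def by (subst emeasure_density) (auto intro!: nn_integral_cong simp: indicator_def)
    have "enn2real (emeasure M (box a b)) = enn2real (emeasure N (box a b))"
      using zero[of a b] real_lebesgue_integral_def[OF g] by (simp add: M N)
    moreover have "emeasure M (box a b) \<noteq> \<infinity>" "emeasure N (box a b) \<noteq> \<infinity>"
      using g unfolding real_integrable_def M N by auto
    ultimately show ?thesis
      by (cases "emeasure M (box a b)"; cases "emeasure N (box a b)") auto
  qed
  have "M = N"
  proof (rule measure_eqI_generator_eq)
    let ?E = "range (\<lambda>(a, b). box a b::'a set)"
    show "Int_stable ?E"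
      by (auto simp: Int_stable_def box_Int_box)
    show "?E \<subseteq> Pow UNIV" "sets M = sigma_sets UNIV ?E" "sets N = sigma_sets UNIV ?E"
      by (simp_all add: borel_eq_box M_def N_def)
    let ?A = "\<lambda>n::nat. box (- (real n *\<^sub>R One)) (real n *\<^sub>R One) :: 'a set"
    show "range ?A \<subseteq> ?E" "(\<Union>i. ?A i) = UNIV"
      unfolding UN_box_eq_UNIV by auto
    show "emeasure M (?A i) \<noteq> \<infinity>" for i using eq by blast
    show "emeasure M X = emeasure N X" if "X \<in> ?E" for X
      using that eq by auto
  qed
  then have "AE x in lborel. ennreal (f x) = ennreal (- f x)"
    unfolding M_def N_def by (intro sigma_finite_measure.density_unique[OF sigma_finite_lborel]) auto
  then show ?thesis
  proof eventually_elim
    case (elim x)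
    then show ?case
      by (cases "f x" "0 :: real" rule: linorder_cases) (auto simp: ennreal_neg)
  qed
qed

lemma locally_integrable_measurable:
  fixes g :: "real^'n::finite \<Rightarrow> real"
  assumes "locally_integrable g"
  shows "g \<in> borel_measurable lebesgue"
proof (rule borel_measurable_LIMSEQ_real)
  fix n :: nat
  have "set_integrable lebesgue (cball 0 (real n)) g"
    using assms compact_cball unfolding locally_integrable_def by metis
  then show "(\<lambda>x. indicator (cball 0 (real n)) x *\<^sub>R g x) \<in> borel_measurable lebesgue"
    unfolding set_integrable_def by auto
next
  fix x :: "real^'n"
  obtain N :: nat where N: "norm x \<le> real N" using real_arch_simple by blast
  have "eventually (\<lambda>n. indicator (cball 0 (real n)) x *\<^sub>R g x = g x) sequentially"
    using eventually_ge_at_top[of N]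
  proof eventually_elim
    case (elim n)
    then have "norm x \<le> real n" using N by linarith
    then show ?case by simp
  qed
  then show "(\<lambda>n. indicator (cball 0 (real n)) x *\<^sub>R g x) \<longlonglongrightarrow> g x"
    by (rule tendsto_eventually)
qed

lemma continuous_measurable_lebesgue:
  "continuous_on UNIV (f :: 'a::euclidean_space \<Rightarrow> real) \<Longrightarrow> f \<in> borel_measurable lebesgue"
  by (rule measurable_completion) (simp add: borel_measurable_continuous_onI)

lemma integrable_locally_mult:
  assumes u: "locally_integrable u" and c: "continuous_on UNIV f"
    and K: "compact K" "\<And>x. x \<notin> K \<Longrightarrow> f x = 0"
  shows "integrable lebesgue (\<lambda>x. u x * f x)"
proof -
  have "bounded (f ` K)"
    using K c by (intro compact_imp_bounded compact_continuous_image) (auto intro: continuous_on_subset)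
  then obtain C where C: "\<And>x. x \<in> K \<Longrightarrow> norm (f x) \<le> C" by (auto simp: bounded_iff)
  have "integrable lebesgue (\<lambda>x. C * (indicator K x *\<^sub>R u x))"
    using u K unfolding locally_integrable_def set_integrable_def by (intro integrable_mult_right) auto
  then show ?thesis
  proof (rule Bochner_Integration.integrable_bound)
    show "(\<lambda>x. u x * f x) \<in> borel_measurable lebesgue"
      using locally_integrable_measurable[OF u] continuous_measurable_lebesgue[OF c] by measurable
    have "norm (u x * f x) \<le> norm (C * (indicator K x *\<^sub>R u x))" for x
    proof (cases "x \<in> K")
      case True
      then have "\<bar>f x\<bar> \<le> C" using C by auto
      then show ?thesis using True by (auto simp: abs_mult mult.commute intro!: mult_right_mono)
    qed (use K in auto)
    then show "AE x in lebesgue. norm (u x * f x) \<le> norm (C * (indicator K x *\<^sub>R u x))" by simp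
  qed
qed

lemma locally_integrable_continuous:
  assumes "continuous_on UNIV f"
  shows "locally_integrable f"
  unfolding locally_integrable_def set_integrable_def
proof (intro allI impI)
  fix K :: "(real^'a) set" assume K: "compact K"
  have i: "integrable lborel (\<lambda>x. indicator K x *\<^sub>R f x)"
    using borel_integrable_compact[OF K] assms continuous_on_subset by blast
  then show "integrable lebesgue (\<lambda>x. indicator K x *\<^sub>R f x)"
    using integrable_completion[of _ lborel] borel_measurable_integrable[OF i] by blast
qed

text \<open>
  Products of bumps converge boundedly to indicators of boxes, so all integrals over boxes vanish.
\<close>

lemma AE_zero_if_orthogonal_to_tensors:
  fixes g :: "real^'n::finite \<Rightarrow> real"
  assumes g: "locally_integrable g"
    and zero: "\<And>F a b. (\<And>i. smooth (F i)) \<Longrightarrow> (\<And>i y. y \<notin> {a i..b i} \<Longrightarrow> F i y = 0) \<Longrightarrow>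
        (LINT x|lebesgue. g x * tensor F x) = 0"
  shows "AE x in lebesgue. g x = 0"
proof -
  note [measurable] = locally_integrable_measurable[OF g]
  have int: "integrable lebesgue (\<lambda>x. indicator (box a b) x * g x)" for a b
  proof -
    have "set_integrable lebesgue (cbox a b) g"
      using g unfolding locally_integrable_def by auto
    then have "set_integrable lebesgue (box a b) g"
      by (rule set_integrable_subset) (auto simp: box_subset_cbox)
    then show ?thesis by (simp add: set_integrable_def)
  qed
  have box0: "(LINT x|lebesgue. indicator (box a b) x * g x) = 0" for a b
  proof -
    let ?F = "\<lambda>m i. bump m (a $ i) (b $ i)"
    let ?s = "\<lambda>m x. g x * tensor (?F m) x"
    have c: "continuous_on UNIV (tensor (?F m))" for m
      using Ck_tensor[of "?F m" 0] smooth_bump by auto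
    have out: "tensor (?F m) x = 0" if x: "x \<notin> box a b" for m x
    proof -
      obtain i where "x $ i \<notin> {a $ i<..<b $ i}"
        using x unfolding mem_box_cart greaterThanLessThan_iff by blast
      then have "?F m i (x $ i) = 0" by (rule bump_outside)
      then show ?thesis unfolding tensor_def by (intro prod_zero bexI[of _ i]) auto
    qed
    have le1: "\<bar>tensor (?F m) x\<bar> \<le> 1" for m x
      unfolding tensor_def abs_prod by (intro prod_le_1) (auto simp: bump_bounds)
    have "(\<lambda>m. LINT x|lebesgue. ?s m x) \<longlonglongrightarrow> (LINT x|lebesgue. g x * indicator (box a b) x)"
    proof (rule integral_dominated_convergence[where w = "\<lambda>x. \<bar>indicator (box a b) x * g x\<bar>"])
      show "?s m \<in> borel_measurable lebesgue" for m
        using continuous_measurable_lebesgue[OF c] by measurable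
      show "integrable lebesgue (\<lambda>x. \<bar>indicator (box a b) x * g x\<bar>)"
        using int by auto
      have "(\<lambda>m. tensor (?F m) x) \<longlonglongrightarrow> indicator (box a b) x" for x
      proof -
        have "(\<lambda>m. tensor (?F m) x) \<longlonglongrightarrow> (\<Prod>i\<in>UNIV. indicator {a $ i<..<b $ i} (x $ i))"
          unfolding tensor_def by (intro tendsto_prod bump_tendsto)
        also have "(\<Prod>i\<in>UNIV. indicator {a $ i<..<b $ i} (x $ i)) = (indicator (box a b) x :: real)"
        proof (cases "x \<in> box a b")
          case False
          then obtain i where i: "x $ i \<notin> {a $ i<..<b $ i}"
            unfolding mem_box_cart greaterThanLessThan_iff by blast
          then have "(\<Prod>i\<in>UNIV. indicator {a $ i<..<b $ i} (x $ i)) = (0 :: real)"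
            by (intro prod_zero bexI[of _ i]) auto
          then show ?thesis using False by simp
        qed (auto simp: mem_box_cart)
        finally show ?thesis .
      qed
      then show "AE x in lebesgue. (\<lambda>m. ?s m x) \<longlonglongrightarrow> g x * indicator (box a b) x"
        by (intro AE_I2 tendsto_intros)
      have "norm (?s m x) \<le> \<bar>indicator (box a b) x * g x\<bar>" for m x
        using le1[of m x] out[of x m] by (cases "x \<in> box a b") (auto simp: abs_mult mult_left_le)
      then show "AE x in lebesgue. norm (?s m x) \<le> \<bar>indicator (box a b) x * g x\<bar>" for m by simp
      show "(\<lambda>x. g x * indicator (box a b) x) \<in> borel_measurable lebesgue"
        using borel_measurable_integrable[OF int[of a b]] by (simp add: mult.commute)
    qed
    moreover have "(LINT x|lebesgue. ?s m x) = 0" for m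
    proof (rule zero[of "?F m" "\<lambda>i. a $ i" "\<lambda>i. b $ i"])
      show "smooth (?F m i)" for i by (rule smooth_bump)
      show "?F m i y = 0" if "y \<notin> {a $ i..b $ i}" for i y
        by (rule bump_outside) (use that in auto)
    qed
    ultimately show ?thesis
      using LIMSEQ_unique[of "\<lambda>m. 0::real"] by (auto simp: mult.commute)
  qed
  have "AE x in lebesgue. indicator (box (- (real n *\<^sub>R One)) (real n *\<^sub>R One)) x * g x = 0" for n :: nat
  proof -
    let ?B = "box (- (real n *\<^sub>R One)) (real n *\<^sub>R One) :: (real^'n) set"
    let ?f = "\<lambda>x. indicator ?B x * g x"
    have m: "?f \<in> borel_measurable lebesgue" using int by auto
    obtain f' where f' [measurable]: "f' \<in> borel_measurable borel" and eq: "AE x in lborel. ?f x = f' x"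
      using borel_representative[OF m] .
    have f'l: "f' \<in> borel_measurable lebesgue" by (rule measurable_completion) simp
    have "integrable lebesgue f'"
      by (rule integrable_cong_AE_imp[OF int f'l]) (use AE_completion[OF eq] in \<open>auto elim: eventually_mono\<close>)
    then have i: "integrable lborel f'" by (simp add: integrable_completion)
    have "AE x in lborel. f' x = 0"
    proof (rule AE_zero_if_integral_box_zero[OF i])
      fix a b :: "real^'n"
      have "(LINT x|lborel. indicator (box a b) x * f' x) = (LINT x|lebesgue. indicator (box a b) x * f' x)"
        by (rule integral_completion[symmetric]) measurable
      also have "\<dots> = (LINT x|lebesgue. indicator (box a b \<inter> ?B) x * g x)"
      proof (rule integral_cong_AE)
        show "(\<lambda>x. indicator (box a b) x * f' x) \<in> borel_measurable lebesgue"
          by (rule measurable_completion) simp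
        show "(\<lambda>x. indicator (box a b \<inter> ?B) x * g x) \<in> borel_measurable lebesgue"
          unfolding box_Int_box using int by auto
        show "AE x in lebesgue. indicator (box a b) x * f' x = indicator (box a b \<inter> ?B) x * g x"
          using AE_completion[OF eq] by eventually_elim (auto simp: indicator_inter_arith)
      qed
      also have "\<dots> = 0" unfolding box_Int_box by (rule box0)
      finally show "(LINT x|lborel. indicator (box a b) x * f' x) = 0" .
    qed
    with eq have "AE x in lborel. ?f x = 0" by eventually_elim auto
    then show ?thesis by (rule AE_completion)
  qed
  then have "AE x in lebesgue. \<forall>n::nat. indicator (box (- (real n *\<^sub>R One)) (real n *\<^sub>R One)) x * g x = 0"
    unfolding AE_all_countable by blast
  then show ?thesis
  proof eventually_elim
    case (elim x)
    obtain n :: nat where "x \<in> box (- (real n *\<^sub>R One)) (real n *\<^sub>R One)"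
      using UN_box_eq_UNIV by blast
    then show ?case using elim[rule_format, of n] by simp
  qed
qed


section \<open>Weak derivatives\<close>

lemma test_functionD:
  fixes \<phi> :: "real^'n::finite \<Rightarrow> real"
  assumes "\<phi> \<in> test_functions \<Omega>"
  shows "continuous_on UNIV \<phi>" "continuous_on UNIV (pderivative i \<phi>)" "\<phi> differentiable (at x)"
    and "\<exists>K. compact K \<and> K \<subseteq> \<Omega> \<and> (\<forall>x. x \<notin> K \<longrightarrow> \<phi> x = 0 \<and> (\<forall>i. pderivative i \<phi> x = 0))"
proof -
  have C: "Ck k \<phi>" for k using assms by (simp add: test_functions_def)
  show "continuous_on UNIV \<phi>" "continuous_on UNIV (pderivative i \<phi>)" "\<phi> differentiable (at x)"
    using C[of 0] C[of "Suc 0"] by (auto simp: differentiable_on_def)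
  let ?K = "closure (support_on UNIV \<phi>)"
  have zero: "\<phi> x = 0" if "x \<notin> ?K" for x
  proof (rule ccontr)
    assume "\<phi> x \<noteq> 0"
    then have "x \<in> support_on UNIV \<phi>" by (simp add: support_on_def)
    then show False using closure_subset that by blast
  qed
  have "pderivative i \<phi> x = 0" if x: "x \<notin> ?K" for x i
  proof -
    have "((\<lambda>x. 0) has_derivative (\<lambda>x. 0)) (at x)" by simp
    then have "(\<phi> has_derivative (\<lambda>x. 0)) (at x)"
      by (rule has_derivative_transform_within_open[where s = "- ?K"]) (use x zero in auto)
    then show ?thesis using frechet_derivative_at by (metis pderivative_def)
  qed
  then show "\<exists>K. compact K \<and> K \<subseteq> \<Omega> \<and> (\<forall>x. x \<notin> K \<longrightarrow> \<phi> x = 0 \<and> (\<forall>i. pderivative i \<phi> x = 0))"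
    using zero assms by (intro exI[of _ ?K]) (auto simp: test_functions_def)
qed

lemma has_derivative_along_axis:
  fixes \<theta> :: "real^'n::finite \<Rightarrow> real"
  assumes "\<And>x. \<theta> differentiable (at x)"
  shows "((\<lambda>t. \<theta> (x + t *\<^sub>R axis i 1)) has_real_derivative pderivative i \<theta> (x + t *\<^sub>R axis i 1)) (at t)"
proof -
  let ?y = "x + t *\<^sub>R axis i 1"
  have 1: "(\<theta> has_derivative frechet_derivative \<theta> (at ?y)) (at ?y)"
    using assms frechet_derivative_works by blast
  have "((\<lambda>t. x + t *\<^sub>R axis i 1) has_derivative (\<lambda>h. h *\<^sub>R axis i 1)) (at t)"
    by (auto intro!: derivative_eq_intros)
  from has_derivative_compose[OF this 1]
  have "((\<lambda>t. \<theta> (x + t *\<^sub>R axis i 1)) has_derivative (\<lambda>h. frechet_derivative \<theta> (at ?y) (h *\<^sub>R axis i 1))) (at t)"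
    by simp
  moreover have "frechet_derivative \<theta> (at ?y) (h *\<^sub>R axis i 1) = h * pderivative i \<theta> ?y" for h
    using linear_frechet_derivative[OF assms] by (simp add: linear_cmul pderivative_def)
  ultimately show ?thesis
    by (simp add: has_field_derivative_def mult_commute_abs)
qed

lemma integrable_continuous_compact_support:
  fixes f :: "'a::euclidean_space \<Rightarrow> real"
  assumes "continuous_on UNIV f" "compact K" "\<And>x. x \<notin> K \<Longrightarrow> f x = 0"
  shows "integrable lborel f"
proof -
  have "integrable lborel (\<lambda>x. indicator K x *\<^sub>R f x)"
    using borel_integrable_compact[OF assms(2)] assms(1) continuous_on_subset by blast
  moreover have "(\<lambda>x. indicator K x *\<^sub>R f x) = f"
    using assms(3) by (auto simp: fun_eq_iff indicator_def)
  ultimately show ?thesis by simp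
qed

text \<open>
  By translation invariance of the integral the difference quotients in direction \<open>i\<close> have integral 0.
  They are uniformly bounded by the mean value theorem and have a common compact support, so dominated
  convergence applies.
\<close>

lemma integral_pderivative_eq_0:
  fixes \<theta> :: "real^'n::finite \<Rightarrow> real"
  assumes diff: "\<And>x. \<theta> differentiable (at x)" and cont: "continuous_on UNIV (pderivative i \<theta>)"
    and K: "compact K" "\<And>x. x \<notin> K \<Longrightarrow> \<theta> x = 0" "\<And>x. x \<notin> K \<Longrightarrow> pderivative i \<theta> x = 0"
  shows "(LINT x|lborel. pderivative i \<theta> x) = 0"
proof -
  let ?e = "axis i 1 :: real^'n"
  define h where "h n = inverse (real (Suc n))" for n
  have h: "0 < h n" "h n \<le> 1" for n by (auto simp: h_def inverse_le_1_iff)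
  have hn: "h n \<noteq> 0" for n using h(1)[of n] by simp
  let ?s = "\<lambda>n x. (\<theta> (x + h n *\<^sub>R ?e) - \<theta> x) / h n"
  have c\<theta>: "continuous_on UNIV \<theta>"
    using diff by (simp add: continuous_on_eq_continuous_at differentiable_imp_continuous_within)
  then have [measurable]: "\<theta> \<in> borel_measurable borel" by (rule borel_measurable_continuous_onI)
  have [measurable]: "pderivative i \<theta> \<in> borel_measurable borel" using cont by (rule borel_measurable_continuous_onI)
  have int: "integrable lborel \<theta>"
    by (rule integrable_continuous_compact_support[OF c\<theta> K(1,2)])
  have tr: "integrable lborel (\<lambda>x. \<theta> (x + c)) \<and> (LINT x|lborel. \<theta> (x + c)) = (LINT x|lborel. \<theta> x)" for c
  proof -
    have d: "lborel = distr lborel borel ((+) c)" by (simp add: lborel_distr_plus)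
    have "integrable (distr lborel borel ((+) c)) \<theta>" using int d by metis
    then have "integrable lborel (\<lambda>x. \<theta> (c + x))"
      by (subst (asm) integrable_distr_eq) auto
    moreover have "(LINT x|distr lborel borel ((+) c). \<theta> x) = (LINT x|lborel. \<theta> (c + x))"
      by (rule integral_distr) auto
    ultimately show ?thesis using d by (simp add: add.commute)
  qed
  have "bounded (pderivative i \<theta> ` K)"
    using K cont by (intro compact_imp_bounded compact_continuous_image) (auto intro: continuous_on_subset)
  then obtain C0 where C0: "\<And>x. x \<in> K \<Longrightarrow> norm (pderivative i \<theta> x) \<le> C0" by (auto simp: bounded_iff)
  define C where "C = max C0 0"
  have C: "\<bar>pderivative i \<theta> x\<bar> \<le> C" "0 \<le> C" for x
    using C0[of x] K(3)[of x] by (cases "x \<in> K"; auto simp: C_def)+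
  obtain R where R: "\<And>x. x \<in> K \<Longrightarrow> norm x \<le> R"
    using compact_imp_bounded[OF K(1)] by (auto simp: bounded_iff)
  \<comment> \<open>The steps are at most 1, so the quotients vanish at distance more than 1 from the support.\<close>
  let ?K' = "cball 0 (R + 1) :: (real^'n) set"
  have bound: "norm (?s n x) \<le> C * indicator ?K' x" for n x
  proof (cases "x \<in> ?K'")
    case False
    have "x \<notin> K" using False R[of x] by auto
    moreover have "x + h n *\<^sub>R ?e \<notin> K"
    proof
      assume "x + h n *\<^sub>R ?e \<in> K"
      then have "norm (x + h n *\<^sub>R ?e) \<le> R" by (rule R)
      moreover have "norm (h n *\<^sub>R ?e) \<le> 1" using h[of n] by simp
      ultimately have "norm x \<le> R + 1"
        using norm_triangle_ineq4[of "x + h n *\<^sub>R ?e" "h n *\<^sub>R ?e"] by simp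
      then show False using False by simp
    qed
    ultimately show ?thesis using K(2) C(2) by simp
  next
    case True
    obtain t where "\<theta> (x + h n *\<^sub>R ?e) - \<theta> (x + 0 *\<^sub>R ?e) = (h n - 0) * pderivative i \<theta> (x + t *\<^sub>R ?e)"
      using MVT2[OF h(1)[of n], of "\<lambda>t. \<theta> (x + t *\<^sub>R ?e)" "\<lambda>t. pderivative i \<theta> (x + t *\<^sub>R ?e)"]
        has_derivative_along_axis[OF diff] by blast
    then have "?s n x = pderivative i \<theta> (x + t *\<^sub>R ?e)" using h(1)[of n] by simp
    then show ?thesis using True C(1) by simp
  qed
  have "(\<lambda>n. LINT x|lborel. ?s n x) \<longlonglongrightarrow> (LINT x|lborel. pderivative i \<theta> x)"
  proof (rule integral_dominated_convergence[where w = "\<lambda>x. C * indicator ?K' x"])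
    show "integrable lborel (\<lambda>x. C * indicator ?K' x :: real)"
      by (intro integrable_mult_right integrable_real_indicator) (use emeasure_bounded_finite[OF bounded_cball, of 0 "R + 1"] in auto)
    show "AE x in lborel. (\<lambda>n. ?s n x) \<longlonglongrightarrow> pderivative i \<theta> x"
    proof (rule AE_I2)
      fix x
      have "((\<lambda>t. (\<theta> (x + (0 + t) *\<^sub>R ?e) - \<theta> (x + 0 *\<^sub>R ?e)) / t) \<longlongrightarrow> pderivative i \<theta> (x + 0 *\<^sub>R ?e)) (at 0)"
        using has_derivative_along_axis[OF diff, of x i 0] unfolding DERIV_def .
      then have "((\<lambda>t. (\<theta> (x + t *\<^sub>R ?e) - \<theta> x) / t) \<longlongrightarrow> pderivative i \<theta> x) (at 0)" by simp
      moreover have "h \<longlonglongrightarrow> 0" unfolding h_def by (rule LIMSEQ_inverse_real_of_nat)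
      ultimately show "(\<lambda>n. ?s n x) \<longlonglongrightarrow> pderivative i \<theta> x"
        unfolding tendsto_at_iff_sequentially using hn by (simp add: comp_def)
    qed
    show "AE x in lborel. norm (?s n x) \<le> C * indicator ?K' x" for n using bound by simp
  qed simp_all
  moreover have "(LINT x|lborel. ?s n x) = 0" for n
    using tr[of "h n *\<^sub>R ?e"] int by simp
  ultimately have "(\<lambda>n. 0) \<longlonglongrightarrow> (LINT x|lborel. pderivative i \<theta> x)" by (simp only:)
  then show ?thesis
    using LIMSEQ_unique[OF tendsto_const] by metis
qed

lemma pderivative_mult:
  assumes "f differentiable (at x)" "g differentiable (at x)"
  shows "pderivative i (\<lambda>x. f x * g x) x = f x * pderivative i g x + pderivative i f x * g x"
proof -
  have "((\<lambda>x. f x * g x) has_derivative (\<lambda>h. f x * frechet_derivative g (at x) h + frechet_derivative f (at x) h * g x)) (at x)"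
    using assms by (intro has_derivative_mult) (auto simp: frechet_derivative_works[symmetric])
  from frechet_derivative_at[OF this] show ?thesis unfolding pderivative_def by metis
qed

lemma test_function_has_weak_partial:
  fixes \<phi> :: "real^'n::finite \<Rightarrow> real"
  assumes \<phi>: "\<phi> \<in> test_functions \<Omega>"
  shows "has_weak_partial i \<phi> (pderivative i \<phi>)"
  unfolding has_weak_partial_def
proof (intro conjI ballI)
  note D\<phi> = test_functionD[OF \<phi>]
  show "locally_integrable \<phi>" "locally_integrable (pderivative i \<phi>)"
    using D\<phi> by (auto intro: locally_integrable_continuous)
  fix \<psi> :: "real^'n \<Rightarrow> real" assume \<psi>: "\<psi> \<in> test_functions UNIV"
  note D\<psi> = test_functionD[OF \<psi>]
  obtain K where K: "compact K" "\<And>x. x \<notin> K \<Longrightarrow> \<psi> x = 0" "\<And>x. x \<notin> K \<Longrightarrow> pderivative i \<psi> x = 0"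
    using D\<psi>(4) by blast
  let ?\<theta> = "\<lambda>x. \<phi> x * \<psi> x"
  have pd: "pderivative i ?\<theta> = (\<lambda>x. \<phi> x * pderivative i \<psi> x + pderivative i \<phi> x * \<psi> x)"
    by (rule ext, rule pderivative_mult[OF D\<phi>(3) D\<psi>(3)])
  have "(LINT x|lborel. pderivative i ?\<theta> x) = 0"
  proof (rule integral_pderivative_eq_0[OF _ _ K(1)])
    show "?\<theta> differentiable (at x)" for x using D\<phi>(3) D\<psi>(3) by (rule differentiable_mult)
    show "continuous_on UNIV (pderivative i ?\<theta>)"
      unfolding pd using D\<phi> D\<psi> by (intro continuous_intros) auto
  qed (use K pd in auto)
  moreover have "integrable lborel (\<lambda>x. \<phi> x * pderivative i \<psi> x)"
    by (rule integrable_continuous_compact_support[OF _ K(1)]) (use D\<phi> D\<psi> K in \<open>auto intro!: continuous_intros\<close>)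
  moreover have "integrable lborel (\<lambda>x. pderivative i \<phi> x * \<psi> x)"
    by (rule integrable_continuous_compact_support[OF _ K(1)]) (use D\<phi> D\<psi> K in \<open>auto intro!: continuous_intros\<close>)
  ultimately have "(LINT x|lborel. \<phi> x * pderivative i \<psi> x) = - (LINT x|lborel. pderivative i \<phi> x * \<psi> x)"
    by (simp add: pd)
  moreover have "(\<lambda>x. \<phi> x * pderivative i \<psi> x) \<in> borel_measurable borel" "(\<lambda>x. pderivative i \<phi> x * \<psi> x) \<in> borel_measurable borel"
    using D\<phi> D\<psi> by (auto intro!: borel_measurable_continuous_onI continuous_intros)
  ultimately show "(LINT x|lebesgue. \<phi> x * pderivative i \<psi> x) = - (LINT x|lebesgue. pderivative i \<phi> x * \<psi> x)"
    by (simp add: integral_completion)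
qed

lemma integrable_mult_test_function:
  assumes "locally_integrable u" "\<phi> \<in> test_functions \<Omega>"
  shows "integrable lebesgue (\<lambda>x. u x * \<phi> x)" "integrable lebesgue (\<lambda>x. u x * pderivative i \<phi> x)"
proof -
  note D = test_functionD[OF assms(2)]
  obtain K where K: "compact K" "\<And>x. x \<notin> K \<Longrightarrow> \<phi> x = 0" "\<And>x. x \<notin> K \<Longrightarrow> pderivative i \<phi> x = 0"
    using D(4) by blast
  show "integrable lebesgue (\<lambda>x. u x * \<phi> x)"
    by (rule integrable_locally_mult[OF assms(1) D(1) K(1,2)])
  show "integrable lebesgue (\<lambda>x. u x * pderivative i \<phi> x)"
    by (rule integrable_locally_mult[OF assms(1) D(2) K(1,3)])
qed

lemma locally_integrable_add_scaled:
  assumes "locally_integrable u" "locally_integrable v"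
  shows "locally_integrable (\<lambda>x. u x + t * v x)"
  using assms unfolding locally_integrable_def
  by (auto intro!: set_integral_add(1) set_integrable_mult_right)

lemma has_weak_partial_add_scaled:
  assumes u: "has_weak_partial i u w" and v: "has_weak_partial i v z"
  shows "has_weak_partial i (\<lambda>x. u x + t * v x) (\<lambda>x. w x + t * z x)"
  unfolding has_weak_partial_def
proof (intro conjI ballI)
  have li: "locally_integrable u" "locally_integrable v" "locally_integrable w" "locally_integrable z"
    using u v by (auto simp: has_weak_partial_def)
  then show "locally_integrable (\<lambda>x. u x + t * v x)" "locally_integrable (\<lambda>x. w x + t * z x)"
    by (auto intro: locally_integrable_add_scaled)
  fix \<phi> :: "real^'a \<Rightarrow> real" assume \<phi>: "\<phi> \<in> test_functions UNIV"
  note int = li[THEN integrable_mult_test_function(1)[OF _ \<phi>]] li[THEN integrable_mult_test_function(2)[OF _ \<phi>]]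
  have "(LINT x|lebesgue. (u x + t * v x) * pderivative i \<phi> x)
     = (LINT x|lebesgue. u x * pderivative i \<phi> x) + t * (LINT x|lebesgue. v x * pderivative i \<phi> x)"
    using int by (simp add: distrib_right mult.assoc)
  also have "\<dots> = - ((LINT x|lebesgue. w x * \<phi> x) + t * (LINT x|lebesgue. z x * \<phi> x))"
    using u v \<phi> by (simp add: has_weak_partial_def)
  also have "(LINT x|lebesgue. w x * \<phi> x) + t * (LINT x|lebesgue. z x * \<phi> x) = (LINT x|lebesgue. (w x + t * z x) * \<phi> x)"
    using int by (simp add: distrib_right mult.assoc)
  finally show "(LINT x|lebesgue. (u x + t * v x) * pderivative i \<phi> x) = - (LINT x|lebesgue. (w x + t * z x) * \<phi> x)" .
qed

lemma has_weak_partial_unique: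
  assumes "has_weak_partial i u g" "has_weak_partial i u h"
  shows "AE x in lebesgue. g x = h x"
proof -
  have li: "locally_integrable g" "locally_integrable h"
    using assms by (auto simp: has_weak_partial_def)
  have "AE x in lebesgue. g x + (-1) * h x = 0"
  proof (rule AE_zero_if_orthogonal_to_tensors)
    show "locally_integrable (\<lambda>x. g x + (-1) * h x)" by (rule locally_integrable_add_scaled[OF li])
    fix F :: "'a \<Rightarrow> real \<Rightarrow> real" and a b
    assume "\<And>i. smooth (F i)" "\<And>i y. y \<notin> {a i..b i} \<Longrightarrow> F i y = 0"
    then have \<phi>: "tensor F \<in> test_functions UNIV" by (rule tensor_test_function)
    note int = li[THEN integrable_mult_test_function(1)[OF _ \<phi>]]
    have "(LINT x|lebesgue. (g x + (-1) * h x) * tensor F x) = (LINT x|lebesgue. g x * tensor F x) - (LINT x|lebesgue. h x * tensor F x)"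
      using int by (simp add: left_diff_distrib)
    also have "\<dots> = 0"
      using assms \<phi> unfolding has_weak_partial_def by (metis add.inverse_inverse diff_self)
    finally show "(LINT x|lebesgue. (g x + (-1) * h x) * tensor F x) = 0" .
  qed
  then show ?thesis by eventually_elim simp
qed

lemma has_weak_partial_weak_partial:
  "has_weak_partial i u g \<Longrightarrow> has_weak_partial i u (weak_partial i u)"
  unfolding weak_partial_def by (rule someI[of "has_weak_partial i u" g])

lemma weak_partial_eq_AE:
  "has_weak_partial i u g \<Longrightarrow> AE x in lebesgue. weak_partial i u x = g x"
  using has_weak_partial_unique has_weak_partial_weak_partial by blast

text \<open>
  The antiderivative of a compactly supported function is constant on both sides of the support, but
  in general not 0. Subtracting a translate removes the constant on the right-hand side.
\<close>

lemma smooth_antiderivative_of_shift_difference: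
  fixes G :: "real \<Rightarrow> real"
  assumes G: "smooth G" "\<And>y. y \<notin> {a..b} \<Longrightarrow> G y = 0" and L: "0 \<le> L"
  obtains \<Phi> where "smooth \<Phi>" "\<And>y. (\<Phi> has_real_derivative G y - G (y - L)) (at y)"
    "\<And>y. y \<notin> {a..b + L} \<Longrightarrow> \<Phi> y = 0"
proof -
  obtain \<Gamma> where \<Gamma>: "\<And>y. (\<Gamma> has_real_derivative G y) (at y)"
    using einterval_antiderivative[of "-\<infinity>" "\<infinity>" G] smooth_isCont[OF G(1)]
    by (auto simp: has_real_derivative_iff_has_vector_derivative)
  have \<Gamma>0: "(\<Gamma> has_real_derivative 0) (at y within S)" if "y \<notin> {a..b}" for y S
    using has_field_derivative_at_within[OF \<Gamma>[of y], of S] G(2)[OF that] by simp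
  have "\<exists>c. \<forall>y\<in>{..<a}. \<Gamma> y = c"
    by (rule has_field_derivative_zero_constant) (use \<Gamma>0 in auto)
  then obtain c0 where c0: "\<And>y. y < a \<Longrightarrow> \<Gamma> y = c0" by auto
  have "\<exists>c. \<forall>y\<in>{b<..}. \<Gamma> y = c"
    by (rule has_field_derivative_zero_constant) (use \<Gamma>0 in auto)
  then obtain c1 where c1: "\<And>y. y > b \<Longrightarrow> \<Gamma> y = c1" by auto
  let ?\<Phi> = "\<lambda>y. \<Gamma> y - \<Gamma> (y - L)"
  have "((\<lambda>y. \<Gamma> (y - L)) has_real_derivative G (y - L)) (at y)" for y
  proof -
    have "((\<lambda>y. y - L) has_real_derivative 1) (at y)" by (auto intro!: derivative_eq_intros)
    from DERIV_chain2[where g = "\<lambda>y. y - L", OF \<Gamma> this] show ?thesis by simp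
  qed
  then have D: "(?\<Phi> has_real_derivative G y - G (y - L)) (at y)" for y
    using \<Gamma> by (auto intro: DERIV_diff)
  show thesis
  proof (rule that[of ?\<Phi>])
    show "smooth ?\<Phi>"
      by (rule smooth_antiderivative[OF D smooth_diff[OF G(1) smooth_shift[OF G(1)]]])
    show "?\<Phi> y = 0" if "y \<notin> {a..b + L}" for y
      using that c0[of y] c0[of "y - L"] c1[of y] c1[of "y - L"] L by auto
  qed (rule D)
qed

text \<open>
  For a compactly supported product \<open>\<psi>\<close> and a translate \<open>\<psi>'\<close> of it in direction \<open>i\<close>, the difference \<open>\<psi> - \<psi>'\<close> is
  the \<open>i\<close>-th derivative of a test function, so \<open>u\<close> has the same integral against \<open>\<psi>\<close> and \<open>\<psi>'\<close>. If the
  translation is long enough, \<open>\<psi>'\<close> vanishes on the bounded set outside of which \<open>u\<close> is 0, so both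
  integrals are 0.
\<close>

lemma zero_weak_partial_imp_zero:
  fixes u :: "real^'n::finite \<Rightarrow> real"
  assumes u: "has_weak_partial i u g" and g: "AE x in lebesgue. g x = 0"
    and \<Omega>: "bounded \<Omega>" and out: "AE x in lebesgue. x \<notin> \<Omega> \<longrightarrow> u x = 0"
  shows "AE x in lebesgue. u x = 0"
proof (rule AE_zero_if_orthogonal_to_tensors)
  show li: "locally_integrable u" using u by (simp add: has_weak_partial_def)
  fix F :: "'n \<Rightarrow> real \<Rightarrow> real" and a b
  assume F: "\<And>i. smooth (F i)" "\<And>i y. y \<notin> {a i..b i} \<Longrightarrow> F i y = 0"
  obtain R where R: "\<And>x. x \<in> \<Omega> \<Longrightarrow> norm x \<le> R" using \<Omega> by (auto simp: bounded_iff)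
  \<comment> \<open>The set \<open>\<Omega>\<close> lies in the ball of radius \<open>R\<close>; the shifted support begins at \<open>a i + L > R\<close>.\<close>
  define L where "L = \<bar>R\<bar> + \<bar>a i\<bar> + 1"
  have L: "0 \<le> L" "a i + L > R" by (auto simp: L_def)
  obtain \<Phi> where \<Phi>: "smooth \<Phi>" "\<And>y. (\<Phi> has_real_derivative F i y - F i (y - L)) (at y)"
    "\<And>y. y \<notin> {a i..b i + L} \<Longrightarrow> \<Phi> y = 0"
    using smooth_antiderivative_of_shift_difference[OF F L(1)] by blast
  let ?F = "F(i := \<Phi>)" and ?S = "F(i := \<lambda>y. F i (y - L))"
  have smF: "smooth (?F j)" for j using F \<Phi> by simp
  have test: "tensor ?F \<in> test_functions UNIV"
    by (rule tensor_test_function[OF smF, of a "b(i := b i + L)"]) (use F \<Phi> in \<open>auto split: if_splits\<close>)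
  have testF: "tensor F \<in> test_functions UNIV" by (rule tensor_test_function[OF F])
  have testS: "tensor ?S \<in> test_functions UNIV"
  proof (rule tensor_test_function[of ?S "a(i := a i + L)" "b(i := b i + L)"])
    show "smooth (?S j)" for j using F smooth_shift[of "F i" L] by simp
    show "?S j y = 0" if "y \<notin> {(a(i := a i + L)) j..(b(i := b i + L)) j}" for j y
    proof (cases "j = i")
      case True
      then have "y - L \<notin> {a i..b i}" using that by auto
      then show ?thesis using F(2)[of "y - L" i] True by simp
    qed (use that F in auto)
  qed
  have pd: "pderivative i (tensor ?F) x = tensor F x - tensor ?S x" for x
  proof -
    have "pderivative i (tensor ?F) = tensor (?F(i := \<lambda>y. F i y - F i (y - L)))"
      by (rule pderivative_tensor[OF smF]) (use \<Phi>(2) in simp)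
    moreover have "tensor F = tensor (F(i := F i))" by simp
    ultimately show ?thesis by (simp only: tensor_upd fun_upd_upd left_diff_distrib)
  qed
  have "(LINT x|lebesgue. u x * pderivative i (tensor ?F) x) = - (LINT x|lebesgue. g x * tensor ?F x)"
    using u test unfolding has_weak_partial_def by blast
  also have "(LINT x|lebesgue. g x * tensor ?F x) = (LINT x|(lebesgue :: (real^'n) measure). 0)"
  proof (rule integral_cong_AE)
    have "locally_integrable g" using u by (simp add: has_weak_partial_def)
    then show "(\<lambda>x. g x * tensor ?F x) \<in> borel_measurable lebesgue"
      using integrable_mult_test_function(1)[OF _ test] by blast
  qed (use g in auto)
  finally have "(LINT x|lebesgue. u x * (tensor F x - tensor ?S x)) = 0"
    unfolding pd by simp
  moreover note int = integrable_mult_test_function(1)[OF li testF] integrable_mult_test_function(1)[OF li testS]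
  ultimately have "(LINT x|lebesgue. u x * tensor F x) = (LINT x|lebesgue. u x * tensor ?S x)"
    by (simp add: right_diff_distrib)
  also have "\<dots> = (LINT x|(lebesgue :: (real^'n) measure). 0)"
  proof (rule integral_cong_AE)
    show "AE x in lebesgue. u x * tensor ?S x = 0"
      using out
    proof eventually_elim
      case (elim x)
      show ?case
      proof (cases "x \<in> \<Omega>")
        case True
        then have "x $ i \<le> R" using R component_le_norm_cart[of x i] by fastforce
        then have "x $ i - L \<notin> {a i..b i}" using L by auto
        then have "F i (x $ i - L) = 0" by (rule F(2))
        then show ?thesis by (simp add: tensor_upd)
      qed (use elim in simp)
    qed
  qed (use int in auto)
  finally show "(LINT x|lebesgue. u x * tensor F x) = 0" by simp
qed

section \<open>Functions in the anisotropic Sobolev space and the Rayleigh quotient\<close>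

text \<open>
  Test functions and their derivatives vanish outside \<open>\<Omega>\<close>, so the norm of the restriction of \<open>v\<close> to the
  complement is at most the distance of \<open>v\<close> to any test function. Monotonicity of the norms thus
  replaces the extraction of an almost everywhere convergent subsequence. The boundary of \<open>\<Omega>\<close>, which may
  have positive measure, is covered as a part of the complement.
\<close>

lemma W01p_mem:
  fixes p :: "'n::{finite,linorder} \<Rightarrow> real"
  assumes p: "\<And>i. 1 < p i" and \<Omega>: "open \<Omega>" and v: "v \<in> W01p p \<Omega>"
  shows "v \<in> borel_measurable lebesgue" "mixed_norm p v < \<infinity>"
    and "has_weak_partial i v (weak_partial i v)" "weak_partial i v \<in> borel_measurable lebesgue"
      "Lp_norm (p i) (weak_partial i v) < \<infinity>"
    and "AE x in lebesgue. x \<notin> \<Omega> \<longrightarrow> v x = 0"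
    and "AE x in lebesgue. x \<notin> \<Omega> \<longrightarrow> weak_partial i v x = 0"
proof -
  have p0: "0 < p i" for i using p[of i] by simp
  have \<Omega>' [measurable]: "\<Omega> \<in> sets lebesgue" using \<Omega> by auto
  have W: "v \<in> W1p p" using v by (simp add: W01p_def)
  show m [measurable]: "v \<in> borel_measurable lebesgue" and "mixed_norm p v < \<infinity>"
    using W by (auto simp: W1p_def)
  obtain g where g: "has_weak_partial i v g" "Lp_norm (p i) g < \<infinity>"
    using W unfolding W1p_def by blast
  show wp: "has_weak_partial i v (weak_partial i v)" by (rule has_weak_partial_weak_partial[OF g(1)])
  then show wm [measurable]: "weak_partial i v \<in> borel_measurable lebesgue"
    by (intro locally_integrable_measurable) (simp add: has_weak_partial_def)
  show "Lp_norm (p i) (weak_partial i v) < \<infinity>"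
    using Lp_norm_cong[OF weak_partial_eq_AE[OF g(1)]] g(2) by simp
  \<comment> \<open>The restrictions to the complement of \<open>\<Omega>\<close>.\<close>
  let ?f = "\<lambda>x. if x \<in> \<Omega> then 0 else v x" and ?h = "\<lambda>x. if x \<in> \<Omega> then 0 else weak_partial i v x"
  have small: "mixed_norm p ?f < ennreal \<epsilon> \<and> Lp_norm (p i) ?h < ennreal \<epsilon>" if \<epsilon>: "\<epsilon> > 0" for \<epsilon>
  proof -
    obtain \<phi> where \<phi>: "\<phi> \<in> test_functions \<Omega>"
      and less: "mixed_norm p (\<lambda>x. v x - \<phi> x) + grad_norm p (\<lambda>x. v x - \<phi> x) < ennreal \<epsilon>"
      using v \<epsilon> unfolding W01p_def by blast
    have out: "\<phi> x = 0" "pderivative i \<phi> x = 0" if "x \<notin> \<Omega>" for x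
      using test_functionD(4)[OF \<phi>] that by blast+
    have "mixed_norm p ?f \<le> mixed_norm p (\<lambda>x. v x - \<phi> x)"
      by (rule mixed_norm_mono[OF p0]) (use out in auto)
    also have "\<dots> \<le> mixed_norm p (\<lambda>x. v x - \<phi> x) + grad_norm p (\<lambda>x. v x - \<phi> x)" by simp
    finally have 1: "mixed_norm p ?f < ennreal \<epsilon>" using less by simp
    have "has_weak_partial i (\<lambda>x. v x - \<phi> x) (\<lambda>x. weak_partial i v x - pderivative i \<phi> x)"
      using has_weak_partial_add_scaled[OF wp test_function_has_weak_partial[OF \<phi>], of "-1"] by simp
    then have ae: "AE x in lebesgue. weak_partial i (\<lambda>x. v x - \<phi> x) x = weak_partial i v x - pderivative i \<phi> x"
      by (rule weak_partial_eq_AE)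
    have "Lp_norm (p i) ?h \<le> Lp_norm (p i) (\<lambda>x. weak_partial i v x - pderivative i \<phi> x)"
      by (rule Lp_norm_mono[OF _ p0]) (use out in auto)
    also have "\<dots> = Lp_norm (p i) (weak_partial i (\<lambda>x. v x - \<phi> x))"
      using Lp_norm_cong[OF ae] by simp
    also have "\<dots> \<le> grad_norm p (\<lambda>x. v x - \<phi> x)"
      unfolding grad_norm_def by (rule member_le_sum) auto
    also have "\<dots> \<le> mixed_norm p (\<lambda>x. v x - \<phi> x) + grad_norm p (\<lambda>x. v x - \<phi> x)" by simp
    finally have "Lp_norm (p i) ?h < ennreal \<epsilon>" using less by simp
    with 1 show ?thesis by simp
  qed
  have zero: "c = 0" if "\<And>\<epsilon>. \<epsilon> > 0 \<Longrightarrow> c < ennreal \<epsilon>" for c :: ennreal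
  proof (rule ccontr)
    assume "c \<noteq> 0"
    moreover have "c < ennreal 1" using that[of 1] by simp
    ultimately obtain r where "c = ennreal r" "r > 0"
      by (cases c) (auto simp: ennreal_eq_0_iff not_le)
    then show False using that[of r] by simp
  qed
  have "mixed_norm p ?f = 0" by (rule zero) (use small in auto)
  moreover have "?f \<in> borel_measurable lebesgue" by measurable
  ultimately have "AE x in lborel. ?f x = 0" using mixed_norm_eq_0_iff by blast
  then show "AE x in lebesgue. x \<notin> \<Omega> \<longrightarrow> v x = 0"
    by (intro AE_completion) (auto elim!: eventually_mono split: if_splits)
  have "Lp_norm (p i) ?h = 0" by (rule zero) (use small in auto)
  moreover have "?h \<in> borel_measurable lebesgue" by measurable
  ultimately have "AE x in lebesgue. ?h x = 0" using Lp_norm_eq_0_iff by blast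
  then show "AE x in lebesgue. x \<notin> \<Omega> \<longrightarrow> weak_partial i v x = 0"
    by (auto elim!: eventually_mono split: if_splits)
qed


text \<open>
  The derivative exists because no partial derivative of \<open>u\<close> vanishes almost everywhere; otherwise \<open>\<bar>t\<bar>\<close> times the
  norm of the derivative of \<open>v\<close> would not be differentiable at 0. This is where the boundedness of \<open>\<Omega>\<close> enters.
\<close>

lemma grad_norm_has_derivative:
  fixes p :: "'n::{finite,linorder} \<Rightarrow> real"
  assumes p: "\<And>i. 1 < p i" and \<Omega>: "open \<Omega>" "bounded \<Omega>" and u: "u \<in> W01p p \<Omega>" and v: "v \<in> W01p p \<Omega>"
    and nz: "\<not> (AE x in lebesgue. u x = 0)"
  shows "((\<lambda>t. enn2real (grad_norm p (\<lambda>x. u x + t * v x))) has_real_derivative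
           (LINT x:\<Omega>|lebesgue. \<Sum>i\<in>UNIV. flux p u i x * weak_partial i v x)) (at 0)"
proof -
  note U = W01p_mem[OF p \<Omega>(1) u] and V = W01p_mem[OF p \<Omega>(1) v]
  have p0: "0 < p i" for i using p[of i] by simp
  have wnz: "\<not> (AE x in lebesgue. weak_partial i u x = 0)" for i
    using zero_weak_partial_imp_zero[OF U(3) _ \<Omega>(2) U(6)] nz by blast
  have flux: "flux p u i = (\<lambda>x. \<bar>weak_partial i u x / enn2real (Lp_norm (p i) (weak_partial i u))\<bar> powr (p i - 2) *
      (weak_partial i u x / enn2real (Lp_norm (p i) (weak_partial i u))))" for i
    by (simp add: flux_def fun_eq_iff Let_def)
  have L: "integrable lebesgue (\<lambda>x. flux p u i x * weak_partial i v x)"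
    "((\<lambda>t. enn2real (Lp_norm (p i) (\<lambda>x. weak_partial i u x + t * weak_partial i v x))) has_real_derivative
       (LINT x|lebesgue. flux p u i x * weak_partial i v x)) (at 0)" for i
    unfolding flux by (rule Lp_norm_has_derivative[OF p U(4) V(4) U(5) V(5) wnz])+
  have wt: "Lp_norm (p i) (weak_partial i (\<lambda>x. u x + t * v x)) = Lp_norm (p i) (\<lambda>x. weak_partial i u x + t * weak_partial i v x)" for i t
    by (rule Lp_norm_cong[OF weak_partial_eq_AE[OF has_weak_partial_add_scaled[OF U(3) V(3)]]])
  have fin: "Lp_norm (p i) (\<lambda>x. weak_partial i u x + t * weak_partial i v x) < \<infinity>" for i t
  proof -
    have "Lp_norm (p i) (\<lambda>x. weak_partial i u x + t * weak_partial i v x)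
       \<le> Lp_norm (p i) (weak_partial i u) + Lp_norm (p i) (\<lambda>x. t * weak_partial i v x)"
      by (rule Lp_norm_triangle) (use U(4) V(4) p in auto)
    also have "\<dots> < \<infinity>"
      using U(5)[of i] V(5)[of i] by (simp add: Lp_norm_cmult[OF V(4) p0] ennreal_mult_less_top)
    finally show ?thesis .
  qed
  have G: "enn2real (grad_norm p (\<lambda>x. u x + t * v x)) = (\<Sum>i\<in>UNIV. enn2real (Lp_norm (p i) (\<lambda>x. weak_partial i u x + t * weak_partial i v x)))" for t
    unfolding grad_norm_def wt by (subst enn2real_sum) (use fin in \<open>auto simp: o_def\<close>)
  have "((\<lambda>t. \<Sum>i\<in>UNIV. enn2real (Lp_norm (p i) (\<lambda>x. weak_partial i u x + t * weak_partial i v x))) has_real_derivative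
     (\<Sum>i\<in>UNIV. (LINT x|lebesgue. flux p u i x * weak_partial i v x))) (at 0)"
    by (intro DERIV_sum L(2))
  also have "(\<Sum>i\<in>UNIV. (LINT x|lebesgue. flux p u i x * weak_partial i v x)) = (LINT x|lebesgue. (\<Sum>i\<in>UNIV. flux p u i x * weak_partial i v x))"
    using L(1) by simp
  also have "\<dots> = (LINT x:\<Omega>|lebesgue. \<Sum>i\<in>UNIV. flux p u i x * weak_partial i v x)"
    unfolding set_lebesgue_integral_def
  proof (rule integral_cong_AE)
    have [measurable]: "\<Omega> \<in> sets lebesgue" using \<Omega> by auto
    show m [measurable]: "(\<lambda>x. \<Sum>i\<in>UNIV. flux p u i x * weak_partial i v x) \<in> borel_measurable lebesgue"
      by (intro borel_measurable_sum borel_measurable_integrable L(1))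
    show "(\<lambda>x. indicator \<Omega> x *\<^sub>R (\<Sum>i\<in>UNIV. flux p u i x * weak_partial i v x)) \<in> borel_measurable lebesgue"
      by measurable
    have "AE x in lebesgue. \<forall>i\<in>UNIV. x \<notin> \<Omega> \<longrightarrow> weak_partial i v x = 0"
      by (intro AE_finite_allI V(7)) simp
    then show "AE x in lebesgue. (\<Sum>i\<in>UNIV. flux p u i x * weak_partial i v x) =
        indicator \<Omega> x *\<^sub>R (\<Sum>i\<in>UNIV. flux p u i x * weak_partial i v x)"
    proof eventually_elim
      case (elim x)
      then show ?case by (cases "x \<in> \<Omega>") auto
    qed
  qed
  finally show ?thesis unfolding G .
qed

lemma mixed_norm_has_derivative_on:
  fixes p :: "'n::{finite,linorder} \<Rightarrow> real"
  assumes p: "\<And>i. 1 < p i" and \<Omega>: "open \<Omega>" and u: "u \<in> W01p p \<Omega>" and v: "v \<in> W01p p \<Omega>"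
    and nz: "\<not> (AE x in lebesgue. u x = 0)"
  shows "((\<lambda>t. enn2real (mixed_norm p (\<lambda>x. u x + t * v x))) has_real_derivative
           (LINT x:\<Omega>|lebesgue. Fp p u x * v x)) (at 0)"
proof -
  note U = W01p_mem[OF p \<Omega> u] and V = W01p_mem[OF p \<Omega> v]
  have "\<not> (AE x in lborel. u x = 0)" using nz AE_completion by blast
  note N = mixed_norm_has_derivative[OF p U(1) V(1) U(2) V(2) this]
  have "(LINT x|lebesgue. Fp p u x * v x) = (LINT x:\<Omega>|lebesgue. Fp p u x * v x)"
    unfolding set_lebesgue_integral_def
  proof (rule integral_cong_AE)
    have [measurable]: "\<Omega> \<in> sets lebesgue" using \<Omega> by auto
    show [measurable]: "(\<lambda>x. Fp p u x * v x) \<in> borel_measurable lebesgue"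
      using N(1) by (rule borel_measurable_integrable)
    show "(\<lambda>x. indicator \<Omega> x *\<^sub>R (Fp p u x * v x)) \<in> borel_measurable lebesgue"
      by measurable
    show "AE x in lebesgue. Fp p u x * v x = indicator \<Omega> x *\<^sub>R (Fp p u x * v x)"
      using V(6)
    proof eventually_elim
      case (elim x)
      then show ?case by (cases "x \<in> \<Omega>") auto
    qed
  qed
  then show ?thesis using N(2) by simp
qed

text \<open>
  Euler's identity: the derivative of a norm at \<open>u\<close> in direction \<open>u\<close> is the norm of \<open>u\<close>, since the norm of
  \<open>u + t u\<close> is \<open>\<bar>1 + t\<bar>\<close> times that of \<open>u\<close>.
\<close>

lemma has_derivative_at_0_of_homogeneous:
  fixes f :: "real \<Rightarrow> real"
  assumes "(f has_real_derivative d) (at 0)" "\<And>t. f t = \<bar>1 + t\<bar> * c"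
  shows "d = c"
proof -
  have "((\<lambda>t. \<bar>1 + t * 1\<bar> * c) has_real_derivative (sgn 1 * 1) * c) (at 0)"
    using DERIV_cmult_right[OF has_real_derivative_abs_affine[of 1 1], of c] by simp
  moreover have "f = (\<lambda>t. \<bar>1 + t\<bar> * c)" by (rule ext, rule assms(2))
  ultimately have "(f has_real_derivative c) (at 0)" by simp
  then show ?thesis using assms(1) DERIV_unique by blast
qed

theorem theorem3p3:
  fixes \<Omega> :: "(real ^ 'n::{finite,linorder}) set"
    and p :: "'n \<Rightarrow> real"
    and u :: "real ^ 'n::_ \<Rightarrow> real"
  assumes "open \<Omega>" "connected \<Omega>" "\<Omega> \<noteq> {}" "bounded \<Omega>"
    and "1 < p (coord 1)" and "mono p"
    and "harmonic_mean p < real CARD('n)"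
    and "u \<in> W01p p \<Omega>" and "\<not> (AE x in lebesgue. u x = 0)"
  shows "critical_point p \<Omega> u \<longleftrightarrow> (\<exists>\<mu>::real. weak_solution p \<Omega> \<mu> u)"
proof -
  have p: "1 < p i" for i
  proof -
    have "i \<in> coord ` {1..CARD('n)}"
      using bij_betw_imp_surj_on[OF coord_bij_betw[where 'n='n]] by simp
    then obtain k where k: "k \<in> {1..CARD('n)}" "i = coord k" by blast
    then have "(coord 1 :: 'n) \<le> coord k"
      using strict_mono_onD[OF coord_strict_mono_on[where 'n='n], of 1 k] by (cases "k = 1") (auto simp: less_imp_le)
    then show ?thesis using assms(5) monoD[OF assms(6)] k(2) by fastforce
  qed
  have p0: "0 < p i" for i using p[of i] by simp
  note U = W01p_mem[OF p assms(1) assms(8)]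
  define G where "G = enn2real (grad_norm p u)"
  define N where "N = enn2real (mixed_norm p u)"
  define dG where "dG v = (LINT x:\<Omega>|lebesgue. \<Sum>i\<in>UNIV. flux p u i x * weak_partial i v x)" for v
  define dN where "dN v = (LINT x:\<Omega>|lebesgue. Fp p u x * v x)" for v
  have DG: "((\<lambda>t. enn2real (grad_norm p (\<lambda>x. u x + t * v x))) has_real_derivative dG v) (at 0)" if "v \<in> W01p p \<Omega>" for v
    unfolding dG_def by (rule grad_norm_has_derivative[OF p assms(1,4,8) that assms(9)])
  have DN: "((\<lambda>t. enn2real (mixed_norm p (\<lambda>x. u x + t * v x))) has_real_derivative dN v) (at 0)" if "v \<in> W01p p \<Omega>" for v
    unfolding dN_def by (rule mixed_norm_has_derivative_on[OF p assms(1,8) that assms(9)])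
  have "mixed_norm p u \<noteq> 0"
    using mixed_norm_eq_0_iff[OF U(1)] assms(9) AE_completion by blast
  then have N: "N > 0" using U(2) by (simp add: N_def enn2real_positive_iff zero_less_iff_neq_zero)
  have "((\<lambda>t. Rayleigh p (\<lambda>x. u x + t * v x)) has_real_derivative (dG v * N - G * dN v) / (N * N)) (at 0)"
    if "v \<in> W01p p \<Omega>" for v
    using DERIV_divide[OF DG[OF that] DN[OF that]] N by (simp add: Rayleigh_def G_def N_def)
  then have crit: "((\<lambda>t. Rayleigh p (\<lambda>x. u x + t * v x)) has_real_derivative 0) (at 0) \<longleftrightarrow> dG v = G / N * dN v"
    if "v \<in> W01p p \<Omega>" for v
    using that N DERIV_unique[of "\<lambda>t. Rayleigh p (\<lambda>x. u x + t * v x)" _ 0 0] by (fastforce simp: field_simps)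
  have weak: "weak_solution p \<Omega> \<mu> u \<longleftrightarrow> (\<forall>v\<in>W01p p \<Omega>. dG v = \<mu> * dN v)" for \<mu>
    using assms(8) by (simp add: weak_solution_def dG_def dN_def)
  have hom: "(\<lambda>x. u x + t * u x) = (\<lambda>x. (1 + t) * u x)" for t by (simp add: fun_eq_iff algebra_simps)
  have dNu: "dN u = N"
  proof (rule has_derivative_at_0_of_homogeneous[OF DN[OF assms(8)]])
    show "enn2real (mixed_norm p (\<lambda>x. u x + t * u x)) = \<bar>1 + t\<bar> * N" for t
      unfolding hom by (simp add: mixed_norm_cmult[OF p0 U(1)] enn2real_mult N_def)
  qed
  have dGu: "dG u = G"
  proof (rule has_derivative_at_0_of_homogeneous[OF DG[OF assms(8)]])
    show "enn2real (grad_norm p (\<lambda>x. u x + t * u x)) = \<bar>1 + t\<bar> * G" for t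
    proof -
      have "Lp_norm (p i) (weak_partial i (\<lambda>x. u x + t * u x)) = ennreal \<bar>1 + t\<bar> * Lp_norm (p i) (weak_partial i u)" for i
      proof -
        have "Lp_norm (p i) (weak_partial i (\<lambda>x. u x + t * u x)) = Lp_norm (p i) (\<lambda>x. weak_partial i u x + t * weak_partial i u x)"
          by (rule Lp_norm_cong[OF weak_partial_eq_AE[OF has_weak_partial_add_scaled[OF U(3) U(3)]]])
        also have "(\<lambda>x. weak_partial i u x + t * weak_partial i u x) = (\<lambda>x. (1 + t) * weak_partial i u x)"
          by (simp add: fun_eq_iff algebra_simps)
        finally show ?thesis using Lp_norm_cmult[OF U(4) p0] by simp
      qed
      then have "grad_norm p (\<lambda>x. u x + t * u x) = ennreal \<bar>1 + t\<bar> * grad_norm p u"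
        by (simp add: grad_norm_def sum_distrib_left)
      then show ?thesis by (simp add: enn2real_mult G_def)
    qed
  qed
  \<comment> \<open>Equality of the two functionals at \<open>v = u\<close> determines the parameter.\<close>
  show ?thesis
  proof
    assume "critical_point p \<Omega> u"
    then have "weak_solution p \<Omega> (G / N) u"
      using crit by (simp add: critical_point_def weak)
    then show "\<exists>\<mu>. weak_solution p \<Omega> \<mu> u" ..
  next
    assume "\<exists>\<mu>. weak_solution p \<Omega> \<mu> u"
    then obtain \<mu> where \<mu>: "dG v = \<mu> * dN v" if "v \<in> W01p p \<Omega>" for v using weak by blast
    have "G = \<mu> * N" using \<mu>[OF assms(8)] dNu dGu by simp
    then have "\<mu> = G / N" using N by simp
    then show "critical_point p \<Omega> u"
      using \<mu> crit assms(8,9) by (simp add: critical_point_def)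
  qed
qed

end
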